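(* (1) $LE_\alpha(A,B)\prec_{\log}G_{\alpha,p}(A,B)$ for all $\alpha>1$, $p>0$ and $A,B\ge0$ with $s(A)\ge s(B)$. (2) For any $\alpha\in(0,1)$ and $p>0$ there exist $A,B\in\mathbb{M}_2^{++}$ such that $SG_{\alpha,p}(A,B)\not\prec_{\log}LE_\alpha(A,B)$. (3) For any $\alpha>1$ and $p>0$ there exist $A,B\in\mathbb{M}_2^{++}$ such that $LE_\alpha(A,B)\not\prec_{\log}SG_{\alpha,p}(A,B)$. (4) For any $\alpha\in(0,\infty)\setminus\{1\}$ and $p>0$ there exist $A,B\in\mathbb{M}_2^{++}$ such that $\widetilde{SG}_{\alpha,p}(A,B)\not\prec_{\log}LE_\alpha(A,B)$. (5) $LE_\alpha(A,B)\prec_{\log}\widetilde{SG}_{\alpha,p}(A,B)$ for all $\alpha\in(0,1/2]$, $p>0$ and $A,B\ge0$ with $s(A)\ge s(B)$. (6) $LE_\alpha(A,B)\prec_{\log}\widetilde{SG}_{\alpha,p}(A,B)$ for all $\alpha>1$, $p>0$ and $A,B\ge0$ with $s(A)\ge s(B)$.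
   Context: Notation: $\mathbb{M}_n$ is the set of $n\times n$ complex matrices, $\mathbb{M}_n^+$ (resp. $\mathbb{M}_n^{++}$) the positive semidefinite (resp. positive definite) ones. $A\ge0$ (resp. $A>0$) means $A\in\mathbb{M}_n^+$ (resp. $A\in\mathbb{M}_n^{++}$) for some $n\in\mathbb{N}$; matrices appearing together have the same size. $s(A)$ is the support projection of $A\ge0$. $A^{-1}$ denotes the generalized inverse (the inverse on the support of $A$, zero on the kernel), and $A^r:=(A^{-1})^{-r}$ for $r<0$. For $\alpha>0$ and $A,B\ge0$ with $s(A)\ge s(B)$, $A\#_\alpha B:=A^{1/2}(A^{-1/2}BA^{-1/2})^{\alpha}A^{1/2}$, and $\#:=\#_{1/2}$. For $s(A)\ge s(B)$: - $G_{\alpha,p}(A,B):=(A^p\#_\alpha B^p)^{1/p}$; - $SG_{\alpha,p}(A,B):=\bigl((A^{-p}\#B^p)^{\alpha}A^p(A^{-p}\#B^p)^{\alpha}\bigr)^{1/p}$; - $\widetilde{SG}_{\alpha,p}(A,B):=\bigl((A^{-p}\#_\alpha B^p)^{1/2}A^{2(1-\alpha)p}(A^{-p}\#_\alpha B^p)^{1/2}\bigr)^{1/p}$; - the Log-Euclidean mean is $LE_\alpha(A,B):=\exp((1-\alpha)\log A+\alpha\log B)$ for $A,B>0$, and in general $LE_\alpha(A,B):=P_0\exp\{(1-\alpha)P_0(\log A)P_0+\alpha P_0(\log B)P_0\}$ with $P_0:=s(A)\wedge s(B)$ (so $P_0=s(B)$ if $s(A)\ge s(B)$), where $\log A$ is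 taken on the support of $A$. Log-majorization: for $X,Y\in\mathbb{M}_n^+$ with eigenvalues $\lambda_1(\cdot)\ge\dots\ge\lambda_n(\cdot)$ counted with multiplicity, $X\prec_{\log}Y$ means $\prod_{i=1}^k\lambda_i(X)\le\prod_{i=1}^k\lambda_i(Y)$ for $1\le k\le n$, with equality for $k=n$. *)

theory Defs
  imports
    Complex_Main
    "HOL-Library.Multiset"
    "HOL-Computational_Algebra.Polynomial"
    "Jordan_Normal_Form.Char_Poly"
    "Jordan_Normal_Form.Schur_Decomposition"
begin

text \<open>In the order on \<^typ>\<open>complex\<close> used here, \<open>0 \<le> z\<close> means that \<open>z\<close> is real and nonnegative
  (likewise for \<open><\<close>).\<close>

definition psd_mats :: "nat \<Rightarrow> complex mat set" where
  "psd_mats n = {A \<in> carrier_mat n n. mat_adjoint A = A \<and>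
     (\<forall>v \<in> carrier_vec n. 0 \<le> (A *\<^sub>v v) \<bullet>c v)}"

definition pd_mats :: "nat \<Rightarrow> complex mat set" where
  "pd_mats n = {A \<in> carrier_mat n n. mat_adjoint A = A \<and>
     (\<forall>v \<in> carrier_vec n. v \<noteq> 0\<^sub>v n \<longrightarrow> 0 < (A *\<^sub>v v) \<bullet>c v)}"

definition loewner_le :: "complex mat \<Rightarrow> complex mat \<Rightarrow> bool" where
  "loewner_le A B \<longleftrightarrow> B - A \<in> psd_mats (dim_row A)"

definition unitary_mats :: "nat \<Rightarrow> complex mat set" where
  "unitary_mats n = {U \<in> carrier_mat n n.
     mat_adjoint U * U = 1\<^sub>m n \<and> U * mat_adjoint U = 1\<^sub>m n}"

text \<open>Functional calculus for Hermitian matrices: if \<open>A = U diag(d) U\<^sup>*\<close> with \<open>U\<close> unitary and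
  \<open>d\<close> real, then \<open>f(A) = U diag(f \<circ> d) U\<^sup>*\<close>. Independence of the diagonalization is
  \<open>mat_fun_eqI\<close> below.\<close>

definition mat_fun :: "(real \<Rightarrow> real) \<Rightarrow> complex mat \<Rightarrow> complex mat" where
  "mat_fun f A = (THE F. \<exists>U \<in> unitary_mats (dim_row A). \<exists>d :: nat \<Rightarrow> real.
     A = U * mat_diag (dim_row A) (\<lambda>i. complex_of_real (d i)) * mat_adjoint U \<and>
     F = U * mat_diag (dim_row A) (\<lambda>i. complex_of_real (f (d i))) * mat_adjoint U)"

definition mat_range :: "complex mat \<Rightarrow> complex vec set" where
  "mat_range A = {A *\<^sub>v v | v. v \<in> carrier_vec (dim_col A)}"

text \<open>The orthogonal projection onto a subspace \<open>V\<close> of \<open>\<complex>\<^sup>n\<close>; for uniqueness see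
  \<open>orth_proj_eqI\<close>.\<close>

definition orth_proj :: "nat \<Rightarrow> complex vec set \<Rightarrow> complex mat" where
  "orth_proj n V = (THE P. P \<in> carrier_mat n n \<and> mat_adjoint P = P \<and> P * P = P \<and>
     mat_range P = V)"

text \<open>For Hermitian \<open>A\<close> the range is the orthogonal complement of the kernel.\<close>

definition supp_proj :: "complex mat \<Rightarrow> complex mat" where
  "supp_proj A = orth_proj (dim_row A) (mat_range A)"

definition proj_meet :: "complex mat \<Rightarrow> complex mat \<Rightarrow> complex mat" where
  "proj_meet P Q = orth_proj (dim_row P) (mat_range P \<inter> mat_range Q)"

text \<open>The generalized inverse uses \<open>inverse 0 = 0\<close>; the powers use \<open>0 powr r = 0\<close>.
  In particular \<open>mat_powr A 0\<close> is the support projection of \<open>A\<close>.\<close>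

definition gen_inv :: "complex mat \<Rightarrow> complex mat" where
  "gen_inv A = mat_fun inverse A"

definition mat_powr :: "complex mat \<Rightarrow> real \<Rightarrow> complex mat" where
  "mat_powr A r = (if 0 \<le> r then mat_fun (\<lambda>x. x powr r) A
                   else mat_fun (\<lambda>x. x powr (- r)) (gen_inv A))"

definition mat_log :: "complex mat \<Rightarrow> complex mat" where
  "mat_log A = mat_fun (\<lambda>x. if x = 0 then 0 else ln x) A"

definition mat_exp :: "complex mat \<Rightarrow> complex mat" where
  "mat_exp A = mat_fun exp A"

definition geo_mean :: "real \<Rightarrow> complex mat \<Rightarrow> complex mat \<Rightarrow> complex mat" where
  "geo_mean \<alpha> A B =
     mat_powr A (1/2) * mat_powr (mat_powr A (- 1/2) * B * mat_powr A (- 1/2)) \<alpha> * mat_powr A (1/2)"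

definition G_mean :: "real \<Rightarrow> real \<Rightarrow> complex mat \<Rightarrow> complex mat \<Rightarrow> complex mat" where
  "G_mean \<alpha> p A B = mat_powr (geo_mean \<alpha> (mat_powr A p) (mat_powr B p)) (1/p)"

definition SG_mean :: "real \<Rightarrow> real \<Rightarrow> complex mat \<Rightarrow> complex mat \<Rightarrow> complex mat" where
  "SG_mean \<alpha> p A B =
     (let C = mat_powr (geo_mean (1/2) (mat_powr A (- p)) (mat_powr B p)) \<alpha>
      in mat_powr (C * mat_powr A p * C) (1/p))"

definition SGt_mean :: "real \<Rightarrow> real \<Rightarrow> complex mat \<Rightarrow> complex mat \<Rightarrow> complex mat" where
  "SGt_mean \<alpha> p A B =
     (let C = mat_powr (geo_mean \<alpha> (mat_powr A (- p)) (mat_powr B p)) (1/2)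
      in mat_powr (C * mat_powr A (2 * (1 - \<alpha>) * p) * C) (1/p))"

text \<open>For positive definite \<open>A\<close>, \<open>B\<close> the projection \<open>P\<close> is the identity and this is
  \<open>exp ((1 - \<alpha>) log A + \<alpha> log B)\<close>.\<close>

definition LE_mean :: "real \<Rightarrow> complex mat \<Rightarrow> complex mat \<Rightarrow> complex mat" where
  "LE_mean \<alpha> A B =
     (let P = proj_meet (supp_proj A) (supp_proj B)
      in P * mat_exp (complex_of_real (1 - \<alpha>) \<cdot>\<^sub>m (P * mat_log A * P) +
                      complex_of_real \<alpha> \<cdot>\<^sub>m (P * mat_log B * P)))"

text \<open>The eigenvalues with algebraic multiplicity, in decreasing order. Meant for Hermitian
  matrices, where taking real parts loses nothing.\<close>

definition eigvals_desc :: "complex mat \<Rightarrow> real list" where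
  "eigvals_desc A = rev (sorted_list_of_multiset (image_mset Re (proots (char_poly A))))"

text \<open>List positions start at 0, so \<open>eigvals_desc X ! i\<close> is \<open>\<lambda>\<^bsub>i+1\<^esub>(X)\<close>.\<close>

definition log_maj :: "nat \<Rightarrow> complex mat \<Rightarrow> complex mat \<Rightarrow> bool" where
  "log_maj n X Y \<longleftrightarrow>
     (\<forall>k \<in> {1..n}. (\<Prod>i<k. eigvals_desc X ! i) \<le> (\<Prod>i<k. eigvals_desc Y ! i)) \<and>
     (\<Prod>i<n. eigvals_desc X ! i) = (\<Prod>i<n. eigvals_desc Y ! i)"

lemma mat_adjoint_carrier [simp]:
  "A \<in> carrier_mat n m \<Longrightarrow> mat_adjoint A \<in> carrier_mat m n"
  unfolding mat_adjoint_def by auto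

lemma mat_adjoint_index [simp]:
  "i < dim_col A \<Longrightarrow> j < dim_row A \<Longrightarrow> mat_adjoint A $$ (i, j) = conjugate (A $$ (j, i))"
  unfolding mat_adjoint_def by (simp add: mat_of_rows_index)

lemma mat_adjoint_mult:
  fixes A B :: "complex mat"
  assumes "A \<in> carrier_mat n m" "B \<in> carrier_mat m k"
  shows "mat_adjoint (A * B) = mat_adjoint B * mat_adjoint A"
proof (rule eq_matI)
  have [simp]: "dim_row (mat_adjoint X) = dim_col X" "dim_col (mat_adjoint X) = dim_row X"
    for X :: "complex mat" unfolding mat_adjoint_def by auto
  show "dim_row (mat_adjoint (A * B)) = dim_row (mat_adjoint B * mat_adjoint A)"
    "dim_col (mat_adjoint (A * B)) = dim_col (mat_adjoint B * mat_adjoint A)"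
    by auto
  fix i j assume "i < dim_row (mat_adjoint B * mat_adjoint A)"
    "j < dim_col (mat_adjoint B * mat_adjoint A)"
  then have ij: "i < k" "j < n" using assms by auto
  show "mat_adjoint (A * B) $$ (i, j) = (mat_adjoint B * mat_adjoint A) $$ (i, j)"
    using ij assms
    by (auto simp: scalar_prod_def mult.commute intro!: sum.cong)
qed

lemma mat_fun_unique:
  fixes U V :: "complex mat" and d e :: "nat \<Rightarrow> real"
  assumes U: "U \<in> unitary_mats n" and V: "V \<in> unitary_mats n"
    and eq: "U * mat_diag n (\<lambda>i. complex_of_real (d i)) * mat_adjoint U =
             V * mat_diag n (\<lambda>i. complex_of_real (e i)) * mat_adjoint V"
  shows "U * mat_diag n (\<lambda>i. complex_of_real (f (d i))) * mat_adjoint U =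
         V * mat_diag n (\<lambda>i. complex_of_real (f (e i))) * mat_adjoint V"
proof -
  define D where "D g = mat_diag n (\<lambda>i. complex_of_real (g (d i)))" for g
  define E where "E g = mat_diag n (\<lambda>i. complex_of_real (g (e i)))" for g
  define W where "W = mat_adjoint V * U"
  have Uc: "U \<in> carrier_mat n n" and UU: "mat_adjoint U * U = 1\<^sub>m n" "U * mat_adjoint U = 1\<^sub>m n"
    using U unfolding unitary_mats_def by auto
  have Vc: "V \<in> carrier_mat n n" and VV: "mat_adjoint V * V = 1\<^sub>m n" "V * mat_adjoint V = 1\<^sub>m n"
    using V unfolding unitary_mats_def by auto
  have Ua: "mat_adjoint U \<in> carrier_mat n n" and Va: "mat_adjoint V \<in> carrier_mat n n"
    using Uc Vc by auto
  have Dc: "D g \<in> carrier_mat n n" "E g \<in> carrier_mat n n" for g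
    unfolding D_def E_def by auto
  have Wc: "W \<in> carrier_mat n n" unfolding W_def using Va Uc by auto
  have left: "mat_adjoint V * (U * D g * mat_adjoint U) * U = W * D g" for g
  proof -
    have "mat_adjoint V * (U * D g * mat_adjoint U) * U
        = W * D g * (mat_adjoint U * U)"
      unfolding W_def using Uc Ua Va Dc[of g]
      by (simp add: assoc_mult_mat[of _ n n _ n _ n] mult_carrier_mat[of _ n n _ n])
    then show ?thesis using UU Wc Dc[of g] by simp
  qed
  have right: "mat_adjoint V * (V * E g * mat_adjoint V) * U = E g * W" for g
  proof -
    have "mat_adjoint V * (V * E g * mat_adjoint V) * U
        = (mat_adjoint V * V) * (E g * W)"
      unfolding W_def using Uc Vc Va Dc[of g]
      by (simp add: assoc_mult_mat[of _ n n _ n _ n] mult_carrier_mat[of _ n n _ n])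
    then show ?thesis using VV Wc Dc[of g] by simp
  qed
  have WD: "W * D (\<lambda>x. x) = E (\<lambda>x. x) * W"
    using left[of "\<lambda>x. x"] right[of "\<lambda>x. x"] eq unfolding D_def E_def by simp
  have "W * D f = E f * W"
  proof (rule eq_matI)
    fix i j assume "i < dim_row (E f * W)" "j < dim_col (E f * W)"
    then have ij: "i < n" "j < n" using Wc Dc[of f] by auto
    have "(W * D (\<lambda>x. x)) $$ (i, j) = (E (\<lambda>x. x) * W) $$ (i, j)" using WD by simp
    then have "W $$ (i, j) * complex_of_real (d j) = complex_of_real (e i) * W $$ (i, j)"
      unfolding D_def E_def mat_diag_mult_right[OF Wc] mat_diag_mult_left[OF Wc] using ij by simp
    then have "W $$ (i, j) = 0 \<or> d j = e i" by (auto simp: mult.commute)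
    then show "(W * D f) $$ (i, j) = (E f * W) $$ (i, j)"
      unfolding D_def E_def mat_diag_mult_right[OF Wc] mat_diag_mult_left[OF Wc] using ij by auto
  qed (use Wc Dc[of f] in auto)
  then have *: "mat_adjoint V * (U * D f * mat_adjoint U) * U =
      mat_adjoint V * (V * E f * mat_adjoint V) * U"
    using left right by simp
  have cancel: "V * (mat_adjoint V * X * U) * mat_adjoint U = X" if X: "X \<in> carrier_mat n n" for X
  proof -
    have "V * (mat_adjoint V * X * U) * mat_adjoint U = (V * mat_adjoint V) * X * (U * mat_adjoint U)"
      using Uc Vc Ua Va X by (simp add: assoc_mult_mat[of _ n n _ n _ n] mult_carrier_mat[of _ n n _ n])
    then show ?thesis using UU VV X by simp
  qed
  have "U * D f * mat_adjoint U = V * E f * mat_adjoint V"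
    using cancel[of "U * D f * mat_adjoint U"] cancel[of "V * E f * mat_adjoint V"] *
      Uc Vc Ua Va Dc[of f] by (metis mult_carrier_mat)
  then show ?thesis unfolding D_def E_def .
qed

lemma mat_fun_eqI:
  assumes U: "U \<in> unitary_mats n"
    and A: "A = U * mat_diag n (\<lambda>i. complex_of_real (d i)) * mat_adjoint U"
  shows "mat_fun f A = U * mat_diag n (\<lambda>i. complex_of_real (f (d i))) * mat_adjoint U"
proof -
  have dim: "dim_row A = n" using U A unfolding unitary_mats_def by auto
  show ?thesis
    unfolding mat_fun_def dim
  proof (rule the_equality)
    show "\<exists>V\<in>unitary_mats n. \<exists>e. A = V * mat_diag n (\<lambda>i. complex_of_real (e i)) * mat_adjoint V \<and>
      U * mat_diag n (\<lambda>i. complex_of_real (f (d i))) * mat_adjoint U =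
      V * mat_diag n (\<lambda>i. complex_of_real (f (e i))) * mat_adjoint V"
      using U A by blast
  next
    fix F
    assume "\<exists>V\<in>unitary_mats n. \<exists>e. A = V * mat_diag n (\<lambda>i. complex_of_real (e i)) * mat_adjoint V \<and>
      F = V * mat_diag n (\<lambda>i. complex_of_real (f (e i))) * mat_adjoint V"
    then obtain V e where "V \<in> unitary_mats n"
      "A = V * mat_diag n (\<lambda>i. complex_of_real (e i)) * mat_adjoint V"
      "F = V * mat_diag n (\<lambda>i. complex_of_real (f (e i))) * mat_adjoint V" by blast
    then show "F = U * mat_diag n (\<lambda>i. complex_of_real (f (d i))) * mat_adjoint U"
      using mat_fun_unique[OF U, of V d e f] A by simp
  qed
qed

lemma proj_absorb:
  fixes P Q :: "complex mat"
  assumes P: "P \<in> carrier_mat n n" "P * P = P" and Q: "Q \<in> carrier_mat n n"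
    and sub: "mat_range Q \<subseteq> mat_range P"
  shows "P * Q = Q"
proof (rule eq_matI)
  fix i j assume "i < dim_row Q" "j < dim_col Q"
  then have ij: "i < n" "j < n" using Q by auto
  have "col Q j = Q *\<^sub>v unit_vec n j"
    using Q ij by (metis col_one col_mult2 one_carrier_mat right_mult_one_mat)
  moreover have "Q *\<^sub>v unit_vec n j \<in> mat_range Q"
    using Q unfolding mat_range_def by auto
  ultimately have "col Q j \<in> mat_range P" using sub by auto
  then obtain v where v: "col Q j = P *\<^sub>v v" "v \<in> carrier_vec n"
    using P unfolding mat_range_def by auto
  then have "P *\<^sub>v col Q j = col Q j"
    using P assoc_mult_mat_vec[of P n n P n v] by simp
  then have "col (P * Q) j = col Q j" using P Q ij col_mult2[of P n n Q n j] by simp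
  then show "(P * Q) $$ (i, j) = Q $$ (i, j)"
    using ij P(1) Q index_col[of i "P * Q" j] index_col[of i Q j] by simp
qed (use P Q in auto)

lemma orth_proj_eqI:
  fixes P :: "complex mat"
  assumes P: "P \<in> carrier_mat n n" "mat_adjoint P = P" "P * P = P" "mat_range P = V"
  shows "orth_proj n V = P"
  unfolding orth_proj_def
proof (rule the_equality)
  fix Q :: "complex mat"
  assume Q: "Q \<in> carrier_mat n n \<and> mat_adjoint Q = Q \<and> Q * Q = Q \<and> mat_range Q = V"
  have "P * Q = Q" using proj_absorb[of P n Q] P Q by simp
  moreover have "Q * P = P" using proj_absorb[of Q n P] P Q by simp
  ultimately show "Q = P" using mat_adjoint_mult[of P n n Q n] P Q by simp
qed (use P in simp)

end

theory Submission
  imports Defs "HOL-Analysis.Elementary_Metric_Spaces"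
begin

text \<open>
  \<^bold>\<open>Majorization.\<close> Rescaling the exponent reduces to \<open>p = 1\<close>, and replacing \<open>A\<close> by the identity on
  its kernel makes \<open>A\<close> invertible. Write the Log-Euclidean mean as \<open>P exp(K)\<close> with \<open>P = s(B)\<close>,
  and let \<open>R\<close> be the other mean, up to a change that keeps its eigenvalues. If \<open>\<alpha> > 1\<close>, the relation
  between \<open>R\<close> and \<open>B\<close> can be solved for \<open>B\<close> as an operator monotone function of \<open>R\<close>. For
  \<open>M = max(R e\<^bsup>-c\<^esup>, 1)\<close> we have \<open>R \<le> e\<^sup>c M\<close>, and the operator monotonicity of the logarithm yields
  \<open>K \<le> c P + P F P\<close> for some \<open>F \<ge> 0\<close> of trace \<open>ln det M\<close>. Taking \<open>e\<^sup>c\<close> to be the \<open>k\<close>-th eigenvalue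
  of \<open>R\<close>, the sum of the \<open>k\<close> largest eigenvalues of \<open>K\<close> is at most \<open>k c + ln det M\<close>, which is the sum
  of the logarithms of the \<open>k\<close> largest eigenvalues of \<open>R\<close>.

  If \<open>\<alpha> \<le> 1/2\<close>, the same argument compares \<open>P exp(K)\<close> with a power of \<open>A\<^bsup>1/2\<^esup> B\<^sup>t A\<^bsup>1/2\<^esup>\<close>, where
  \<open>t = \<alpha>/(1 - \<alpha>)\<close>; Furuta's inequality, applied to compound matrices, compares that with \<open>R\<close>.

  \<^bold>\<open>Counterexamples.\<close> Take \<open>A = diag(1, e\<^bsup>-s\<^esup>)\<close> and \<open>B\<close> close to the projection onto the line
  spanned by \<open>(1, 1)\<close>. The logarithm of the largest eigenvalue of the Log-Euclidean mean is then
  about \<open>-(1 - \<alpha>) s/2\<close>, which is compared with entries of the other means as \<open>s\<close> grows.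
\<close>

section \<open>The spectral theorem\<close>

text \<open>Feeding M instead of R into the solved relation turns B into an invertible matrix, and F
  is the sum of the logarithms of that matrix and of A with the weights of the mean. For M = 1 the
  two logarithms cancel, so M \<ge> 1 makes F \<ge> 0, and its trace is ln det M because the trace
  of a logarithm is the logarithm of the determinant. A singular B is the obstacle: monotonicity of
  the logarithm is used only on vectors in the range of B, which is where K acts. For \<alpha> < 1
  solving for B would need the power 1/\<alpha>, which is not operator monotone; in the comparison
  matrix B^t occurs linearly, so solving for it takes no power. Furuta's inequality by itself
  compares largest eigenvalues, and the largest eigenvalue of the k-th compound matrix is the
  product of the k largest eigenvalues. In the counterexamples the factor 1/2 in -(1 - \<alpha>) s/2
  is the average of log A over the line of (1, 1), whereas the bounds for the other means follow a
  single diagonal entry of A and have rate 0 or -(1 - \<alpha>) s.\<close>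

lemma mat_adjoint_dim [simp]:
  "dim_row (mat_adjoint A) = dim_col A" "dim_col (mat_adjoint A) = dim_row A"
  unfolding mat_adjoint_def by auto

lemma mat_adjoint_adjoint [simp]: "mat_adjoint (mat_adjoint A) = (A :: complex mat)"
  by (rule eq_matI) auto

lemma mat_diag_dims [simp]: "dim_row (mat_diag n f) = n" "dim_col (mat_diag n f) = n"
  by (simp_all add: mat_diag_def)

lemma mat_assoc:
  "dim_col A = dim_row B \<Longrightarrow> dim_col B = dim_row C \<Longrightarrow> A * B * C = A * (B * (C :: complex mat))"
  by (rule assoc_mult_mat[of _ "dim_row A" "dim_col A" _ "dim_col B" _ "dim_col C"]) auto

lemma mat_adjoint_times:
  "dim_col A = dim_row B \<Longrightarrow> mat_adjoint (A * B) = mat_adjoint B * mat_adjoint (A :: complex mat)"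
  by (rule mat_adjoint_mult[of _ "dim_row A" "dim_col A" _ "dim_col B"]) auto

lemma mat_adjoint_one [simp]: "mat_adjoint (1\<^sub>m n :: complex mat) = 1\<^sub>m n"
  by (rule eq_matI) auto

lemma mat_adjoint_add:
  "A \<in> carrier_mat n m \<Longrightarrow> B \<in> carrier_mat n m \<Longrightarrow>
     mat_adjoint (A + B :: complex mat) = mat_adjoint A + mat_adjoint B"
  by (rule eq_matI) auto

lemma mat_adjoint_smult: "mat_adjoint (c \<cdot>\<^sub>m A :: complex mat) = cnj c \<cdot>\<^sub>m mat_adjoint A"
  by (rule eq_matI) auto

lemma mat_adjoint_diag:
  "mat_adjoint (mat_diag n f :: complex mat) = mat_diag n (\<lambda>i. cnj (f i))"
  by (rule eq_matI) (auto simp: mat_diag_def)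

lemma cscalar_prod_sum:
  "(v :: complex vec) \<in> carrier_vec n \<Longrightarrow> w \<in> carrier_vec n \<Longrightarrow>
     v \<bullet>c w = (\<Sum>i<n. v $ i * cnj (w $ i))"
  by (auto simp: scalar_prod_def atLeast0LessThan)

lemma mult_mat_vec_index_sum:
  "A \<in> carrier_mat n m \<Longrightarrow> v \<in> carrier_vec m \<Longrightarrow> i < n \<Longrightarrow>
     (A *\<^sub>v v) $ i = (\<Sum>j<m. A $$ (i, j) * v $ j)"
  by (auto simp: scalar_prod_def atLeast0LessThan)

lemma mult_mat_index_sum:
  "A \<in> carrier_mat n m \<Longrightarrow> B \<in> carrier_mat m k \<Longrightarrow> i < n \<Longrightarrow> j < k \<Longrightarrow>
     (A * B) $$ (i, j) = (\<Sum>l<m. A $$ (i, l) * B $$ (l, j))"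
  by (auto simp: scalar_prod_def atLeast0LessThan)

lemma adjoint_cscalar_prod:
  fixes A :: "complex mat"
  assumes A: "A \<in> carrier_mat n m" and x: "x \<in> carrier_vec m" and y: "y \<in> carrier_vec n"
  shows "(A *\<^sub>v x) \<bullet>c y = x \<bullet>c (mat_adjoint A *\<^sub>v y)"
proof -
  have "(A *\<^sub>v x) \<bullet>c y = (\<Sum>i<n. \<Sum>j<m. A $$ (i, j) * x $ j * cnj (y $ i))"
    using assms by (simp add: cscalar_prod_sum[of _ n] mult_mat_vec_index_sum[of _ n m] sum_distrib_right
        del: index_mult_mat_vec)
  also have "\<dots> = (\<Sum>j<m. \<Sum>i<n. A $$ (i, j) * x $ j * cnj (y $ i))" by (rule sum.swap)
  also have "\<dots> = x \<bullet>c (mat_adjoint A *\<^sub>v y)"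
    using assms cscalar_prod_sum[of x m "mat_adjoint A *\<^sub>v y"]
      mult_mat_vec_carrier[OF mat_adjoint_carrier[OF A] y]
    by (simp add: mult_mat_vec_index_sum[of "mat_adjoint A" m n y] sum_distrib_left mult_ac
        del: index_mult_mat_vec)
  finally show ?thesis .
qed

lemma cscalar_prod_self:
  "(v :: complex vec) \<in> carrier_vec n \<Longrightarrow> v \<bullet>c v = of_real (\<Sum>i<n. (cmod (v $ i))\<^sup>2)"
  by (simp add: cscalar_prod_sum complex_norm_square[symmetric] del: of_real_power)

lemma cscalar_prod_self_Re:
  "(v :: complex vec) \<in> carrier_vec n \<Longrightarrow> Re (v \<bullet>c v) = (\<Sum>i<n. (cmod (v $ i))\<^sup>2)"
  by (simp add: cscalar_prod_self)

lemma cscalar_prod_self_nonneg: "(v :: complex vec) \<in> carrier_vec n \<Longrightarrow> 0 \<le> Re (v \<bullet>c v)"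
  by (simp add: cscalar_prod_self_Re sum_nonneg)

lemma cscalar_prod_self_pos:
  "(v :: complex vec) \<in> carrier_vec n \<Longrightarrow> v \<noteq> 0\<^sub>v n \<Longrightarrow> 0 < Re (v \<bullet>c v)"
  using conjugate_square_eq_0_vec[of v n] cscalar_prod_self[of v n]
  by (metis cscalar_prod_self_nonneg less_eq_real_def of_real_0 Re_complex_of_real)

section \<open>Hermitian and unitary matrices\<close>

definition herm_mats :: "nat \<Rightarrow> complex mat set" where
  "herm_mats n = {A \<in> carrier_mat n n. mat_adjoint A = A}"

lemma herm_carrier [simp]: "A \<in> herm_mats n \<Longrightarrow> A \<in> carrier_mat n n"
  and herm_adjoint: "A \<in> herm_mats n \<Longrightarrow> mat_adjoint A = A"
  by (auto simp: herm_mats_def)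

lemma hermI: "A \<in> carrier_mat n n \<Longrightarrow> mat_adjoint A = A \<Longrightarrow> A \<in> herm_mats n"
  unfolding herm_mats_def by blast

lemma unitary_carrier [simp]: "U \<in> unitary_mats n \<Longrightarrow> U \<in> carrier_mat n n"
  and unitary_left [simp]: "U \<in> unitary_mats n \<Longrightarrow> mat_adjoint U * U = 1\<^sub>m n"
  and unitary_right [simp]: "U \<in> unitary_mats n \<Longrightarrow> U * mat_adjoint U = 1\<^sub>m n"
  by (auto simp: unitary_mats_def)

lemma unitaryI:
  assumes "U \<in> carrier_mat n n" "mat_adjoint U * U = 1\<^sub>m n"
  shows "U \<in> unitary_mats n"
  unfolding unitary_mats_def using assms mat_mult_left_right_inverse[of "mat_adjoint U" n U] by simp

lemma unitary_one [simp]: "1\<^sub>m n \<in> unitary_mats n"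
  by (auto intro: unitaryI)

lemma unitary_adjoint [simp]: "U \<in> unitary_mats n \<Longrightarrow> mat_adjoint U \<in> unitary_mats n"
  by (rule unitaryI) auto

lemma unitary_mult:
  assumes "U \<in> unitary_mats n" "V \<in> unitary_mats n"
  shows "U * V \<in> unitary_mats n"
proof (rule unitaryI)
  have c: "U \<in> carrier_mat n n" "V \<in> carrier_mat n n" "mat_adjoint U \<in> carrier_mat n n"
    "mat_adjoint V \<in> carrier_mat n n" using assms by auto
  have "mat_adjoint (U * V) * (U * V) = mat_adjoint V * ((mat_adjoint U * U) * V)"
    using c by (simp add: mat_adjoint_times mat_assoc)
  then show "mat_adjoint (U * V) * (U * V) = 1\<^sub>m n"
    using assms c by simp
  show "U * V \<in> carrier_mat n n" using c by simp
qed

text \<open>The fundamental theorem of algebra gives a root of the characteristic polynomial. The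
  eigenvector is only nonzero; \<open>exists_unitary_hd\<close> normalizes it.\<close>

lemma exists_unit_eigenvector:
  fixes A :: "complex mat"
  assumes A: "A \<in> carrier_mat n n" and n: "n \<noteq> 0"
  obtains v e where "v \<in> carrier_vec n" "v \<noteq> 0\<^sub>v n" "A *\<^sub>v v = e \<cdot>\<^sub>v v"
proof -
  have "degree (char_poly A) = n" using degree_monic_char_poly[OF A] by simp
  then have "\<not> constant (poly (char_poly A))" using n by (simp add: constant_degree)
  then obtain e where "poly (char_poly A) e = 0" using fundamental_theorem_of_algebra by blast
  then have "eigenvalue A e" using eigenvalue_root_char_poly[OF A] by simp
  then show thesis using that A unfolding eigenvalue_def eigenvector_def by auto
qed

text \<open>Gram-Schmidt applied to a basis that starts with \<open>v\<close>, followed by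
  normalization of each vector; the first vector stays proportional to \<open>v\<close>.\<close>

lemma exists_unitary_hd:
  fixes v :: "complex vec"
  assumes v: "v \<in> carrier_vec n" and v0: "v \<noteq> 0\<^sub>v n"
  obtains W c where "W \<in> unitary_mats n" "col W 0 = c \<cdot>\<^sub>v v" "c \<noteq> 0"
proof -
  have n: "n \<noteq> 0" using v v0 by (metis carrier_vecD eq_vecI index_zero_vec(2) less_nat_zero_code)
  interpret cof_vec_space n "TYPE(complex)" .
  define b where "b = basis_completion v"
  define ws where "ws = gram_schmidt n b"
  from basis_completion[OF v v0, folded b_def]
  have span_b: "span (set b) = carrier_vec n" and dist_b: "distinct b"
    and indep: "\<not> lin_dep (set b)" and b: "set b \<subseteq> carrier_vec n" and hdb: "hd b = v"
    and len_b: "length b = n" by auto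
  from hdb len_b n obtain vs where bv: "b = v # vs" by (cases b, auto)
  from gram_schmidt_result[OF b dist_b indep refl, folded ws_def]
  have ws: "set ws \<subseteq> carrier_vec n" "corthogonal ws" "length ws = n"
    by (auto simp: len_b)
  from gram_schmidt_hd[OF v, of vs, folded bv] have hdws: "hd ws = v" unfolding ws_def .
  define s where "s i = 1 / sqrt (Re (ws ! i \<bullet>c ws ! i))" for i
  have wsc: "ws ! i \<in> carrier_vec n" if "i < n" for i using ws that by auto
  have orth: "(ws ! i \<bullet>c ws ! j = 0) \<longleftrightarrow> i \<noteq> j" if "i < n" "j < n" for i j
    using corthogonalD[OF ws(2)] that ws(3) by simp
  have wpos: "0 < Re (ws ! i \<bullet>c ws ! i)" if i: "i < n" for i
  proof -
    have "ws ! i \<bullet>c ws ! i \<noteq> 0" using orth[OF i i] by simp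
    then have "ws ! i \<noteq> 0\<^sub>v n" by auto
    then show ?thesis using cscalar_prod_self_pos[OF wsc[OF i]] by simp
  qed
  define W where "W = mat n n (\<lambda>(a,i). of_real (s i) * (ws ! i) $ a)"
  have W: "W \<in> carrier_mat n n" by (simp add: W_def)
  have "W \<in> unitary_mats n"
  proof (rule unitaryI[OF W], rule eq_matI)
    fix i j assume "i < dim_row (1\<^sub>m n :: complex mat)" "j < dim_col (1\<^sub>m n :: complex mat)"
    then have ij: "i < n" "j < n" by auto
    have "(mat_adjoint W * W) $$ (i, j) = (\<Sum>a<n. cnj (W $$ (a, i)) * W $$ (a, j))"
      using ij W by (subst mult_mat_index_sum[of _ n n _ n]) auto
    also have "\<dots> = of_real (s i) * of_real (s j) * (\<Sum>a<n. (ws ! j) $ a * cnj ((ws ! i) $ a))"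
      using ij by (simp add: W_def sum_distrib_left mult_ac)
    also have "\<dots> = of_real (s i) * of_real (s j) * (ws ! j \<bullet>c ws ! i)"
      using ij wsc by (simp add: cscalar_prod_sum[of _ n])
    also have "\<dots> = 1\<^sub>m n $$ (i, j)"
    proof (cases "i = j")
      case True
      define r where "r = Re (ws ! i \<bullet>c ws ! i)"
      have r: "r > 0" using wpos ij r_def by simp
      have "ws ! i \<bullet>c ws ! i = of_real r"
        using cscalar_prod_self[OF wsc[OF ij(1)]] by (simp add: r_def)
      moreover have "s i * s i * r = 1"
        using r by (simp add: s_def r_def[symmetric])
      ultimately show ?thesis using True ij
        by (metis index_one_mat(1) of_real_1 of_real_mult)
    next
      case False
      then show ?thesis using orth[OF ij(2,1)] ij by simp
    qed
    finally show "(mat_adjoint W * W) $$ (i, j) = 1\<^sub>m n $$ (i, j)" .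
  qed (use W in auto)
  moreover have "col W 0 = of_real (s 0) \<cdot>\<^sub>v v"
  proof -
    have "ws ! 0 = v" using hdws ws(3) n by (metis hd_conv_nth length_0_conv)
    then show ?thesis using n v by (intro eq_vecI) (auto simp: W_def)
  qed
  moreover have "s 0 \<noteq> 0" using wpos[of 0] n by (simp add: s_def)
  ultimately show thesis using that by (metis of_real_eq_0_iff)
qed

abbreviation rdiag :: "nat \<Rightarrow> (nat \<Rightarrow> real) \<Rightarrow> complex mat" where
  "rdiag n d \<equiv> mat_diag n (\<lambda>i. complex_of_real (d i))"

text \<open>The block diagonal sum of the 1 by 1 block \<open>a\<close> and \<open>M\<close>. It
  carries a diagonalization of \<open>M\<close> to the next dimension.\<close>

definition dsum1 :: "complex \<Rightarrow> complex mat \<Rightarrow> complex mat" where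
  "dsum1 a M = mat (Suc (dim_row M)) (Suc (dim_col M))
     (\<lambda>(i,j). case (i, j) of (0, 0) \<Rightarrow> a | (Suc i, Suc j) \<Rightarrow> M $$ (i, j) | _ \<Rightarrow> 0)"

lemma dsum1_carrier: "M \<in> carrier_mat m m \<Longrightarrow> dsum1 a M \<in> carrier_mat (Suc m) (Suc m)"
  by (auto simp: dsum1_def)

lemma dsum1_adjoint:
  "M \<in> carrier_mat m m \<Longrightarrow> mat_adjoint (dsum1 a M) = dsum1 (cnj a) (mat_adjoint M)"
  by (intro eq_matI) (auto simp: dsum1_def split: nat.splits)

lemma dsum1_one: "dsum1 1 (1\<^sub>m m) = 1\<^sub>m (Suc m)"
  by (intro eq_matI) (auto simp: dsum1_def split: nat.splits)

lemma dsum1_mult: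
  assumes "M \<in> carrier_mat m m" "N \<in> carrier_mat m m"
  shows "dsum1 a M * dsum1 b N = dsum1 (a * b) (M * N)"
proof (rule eq_matI)
  fix i j assume "i < dim_row (dsum1 (a * b) (M * N))" "j < dim_col (dsum1 (a * b) (M * N))"
  then have ij: "i < Suc m" "j < Suc m" using assms by (auto simp: dsum1_def)
  have "(dsum1 a M * dsum1 b N) $$ (i, j) = (\<Sum>l<Suc m. dsum1 a M $$ (i, l) * dsum1 b N $$ (l, j))"
    by (rule mult_mat_index_sum[OF dsum1_carrier[OF assms(1)] dsum1_carrier[OF assms(2)] ij])
  also have "\<dots> = dsum1 a M $$ (i, 0) * dsum1 b N $$ (0, j)
      + (\<Sum>l<m. dsum1 a M $$ (i, Suc l) * dsum1 b N $$ (Suc l, j))"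
    by (rule sum.lessThan_Suc_shift)
  also have "\<dots> = dsum1 (a * b) (M * N) $$ (i, j)"
    using ij assms mult_mat_index_sum[OF assms]
    by (cases i; cases j) (auto simp: dsum1_def simp del: index_mult_mat(1))
  finally show "(dsum1 a M * dsum1 b N) $$ (i, j) = dsum1 (a * b) (M * N) $$ (i, j)" .
qed (use assms in \<open>auto simp: dsum1_def\<close>)

text \<open>Deflation: in an orthonormal basis that starts with an eigenvector, column 0 vanishes
  below the diagonal, hermiticity clears row 0 as well, and the induction hypothesis diagonalizes
  the remaining block.\<close>

theorem spectral_theorem:
  assumes "A \<in> herm_mats n"
  shows "\<exists>U \<in> unitary_mats n. \<exists>d. A = U * rdiag n d * mat_adjoint U"
  using assms
proof (induction n arbitrary: A)
  case 0
  then have "A = 1\<^sub>m 0 * rdiag 0 (\<lambda>_. 0 :: real) * mat_adjoint (1\<^sub>m 0)"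
    by (intro eq_matI) (auto dest: herm_carrier)
  then show ?case by (intro bexI[of _ "1\<^sub>m 0"] exI[of _ "\<lambda>_. 0 :: real"]) auto
next
  case (Suc m)
  let ?n = "Suc m"
  have A: "A \<in> carrier_mat ?n ?n" and Ah: "mat_adjoint A = A"
    using Suc.prems by (auto simp: herm_adjoint)
  obtain v e where v: "v \<in> carrier_vec ?n" "v \<noteq> 0\<^sub>v ?n" "A *\<^sub>v v = e \<cdot>\<^sub>v v"
    using exists_unit_eigenvector[OF A] by blast
  obtain W c where W: "W \<in> unitary_mats ?n" "col W 0 = c \<cdot>\<^sub>v v" "c \<noteq> 0"
    using exists_unitary_hd[OF v(1,2)] by blast
  have Wc: "W \<in> carrier_mat ?n ?n" and Wa: "mat_adjoint W \<in> carrier_mat ?n ?n" using W by auto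
  define B where "B = mat_adjoint W * (A * W)"
  have B: "B \<in> carrier_mat ?n ?n" using Wc Wa A B_def by auto
  have Bh: "mat_adjoint B = B"
    unfolding B_def using Wc Wa A Ah
    by (simp add: mat_adjoint_times mat_assoc)
  have AB: "A = W * B * mat_adjoint W"
  proof -
    have "W * B * mat_adjoint W = (W * mat_adjoint W) * A * (W * mat_adjoint W)"
      unfolding B_def using Wc Wa A by (simp add: mat_assoc)
    then show ?thesis using W A by simp
  qed
  have col0: "B $$ (i, 0) = (if i = 0 then e else 0)" if i: "i < ?n" for i
  proof -
    have "col (A * W) 0 = A *\<^sub>v (c \<cdot>\<^sub>v v)" using col_mult2[OF A Wc, of 0] W(2) by simp
    also have "\<dots> = e \<cdot>\<^sub>v col W 0"
      using A v W(2) by (simp add: mult_mat_vec[of _ ?n ?n] smult_smult_assoc mult.commute)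
    finally have c0: "col (A * W) 0 = e \<cdot>\<^sub>v col W 0" .
    have "B $$ (i, 0) = row (mat_adjoint W) i \<bullet> (e \<cdot>\<^sub>v col W 0)"
      using i B A Wc unfolding B_def by (simp add: c0)
    also have "\<dots> = e * (mat_adjoint W * W) $$ (i, 0)"
      using i Wc by (simp add: scalar_prod_smult_distrib[of _ ?n])
    finally show ?thesis using W i by simp
  qed
  have e_real: "cnj e = e"
    using col0[of 0] Bh B mat_adjoint_index[of 0 B 0] by simp
  have row0: "B $$ (0, j) = (if j = 0 then e else 0)" if j: "j < ?n" for j
    using col0[OF j] mat_adjoint_index[of 0 B j] Bh B e_real j by (auto split: if_splits)
  define A3 where "A3 = mat m m (\<lambda>(i,j). B $$ (Suc i, Suc j))"
  have A3h: "A3 \<in> herm_mats m"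
  proof (rule hermI)
    show "mat_adjoint A3 = A3"
    proof (rule eq_matI)
      fix i j assume "i < dim_row A3" "j < dim_col A3"
      then show "mat_adjoint A3 $$ (i, j) = A3 $$ (i, j)"
        using mat_adjoint_index[of "Suc i" B "Suc j"] Bh B by (auto simp: A3_def)
    qed (auto simp: A3_def)
  qed (auto simp: A3_def)
  from Suc.IH[OF A3h] obtain V d where V: "V \<in> unitary_mats m"
    and A3: "A3 = V * rdiag m d * mat_adjoint V" by blast
  define V' where "V' = dsum1 1 V"
  define d' where "d' = (\<lambda>i. case i of 0 \<Rightarrow> Re e | Suc i \<Rightarrow> d i)"
  have Vc: "V \<in> carrier_mat m m" "mat_adjoint V \<in> carrier_mat m m" using V by auto
  have V'c: "V' \<in> carrier_mat ?n ?n" using Vc by (simp add: V'_def dsum1_carrier)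
  have V'a: "mat_adjoint V' = dsum1 1 (mat_adjoint V)"
    unfolding V'_def using dsum1_adjoint[OF Vc(1), of 1] by simp
  have V'u: "V' \<in> unitary_mats ?n"
  proof (rule unitaryI[OF V'c])
    show "mat_adjoint V' * V' = 1\<^sub>m ?n"
      unfolding V'a unfolding V'_def dsum1_mult[OF Vc(2,1)] using V by (simp add: dsum1_one)
  qed
  have eD: "complex_of_real (Re e) = e" using e_real by (metis complex_is_Real_iff Reals_cnj_iff of_real_Re)
  have D': "rdiag ?n d' = dsum1 e (rdiag m d)"
    by (intro eq_matI) (auto simp: mat_diag_def dsum1_def d'_def eD split: nat.splits)
  have "V' * rdiag ?n d' * mat_adjoint V' = dsum1 e A3"
    unfolding V'a D' unfolding V'_def A3 using Vc
    by (simp add: dsum1_mult[of _ m] mult_carrier_mat[of _ m m _ m])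
  also have "\<dots> = B"
  proof (rule eq_matI)
    fix i j assume "i < dim_row B" "j < dim_col B"
    then show "dsum1 e A3 $$ (i, j) = B $$ (i, j)"
      using B col0 row0 by (cases i; cases j) (auto simp: A3_def dsum1_def)
  qed (use B in \<open>auto simp: A3_def dsum1_def\<close>)
  finally have "A = W * (V' * rdiag ?n d' * mat_adjoint V') * mat_adjoint W" using AB by simp
  also have "\<dots> = (W * V') * rdiag ?n d' * mat_adjoint (W * V')"
    using Wc V'c Wa mat_diag_dim[of ?n] mat_adjoint_carrier[OF V'c]
    by (simp add: mat_adjoint_times mat_assoc)
  finally show ?case using unitary_mult[OF W(1) V'u] by blast
qed

section \<open>Quadratic forms and functional calculus\<close>

lemma unitary_dim [simp]: "U \<in> unitary_mats n \<Longrightarrow> dim_row U = n" "U \<in> unitary_mats n \<Longrightarrow> dim_col U = n"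
  using unitary_carrier by blast+

lemma herm_dim [simp]: "A \<in> herm_mats n \<Longrightarrow> dim_row A = n" "A \<in> herm_mats n \<Longrightarrow> dim_col A = n"
  using herm_carrier by blast+

lemma mult_square_carrier [simp]:
  "A \<in> carrier_mat n n \<Longrightarrow> B \<in> carrier_mat n n \<Longrightarrow> A * B \<in> carrier_mat n n"
  by (rule mult_carrier_mat)

lemma mult_square_vec_carrier [simp]:
  "A \<in> carrier_mat n n \<Longrightarrow> v \<in> carrier_vec n \<Longrightarrow> A *\<^sub>v v \<in> carrier_vec n"
  by (rule mult_mat_vec_carrier)

lemma mat_mult_smult:
  "dim_col A = dim_row B \<Longrightarrow> A * (c \<cdot>\<^sub>m B) = c \<cdot>\<^sub>m (A * (B :: complex mat))"
  by (rule mult_smult_distrib[of _ "dim_row A" "dim_col A" _ "dim_col B"]) auto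

lemma mat_smult_mult:
  "dim_col A = dim_row B \<Longrightarrow> (c \<cdot>\<^sub>m A) * B = c \<cdot>\<^sub>m (A * (B :: complex mat))"
  by (rule mult_smult_assoc_mat[of _ "dim_row A" "dim_col A" _ "dim_col B"]) auto

lemma mat_mult_add:
  "dim_col A = dim_row B \<Longrightarrow> dim_row B = dim_row C \<Longrightarrow> dim_col B = dim_col C \<Longrightarrow>
     A * (B + C) = A * B + A * (C :: complex mat)"
  by (rule mult_add_distrib_mat[of _ "dim_row A" "dim_col A" _ "dim_col B"]) auto

lemma mat_add_mult:
  "dim_row A = dim_row B \<Longrightarrow> dim_col A = dim_col B \<Longrightarrow> dim_col B = dim_row C \<Longrightarrow>
     (A + B) * C = A * C + B * (C :: complex mat)"
  by (rule add_mult_distrib_mat[of _ "dim_row A" "dim_col A" _ _ "dim_col C"]) auto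

section \<open>The Loewner order as an order of quadratic forms\<close>

definition qform :: "complex mat \<Rightarrow> complex vec \<Rightarrow> real" where
  "qform X v = Re ((X *\<^sub>v v) \<bullet>c v)"

text \<open>Neither hermiticity nor a carrier is built into this form of the Loewner order, so
  transitivity holds unconditionally.\<close>

definition qle :: "nat \<Rightarrow> complex mat \<Rightarrow> complex mat \<Rightarrow> bool" where
  "qle n X Y \<longleftrightarrow> (\<forall>v \<in> carrier_vec n. qform X v \<le> qform Y v)"

lemma qleI: "(\<And>v. v \<in> carrier_vec n \<Longrightarrow> qform X v \<le> qform Y v) \<Longrightarrow> qle n X Y"
  by (simp add: qle_def)

lemma qleD: "qle n X Y \<Longrightarrow> v \<in> carrier_vec n \<Longrightarrow> qform X v \<le> qform Y v"
  by (simp add: qle_def)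

lemma qle_trans [trans]: "qle n X Y \<Longrightarrow> qle n Y Z \<Longrightarrow> qle n X Z"
  by (force simp: qle_def)

lemma smult_mat_mat_vec:
  "X \<in> carrier_mat n m \<Longrightarrow> v \<in> carrier_vec m \<Longrightarrow> (c \<cdot>\<^sub>m X) *\<^sub>v v = c \<cdot>\<^sub>v (X *\<^sub>v (v :: complex vec))"
  by (intro eq_vecI) auto

lemma qform_add:
  "X \<in> carrier_mat n n \<Longrightarrow> Y \<in> carrier_mat n n \<Longrightarrow> v \<in> carrier_vec n \<Longrightarrow>
     qform (X + Y) v = qform X v + qform Y v"
  unfolding qform_def
  by (simp add: add_mult_distrib_mat_vec[of _ n n] add_scalar_prod_distrib[of _ n])

lemma qform_smult:
  "X \<in> carrier_mat n n \<Longrightarrow> v \<in> carrier_vec n \<Longrightarrow>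
     qform (complex_of_real c \<cdot>\<^sub>m X) v = c * qform X v"
  unfolding qform_def by (simp add: smult_mat_mat_vec)

lemma qform_one: "v \<in> carrier_vec n \<Longrightarrow> qform (1\<^sub>m n) v = Re (v \<bullet>c v)"
  unfolding qform_def by simp

lemma qform_congruence:
  assumes "X \<in> carrier_mat n n" "K \<in> carrier_mat n n" "v \<in> carrier_vec n"
  shows "qform (K * X * mat_adjoint K) v = qform X (mat_adjoint K *\<^sub>v v)"
proof -
  have c: "mat_adjoint K \<in> carrier_mat n n" "mat_adjoint K *\<^sub>v v \<in> carrier_vec n"
    "X *\<^sub>v (mat_adjoint K *\<^sub>v v) \<in> carrier_vec n"
    using assms by (auto intro!: mult_mat_vec_carrier[of _ n n])
  have "K * X * mat_adjoint K *\<^sub>v v = K *\<^sub>v (X *\<^sub>v (mat_adjoint K *\<^sub>v v))"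
    using assms c by (simp add: assoc_mult_mat_vec[of _ n n _ n])
  then show ?thesis
    unfolding qform_def using adjoint_cscalar_prod[OF assms(2) c(3) assms(3)] by simp
qed

lemma qle_congruence:
  assumes "qle n X Y" "X \<in> carrier_mat n n" "Y \<in> carrier_mat n n" "K \<in> carrier_mat n n"
  shows "qle n (K * X * mat_adjoint K) (K * Y * mat_adjoint K)"
proof (rule qleI)
  fix v :: "complex vec" assume v: "v \<in> carrier_vec n"
  then have "mat_adjoint K *\<^sub>v v \<in> carrier_vec n"
    using assms mult_mat_vec_carrier mat_adjoint_carrier by blast
  then show "qform (K * X * mat_adjoint K) v \<le> qform (K * Y * mat_adjoint K) v"
    using assms v qform_congruence qleD by simp
qed

lemma qle_congruence_herm:
  assumes "qle n X Y" "X \<in> carrier_mat n n" "Y \<in> carrier_mat n n" "K \<in> herm_mats n"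
  shows "qle n (K * X * K) (K * Y * K)"
  using qle_congruence[OF assms(1-3), of K] assms(4) by (simp add: herm_adjoint)

lemma qle_smult:
  "qle n X Y \<Longrightarrow> 0 \<le> c \<Longrightarrow> X \<in> carrier_mat n n \<Longrightarrow> Y \<in> carrier_mat n n \<Longrightarrow>
     qle n (complex_of_real c \<cdot>\<^sub>m X) (complex_of_real c \<cdot>\<^sub>m Y)"
  by (simp add: qle_def qform_smult mult_left_mono)

lemma herm_congruence:
  assumes "X \<in> herm_mats n" "K \<in> carrier_mat n n"
  shows "K * X * mat_adjoint K \<in> herm_mats n"
proof (rule hermI)
  have c: "X \<in> carrier_mat n n" "mat_adjoint K \<in> carrier_mat n n" using assms by auto
  then show "K * X * mat_adjoint K \<in> carrier_mat n n"
    using assms(2) by (intro mult_carrier_mat[of _ n n])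
  show "mat_adjoint (K * X * mat_adjoint K) = K * X * mat_adjoint K"
    using assms c by (simp add: mat_adjoint_times mat_assoc herm_adjoint)
qed

lemma herm_congruence':
  "X \<in> herm_mats n \<Longrightarrow> K \<in> herm_mats n \<Longrightarrow> K * X * K \<in> herm_mats n"
  using herm_congruence[of X n K] by (simp add: herm_adjoint)

lemma herm_add: "X \<in> herm_mats n \<Longrightarrow> Y \<in> herm_mats n \<Longrightarrow> X + Y \<in> herm_mats n"
  by (rule hermI) (auto simp: herm_adjoint mat_adjoint_add[of _ n n])

lemma herm_smult: "X \<in> herm_mats n \<Longrightarrow> complex_of_real c \<cdot>\<^sub>m X \<in> herm_mats n"
  by (rule hermI) (auto simp: herm_adjoint mat_adjoint_smult)

lemma herm_one [simp]: "1\<^sub>m n \<in> herm_mats n"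
  by (rule hermI) auto

lemma herm_rdiag [simp]: "rdiag n d \<in> herm_mats n"
  by (rule hermI) (auto simp: mat_adjoint_diag)

lemma herm_spectral: "U \<in> unitary_mats n \<Longrightarrow> U * rdiag n d * mat_adjoint U \<in> herm_mats n"
  by (rule herm_congruence) auto

lemma herm_qform_complex:
  assumes "X \<in> herm_mats n" "v \<in> carrier_vec n"
  shows "(X *\<^sub>v v) \<bullet>c v = complex_of_real (qform X v)"
proof -
  have c: "X *\<^sub>v v \<in> carrier_vec n" using assms mult_mat_vec_carrier herm_carrier by blast
  have "(X *\<^sub>v v) \<bullet>c v = v \<bullet>c (X *\<^sub>v v)"
    using adjoint_cscalar_prod[of X n n v v] assms by (simp add: herm_adjoint)
  also have "\<dots> = cnj ((X *\<^sub>v v) \<bullet>c v)"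
    using c assms by (simp add: cscalar_prod_sum[of _ n] mult.commute)
  finally have "(X *\<^sub>v v) \<bullet>c v \<in> \<real>" by (metis Reals_cnj_iff)
  then show ?thesis unfolding qform_def by (simp add: of_real_Re)
qed

lemma psd_iff: "A \<in> psd_mats n \<longleftrightarrow> A \<in> herm_mats n \<and> (\<forall>v \<in> carrier_vec n. 0 \<le> qform A v)"
proof -
  have "A \<in> psd_mats n \<longleftrightarrow> A \<in> herm_mats n \<and> (\<forall>v \<in> carrier_vec n. 0 \<le> (A *\<^sub>v v) \<bullet>c v)"
    unfolding psd_mats_def herm_mats_def by blast
  also have "\<dots> \<longleftrightarrow> A \<in> herm_mats n \<and> (\<forall>v \<in> carrier_vec n. 0 \<le> qform A v)"
    by (intro conj_cong refl ball_cong) (simp add: herm_qform_complex less_eq_complex_def)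
  finally show ?thesis .
qed

lemma pd_iff: "A \<in> pd_mats n \<longleftrightarrow>
    A \<in> herm_mats n \<and> (\<forall>v \<in> carrier_vec n. v \<noteq> 0\<^sub>v n \<longrightarrow> 0 < qform A v)"
proof -
  have "A \<in> pd_mats n \<longleftrightarrow>
      A \<in> herm_mats n \<and> (\<forall>v \<in> carrier_vec n. v \<noteq> 0\<^sub>v n \<longrightarrow> 0 < (A *\<^sub>v v) \<bullet>c v)"
    unfolding pd_mats_def herm_mats_def by blast
  also have "\<dots> \<longleftrightarrow> A \<in> herm_mats n \<and> (\<forall>v \<in> carrier_vec n. v \<noteq> 0\<^sub>v n \<longrightarrow> 0 < qform A v)"
    by (intro conj_cong imp_cong refl ball_cong) (simp add: herm_qform_complex less_complex_def)
  finally show ?thesis .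
qed

lemma psd_herm [simp]: "A \<in> psd_mats n \<Longrightarrow> A \<in> herm_mats n"
  and pd_herm [simp]: "A \<in> pd_mats n \<Longrightarrow> A \<in> herm_mats n"
  and psd_carrier [simp]: "A \<in> psd_mats n \<Longrightarrow> A \<in> carrier_mat n n"
  and pd_carrier [simp]: "A \<in> pd_mats n \<Longrightarrow> A \<in> carrier_mat n n"
  by (auto simp: psd_iff pd_iff)

lemma psd_dim [simp]: "A \<in> psd_mats n \<Longrightarrow> dim_row A = n" "A \<in> psd_mats n \<Longrightarrow> dim_col A = n"
  and pd_dim [simp]: "A \<in> pd_mats n \<Longrightarrow> dim_row A = n" "A \<in> pd_mats n \<Longrightarrow> dim_col A = n"
  using psd_carrier pd_carrier by blast+

lemma qform_zero_vec: "X \<in> carrier_mat n n \<Longrightarrow> qform X (0\<^sub>v n) = 0"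
  unfolding qform_def by (metis conjugate_zero_vec mult_mat_vec_carrier scalar_prod_right_zero zero_carrier_vec zero_complex.simps(1))

lemma pd_imp_psd [simp]: "A \<in> pd_mats n \<Longrightarrow> A \<in> psd_mats n"
  unfolding psd_iff pd_iff
  using qform_zero_vec[of A n] by (metis herm_carrier less_eq_real_def)

text \<open>The squared moduli of the coordinates of \<open>v\<close> in the orthonormal basis of
  the columns of \<open>U\<close>. They are nonnegative weights that turn quadratic forms of
  functions of a matrix into weighted sums of scalars.\<close>

definition coord :: "complex mat \<Rightarrow> complex vec \<Rightarrow> nat \<Rightarrow> real" where
  "coord U v i = (cmod ((mat_adjoint U *\<^sub>v v) $ i))\<^sup>2"

lemma coord_nonneg [simp]: "0 \<le> coord U v i"
  by (simp add: coord_def)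

lemma mat_diag_mult_vec:
  "v \<in> carrier_vec n \<Longrightarrow> i < n \<Longrightarrow> (mat_diag n f *\<^sub>v v) $ i = f i * (v $ i :: complex)"
  by (subst mult_mat_vec_index_sum[of _ n n]) (auto simp: mat_diag_def if_distrib[of "\<lambda>x. x * _"] cong: if_cong)

lemma qform_rdiag:
  assumes "v \<in> carrier_vec n"
  shows "qform (rdiag n d) v = (\<Sum>i<n. d i * (cmod (v $ i))\<^sup>2)"
proof -
  have "rdiag n d *\<^sub>v v \<in> carrier_vec n" using assms mult_mat_vec_carrier mat_diag_dim by blast
  then have "(rdiag n d *\<^sub>v v) \<bullet>c v = (\<Sum>i<n. complex_of_real (d i) * v $ i * cnj (v $ i))"
    using assms by (simp add: cscalar_prod_sum[of _ n] mat_diag_mult_vec del: index_mult_mat_vec)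
  also have "\<dots> = complex_of_real (\<Sum>i<n. d i * (cmod (v $ i))\<^sup>2)"
    by (simp add: mult.assoc complex_norm_square[symmetric] del: of_real_power)
  finally show ?thesis unfolding qform_def by simp
qed

lemma qform_spectral:
  assumes "U \<in> unitary_mats n" "v \<in> carrier_vec n"
  shows "qform (U * rdiag n d * mat_adjoint U) v = (\<Sum>i<n. d i * coord U v i)"
proof -
  have "mat_adjoint U *\<^sub>v v \<in> carrier_vec n"
    using assms mult_mat_vec_carrier[of "mat_adjoint U" n n v] by simp
  then show ?thesis
    using assms by (simp add: qform_congruence[of _ n] qform_rdiag coord_def del: index_mult_mat_vec)
qed

lemma sum_coord:
  assumes "U \<in> unitary_mats n" "v \<in> carrier_vec n"
  shows "(\<Sum>i<n. coord U v i) = Re (v \<bullet>c v)"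
  using qform_spectral[OF assms, of "\<lambda>_. 1"] assms
    right_mult_one_mat[OF unitary_carrier[OF assms(1)]] by (simp add: qform_one)

lemma coord_col:
  assumes "U \<in> unitary_mats n" "i < n" "j < n"
  shows "coord U (col U j) i = (if i = j then 1 else 0)"
proof -
  have "row (mat_adjoint U) i \<bullet> col U j = (mat_adjoint U * U) $$ (i, j)"
    using assms by (subst index_mult_mat) auto
  then have *: "(mat_adjoint U *\<^sub>v col U j) $ i = 1\<^sub>m n $$ (i, j)"
    unfolding unitary_left[OF assms(1)] using assms by simp
  show ?thesis unfolding coord_def * using assms by simp
qed

lemma spectral_col:
  assumes U: "U \<in> unitary_mats n" and j: "j < n"
  shows "(U * mat_diag n f * mat_adjoint U) *\<^sub>v col U j = f j \<cdot>\<^sub>v col U j"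
proof -
  have Uc: "U \<in> carrier_mat n n" using U by simp
  have "(U * mat_diag n f * mat_adjoint U) *\<^sub>v col U j = col (U * mat_diag n f * mat_adjoint U * U) j"
    using Uc j by (subst col_mult2[of _ n n _ n]) auto
  also have "U * mat_diag n f * mat_adjoint U * U = U * mat_diag n f"
    using Uc U right_mult_one_mat[of "U * mat_diag n f" n n] by (simp add: mat_assoc)
  also have "col (U * mat_diag n f) j = f j \<cdot>\<^sub>v col U j"
    using Uc j by (intro eq_vecI) (auto simp: mat_diag_mult_right[OF Uc] mult.commute)
  finally show ?thesis .
qed

text \<open>Defined by eigenvectors, so that it does not depend on the choice of a
  diagonalization.\<close>

definition real_spectrum :: "complex mat \<Rightarrow> real set" where
  "real_spectrum A = {x. \<exists>v \<in> carrier_vec (dim_row A). v \<noteq> 0\<^sub>v (dim_row A) \<and> A *\<^sub>v v = complex_of_real x \<cdot>\<^sub>v v}"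

lemma real_spectrumE:
  assumes "x \<in> real_spectrum A" "dim_row A = n"
  obtains v where "v \<in> carrier_vec n" "v \<noteq> 0\<^sub>v n" "A *\<^sub>v v = complex_of_real x \<cdot>\<^sub>v v"
  using assms(1) unfolding real_spectrum_def assms(2) by blast

lemma unitary_adjoint_vec_cancel:
  assumes "U \<in> unitary_mats n" "v \<in> carrier_vec n"
  shows "U *\<^sub>v (mat_adjoint U *\<^sub>v v) = v"
  using assms assoc_mult_mat_vec[of U n n "mat_adjoint U" n v] by simp

lemma real_spectrum_spectral:
  assumes U: "U \<in> unitary_mats n"
  shows "real_spectrum (U * rdiag n d * mat_adjoint U) = d ` {..<n}"
proof -
  let ?A = "U * rdiag n d * mat_adjoint U"
  have Uc: "U \<in> carrier_mat n n" and Ua: "mat_adjoint U \<in> carrier_mat n n" using U by auto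
  have dim: "dim_row ?A = n" using Uc by simp
  have "d j \<in> real_spectrum ?A" if j: "j < n" for j
  proof -
    have "col U j \<noteq> 0\<^sub>v n"
      using coord_col[OF U j j] Ua j U by (auto simp: coord_def)
    then show ?thesis
      unfolding real_spectrum_def dim using spectral_col[OF U j] Uc j
      by (intro CollectI bexI[of _ "col U j"]) auto
  qed
  moreover have "x \<in> d ` {..<n}" if "x \<in> real_spectrum ?A" for x
  proof -
    from that obtain v where v: "v \<in> carrier_vec n" "v \<noteq> 0\<^sub>v n"
      "?A *\<^sub>v v = complex_of_real x \<cdot>\<^sub>v v"
      unfolding real_spectrum_def dim by auto
    define w where "w = mat_adjoint U *\<^sub>v v"
    have w: "w \<in> carrier_vec n" unfolding w_def using Ua v by auto
    have Dw: "rdiag n d *\<^sub>v w \<in> carrier_vec n" using w mult_mat_vec_carrier mat_diag_dim by blast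
    have "?A *\<^sub>v v = U *\<^sub>v (rdiag n d *\<^sub>v w)"
      unfolding w_def using Uc Ua v by (simp add: assoc_mult_mat_vec[of _ n n _ n] mult_mat_vec_carrier[of _ n n])
    moreover have "mat_adjoint U *\<^sub>v (?A *\<^sub>v v) = complex_of_real x \<cdot>\<^sub>v w"
      unfolding v(3) w_def using v(1) U by (simp add: mult_mat_vec[of _ n n])
    ultimately have "mat_adjoint U *\<^sub>v (U *\<^sub>v (rdiag n d *\<^sub>v w)) = complex_of_real x \<cdot>\<^sub>v w"
      by simp
    then have eq: "rdiag n d *\<^sub>v w = complex_of_real x \<cdot>\<^sub>v w"
      using unitary_adjoint_vec_cancel[of "mat_adjoint U" n "rdiag n d *\<^sub>v w"] U Dw by simp
    have "w \<noteq> 0\<^sub>v n"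
    proof
      assume "w = 0\<^sub>v n"
      then have "v = U *\<^sub>v 0\<^sub>v n" using unitary_adjoint_vec_cancel[OF U v(1)] w_def by simp
      then show False using v Uc by auto
    qed
    then obtain i where i: "i < n" "w $ i \<noteq> 0" using w by (metis carrier_vecD eq_vecI index_zero_vec)
    have "(rdiag n d *\<^sub>v w) $ i = complex_of_real x * w $ i" unfolding eq using i w by simp
    then have "complex_of_real (d i) * w $ i = complex_of_real x * w $ i"
      using mat_diag_mult_vec[OF w i(1)] by simp
    then have "d i = x" using i by simp
    then show ?thesis using i by auto
  qed
  ultimately show ?thesis by auto
qed

text \<open>A single diagonalization serves the matrix, its spectrum and all its functions at once;
  identities between functions of one matrix then reduce to diagonal entries.\<close>

lemma herm_cases:
  assumes "A \<in> herm_mats n"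
  obtains U d where "U \<in> unitary_mats n" "A = U * rdiag n d * mat_adjoint U"
    "real_spectrum A = d ` {..<n}"
    "\<And>f. mat_fun f A = U * rdiag n (\<lambda>i. f (d i)) * mat_adjoint U"
  using spectral_theorem[OF assms] real_spectrum_spectral mat_fun_eqI by metis

section \<open>Rules of the functional calculus\<close>

lemma mat_fun_herm [simp]: "A \<in> herm_mats n \<Longrightarrow> mat_fun f A \<in> herm_mats n"
  by (erule herm_cases) (simp add: herm_spectral)

lemma mat_fun_carrier [simp]: "A \<in> herm_mats n \<Longrightarrow> mat_fun f A \<in> carrier_mat n n"
  using mat_fun_herm herm_carrier by blast

lemma mat_fun_dim [simp]:
  "A \<in> herm_mats n \<Longrightarrow> dim_row (mat_fun f A) = n" "A \<in> herm_mats n \<Longrightarrow> dim_col (mat_fun f A) = n"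
  using mat_fun_carrier by blast+

lemma real_spectrum_mat_fun:
  "A \<in> herm_mats n \<Longrightarrow> real_spectrum (mat_fun f A) = f ` real_spectrum A"
  by (erule herm_cases) (simp add: real_spectrum_spectral image_image)

lemma mat_fun_id [simp]: "A \<in> herm_mats n \<Longrightarrow> mat_fun (\<lambda>x. x) A = A"
  by (erule herm_cases) simp

lemma mat_fun_const_1 [simp]: "A \<in> herm_mats n \<Longrightarrow> mat_fun (\<lambda>x. 1) A = 1\<^sub>m n"
  by (erule herm_cases) (simp add: right_mult_one_mat[OF unitary_carrier])

lemma spectral_mult:
  fixes U :: "complex mat"
  assumes U: "U \<in> unitary_mats n"
  shows "(U * mat_diag n f * mat_adjoint U) * (U * mat_diag n g * mat_adjoint U)
    = U * mat_diag n (\<lambda>i. f i * g i) * mat_adjoint U"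
proof -
  have Uc: "U \<in> carrier_mat n n" using U by simp
  have "(U * mat_diag n f * mat_adjoint U) * (U * mat_diag n g * mat_adjoint U)
    = U * (mat_diag n f * ((mat_adjoint U * U) * (mat_diag n g * mat_adjoint U)))"
    using Uc by (simp add: mat_assoc)
  also have "\<dots> = U * ((mat_diag n f * mat_diag n g) * mat_adjoint U)"
    using Uc U mat_assoc[of "mat_diag n f" "mat_diag n g" "mat_adjoint U"]
    by (simp add: left_mult_one_mat[of "mat_diag n g * mat_adjoint U" n n] del: mat_diag_diag)
  finally show ?thesis using Uc by (simp add: mat_assoc)
qed

lemma mat_fun_mult:
  "A \<in> herm_mats n \<Longrightarrow> mat_fun f A * mat_fun g A = mat_fun (\<lambda>x. f x * g x) A"
  by (erule herm_cases) (simp add: spectral_mult)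

lemma mat_fun_mult_assoc:
  "A \<in> herm_mats n \<Longrightarrow> dim_row X = n \<Longrightarrow>
     mat_fun f A * (mat_fun g A * X) = mat_fun (\<lambda>x. f x * g x) A * X"
  using mat_assoc[of "mat_fun f A" "mat_fun g A" X] mat_fun_mult[of A n f g]
    mat_fun_dim[of A n f] mat_fun_dim[of A n g] by simp

lemma mat_fun_add:
  assumes "A \<in> herm_mats n"
  shows "mat_fun f A + mat_fun g A = mat_fun (\<lambda>x. f x + g x) A"
proof -
  from assms obtain U d where U: "U \<in> unitary_mats n"
    and mf: "\<And>f. mat_fun f A = U * rdiag n (\<lambda>i. f (d i)) * mat_adjoint U" using herm_cases by metis
  have Uc: "U \<in> carrier_mat n n" "mat_adjoint U \<in> carrier_mat n n" using U by auto
  have "rdiag n (\<lambda>i. f (d i) + g (d i)) = rdiag n (\<lambda>i. f (d i)) + rdiag n (\<lambda>i. g (d i))"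
    by (intro eq_matI) (auto simp: mat_diag_def)
  then show ?thesis unfolding mf using Uc U
    by (simp add: mat_mult_add mat_add_mult)
qed

lemma mat_fun_smult:
  assumes "A \<in> herm_mats n"
  shows "complex_of_real c \<cdot>\<^sub>m mat_fun f A = mat_fun (\<lambda>x. c * f x) A"
proof -
  from assms obtain U d where U: "U \<in> unitary_mats n"
    and mf: "\<And>f. mat_fun f A = U * rdiag n (\<lambda>i. f (d i)) * mat_adjoint U" using herm_cases by metis
  have Uc: "U \<in> carrier_mat n n" "mat_adjoint U \<in> carrier_mat n n" using U by auto
  have "rdiag n (\<lambda>i. c * f (d i)) = complex_of_real c \<cdot>\<^sub>m rdiag n (\<lambda>i. f (d i))"
    by (intro eq_matI) (auto simp: mat_diag_def)
  then show ?thesis unfolding mf using Uc U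
    by (simp add: mat_mult_smult mat_smult_mult)
qed

lemma mat_fun_comp:
  "A \<in> herm_mats n \<Longrightarrow> mat_fun f (mat_fun g A) = mat_fun (\<lambda>x. f (g x)) A"
  by (erule herm_cases) (simp add: mat_fun_eqI[OF _ refl])

lemma mat_fun_cong:
  assumes "A \<in> herm_mats n" "\<And>x. x \<in> real_spectrum A \<Longrightarrow> f x = g x"
  shows "mat_fun f A = mat_fun g A"
proof -
  from assms(1) obtain U d where mf: "real_spectrum A = d ` {..<n}"
    "\<And>f. mat_fun f A = U * rdiag n (\<lambda>i. f (d i)) * mat_adjoint U" using herm_cases by metis
  have "rdiag n (\<lambda>i. f (d i)) = rdiag n (\<lambda>i. g (d i))"
    using assms(2) mf(1) by (intro eq_matI) (auto simp: mat_diag_def)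
  then show ?thesis unfolding mf by simp
qed

lemma mat_fun_mono:
  assumes "A \<in> herm_mats n" "\<And>x. x \<in> real_spectrum A \<Longrightarrow> f x \<le> g x"
  shows "qle n (mat_fun f A) (mat_fun g A)"
proof -
  from assms(1) obtain U d where U: "U \<in> unitary_mats n" and mf: "real_spectrum A = d ` {..<n}"
    "\<And>f. mat_fun f A = U * rdiag n (\<lambda>i. f (d i)) * mat_adjoint U" using herm_cases by metis
  show ?thesis unfolding mf
    using assms(2) mf(1) U by (auto intro!: qleI sum_mono mult_right_mono simp: qform_spectral)
qed

section \<open>Positivity read off the spectrum\<close>

lemma eigen_qform:
  assumes "A *\<^sub>v v = complex_of_real x \<cdot>\<^sub>v v" "v \<in> carrier_vec n"
  shows "qform A v = x * Re (v \<bullet>c v)"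
  unfolding qform_def assms(1) using assms(2) by simp

lemma psd_spectrum_iff: "A \<in> psd_mats n \<longleftrightarrow> A \<in> herm_mats n \<and> (\<forall>x \<in> real_spectrum A. 0 \<le> x)"
proof (intro iffI conjI ballI)
  fix x assume A: "A \<in> psd_mats n" and x: "x \<in> real_spectrum A"
  obtain v where v: "v \<in> carrier_vec n" "v \<noteq> 0\<^sub>v n" "A *\<^sub>v v = complex_of_real x \<cdot>\<^sub>v v"
    by (rule real_spectrumE[OF x psd_dim(1)[OF A]])
  have "0 \<le> qform A v" using A v unfolding psd_iff by blast
  then show "0 \<le> x"
    using eigen_qform[OF v(3,1)] cscalar_prod_self_pos[OF v(1,2)] by (simp add: zero_le_mult_iff)
next
  assume A: "A \<in> herm_mats n \<and> (\<forall>x \<in> real_spectrum A. 0 \<le> x)"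
  then obtain U d where "U \<in> unitary_mats n" "real_spectrum A = d ` {..<n}"
    "A = U * rdiag n d * mat_adjoint U" using herm_cases by metis
  then show "A \<in> psd_mats n" using A
    by (auto simp: psd_iff qform_spectral intro!: sum_nonneg)
qed auto

lemma pd_spectrum_iff: "A \<in> pd_mats n \<longleftrightarrow> A \<in> herm_mats n \<and> (\<forall>x \<in> real_spectrum A. 0 < x)"
proof (intro iffI conjI ballI)
  fix x assume A: "A \<in> pd_mats n" and x: "x \<in> real_spectrum A"
  obtain v where v: "v \<in> carrier_vec n" "v \<noteq> 0\<^sub>v n" "A *\<^sub>v v = complex_of_real x \<cdot>\<^sub>v v"
    by (rule real_spectrumE[OF x pd_dim(1)[OF A]])
  have "0 < qform A v" using A v unfolding pd_iff by blast
  then show "0 < x"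
    using eigen_qform[OF v(3,1)] cscalar_prod_self_pos[OF v(1,2)] by (simp add: zero_less_mult_iff)
next
  assume A: "A \<in> herm_mats n \<and> (\<forall>x \<in> real_spectrum A. 0 < x)"
  then obtain U d where U: "U \<in> unitary_mats n" "real_spectrum A = d ` {..<n}"
    "A = U * rdiag n d * mat_adjoint U" using herm_cases by metis
  show "A \<in> pd_mats n" unfolding pd_iff
  proof (intro conjI ballI impI)
    fix v :: "complex vec" assume v: "v \<in> carrier_vec n" "v \<noteq> 0\<^sub>v n"
    have "0 < (\<Sum>i<n. coord U v i)" using sum_coord[OF U(1) v(1)] cscalar_prod_self_pos[OF v] by simp
    then obtain i where i: "i < n" "coord U v i \<noteq> 0" by (metis lessThan_iff less_irrefl sum.neutral)
    have dpos: "0 < d i" if "i < n" for i using A U(2) that by auto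
    have "0 < d i * coord U v i"
      using i dpos[of i] coord_nonneg[of U v i] by (simp add: less_le)
    moreover have "0 \<le> d j * coord U v j" if "j < n" for j using dpos[OF that] by simp
    ultimately have "0 < (\<Sum>i<n. d i * coord U v i)"
      using i by (intro sum_pos2[of "{..<n}" i]) auto
    then show "0 < qform A v" using U v by (simp add: qform_spectral)
  qed (use A in auto)
qed auto

lemma psd_spectrum: "A \<in> psd_mats n \<Longrightarrow> x \<in> real_spectrum A \<Longrightarrow> 0 \<le> x"
  and pd_spectrum: "A \<in> pd_mats n \<Longrightarrow> x \<in> real_spectrum A \<Longrightarrow> 0 < x"
  using psd_spectrum_iff pd_spectrum_iff by blast+

lemma mat_fun_psd:
  "A \<in> herm_mats n \<Longrightarrow> (\<And>x. x \<in> real_spectrum A \<Longrightarrow> 0 \<le> f x) \<Longrightarrow> mat_fun f A \<in> psd_mats n"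
  unfolding psd_spectrum_iff using real_spectrum_mat_fun by auto

lemma mat_fun_pd:
  "A \<in> herm_mats n \<Longrightarrow> (\<And>x. x \<in> real_spectrum A \<Longrightarrow> 0 < f x) \<Longrightarrow> mat_fun f A \<in> pd_mats n"
  unfolding pd_spectrum_iff using real_spectrum_mat_fun by auto

text \<open>In eigenbases the relation reads \<open>d i * W $$ (i, j) = W $$ (i, j) * e j\<close>,
  so each entry of \<open>W\<close> vanishes or \<open>d i = e j\<close>. In both cases the relation
  persists for \<open>f (d i)\<close> and \<open>f (e j)\<close>.\<close>

lemma mat_fun_intertwine:
  fixes K :: "complex mat"
  assumes X: "X \<in> herm_mats n" and Y: "Y \<in> herm_mats n" and K: "K \<in> carrier_mat n n"
    and eq: "X * K = K * Y"
  shows "mat_fun f X * K = K * mat_fun f Y"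
proof -
  from X obtain U d where U: "U \<in> unitary_mats n" and Xe: "X = U * rdiag n d * mat_adjoint U"
    and mX: "\<And>f. mat_fun f X = U * rdiag n (\<lambda>i. f (d i)) * mat_adjoint U" using herm_cases by metis
  from Y obtain V e where V: "V \<in> unitary_mats n" and Ye: "Y = V * rdiag n e * mat_adjoint V"
    and mY: "\<And>f. mat_fun f Y = V * rdiag n (\<lambda>i. f (e i)) * mat_adjoint V" using herm_cases by metis
  have c: "U \<in> carrier_mat n n" "V \<in> carrier_mat n n" using U V by auto
  define W where "W = mat_adjoint U * K * V"
  have W: "W \<in> carrier_mat n n" unfolding W_def using c K by auto
  have l: "mat_adjoint U * ((U * rdiag n d * mat_adjoint U) * K) * V = rdiag n d * W" for d
  proof -
    have "mat_adjoint U * ((U * rdiag n d * mat_adjoint U) * K) * V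
      = (mat_adjoint U * U) * (rdiag n d * W)"
      unfolding W_def using c K by (simp add: mat_assoc)
    then show ?thesis using U W by simp
  qed
  have r: "mat_adjoint U * (K * (V * rdiag n e * mat_adjoint V)) * V = W * rdiag n e" for e
  proof -
    have "mat_adjoint U * (K * (V * rdiag n e * mat_adjoint V)) * V
      = (W * rdiag n e) * (mat_adjoint V * V)"
      unfolding W_def using c K by (simp add: mat_assoc)
    then show ?thesis using V W by simp
  qed
  have eqW: "rdiag n d * W = W * rdiag n e" using eq l[of d] r[of e] Xe Ye by simp
  have "rdiag n (\<lambda>i. f (d i)) * W = W * rdiag n (\<lambda>i. f (e i))"
  proof (rule eq_matI)
    fix i j assume "i < dim_row (W * rdiag n (\<lambda>i. f (e i)))" "j < dim_col (W * rdiag n (\<lambda>i. f (e i)))"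
    then have ij: "i < n" "j < n" using W by auto
    have "(rdiag n d * W) $$ (i, j) = (W * rdiag n e) $$ (i, j)" using eqW by simp
    then have "complex_of_real (d i) * W $$ (i, j) = W $$ (i, j) * complex_of_real (e j)"
      unfolding mat_diag_mult_right[OF W] mat_diag_mult_left[OF W] using ij by simp
    then have "W $$ (i, j) = 0 \<or> d i = e j" by (auto simp: mult.commute)
    then show "(rdiag n (\<lambda>i. f (d i)) * W) $$ (i, j) = (W * rdiag n (\<lambda>i. f (e i))) $$ (i, j)"
      unfolding mat_diag_mult_right[OF W] mat_diag_mult_left[OF W] using ij by auto
  qed (use W in auto)
  then have *: "mat_adjoint U * (mat_fun f X * K) * V = mat_adjoint U * (K * mat_fun f Y) * V"
    unfolding mX mY l r .
  have cancel: "U * (mat_adjoint U * Z * V) * mat_adjoint V = Z" if Z: "Z \<in> carrier_mat n n" for Z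
  proof -
    have "U * (mat_adjoint U * Z * V) * mat_adjoint V = (U * mat_adjoint U) * Z * (V * mat_adjoint V)"
      using c Z by (simp add: mat_assoc)
    then show ?thesis using U V Z by simp
  qed
  have "mat_fun f X * K \<in> carrier_mat n n" "K * mat_fun f Y \<in> carrier_mat n n"
    using K X Y by auto
  then show ?thesis using cancel * by metis
qed

section \<open>Powers and the Loewner-Heinz inequality\<close>

lemma smult_1_mat [simp]: "(1 :: complex) \<cdot>\<^sub>m A = A"
  by (rule eq_matI) auto

text \<open>With \<open>inverse 0 = 0\<close> and \<open>0 powr r = 0\<close> the detour over the
  generalized inverse for negative exponents is the same scalar function, so the case split
  disappears.\<close>

lemma mat_powr_psd_eq: "A \<in> psd_mats n \<Longrightarrow> mat_powr A r = mat_fun (\<lambda>x. x powr r) A"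
proof (cases "0 \<le> r")
  case False
  assume A: "A \<in> psd_mats n"
  have "mat_powr A r = mat_fun (\<lambda>x. inverse x powr (- r)) A"
    using False mat_fun_comp[OF psd_herm[OF A]] by (simp add: mat_powr_def gen_inv_def)
  also have "\<dots> = mat_fun (\<lambda>x. x powr r) A"
    using psd_spectrum[OF A]
    by (intro mat_fun_cong[OF psd_herm[OF A]]) (simp add: inverse_powr powr_minus)
  finally show ?thesis .
qed (simp add: mat_powr_def)

lemma mat_powr_psd [simp]: "A \<in> psd_mats n \<Longrightarrow> mat_powr A r \<in> psd_mats n"
  using mat_fun_psd[OF psd_herm, of A n "\<lambda>x. x powr r"] by (simp add: mat_powr_psd_eq)

lemma mat_powr_pd [simp]: "A \<in> pd_mats n \<Longrightarrow> mat_powr A r \<in> pd_mats n"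
  using mat_fun_pd[OF pd_herm, of A n "\<lambda>x. x powr r"] pd_spectrum[of A n]
  by (simp add: mat_powr_psd_eq[OF pd_imp_psd] less_le)

lemma real_spectrum_mat_powr:
  "A \<in> psd_mats n \<Longrightarrow> real_spectrum (mat_powr A r) = (\<lambda>x. x powr r) ` real_spectrum A"
  by (simp add: mat_powr_psd_eq real_spectrum_mat_fun[OF psd_herm])

text \<open>The exponents add also for singular \<open>A\<close>, since \<open>0 powr r = 0\<close>
  for every r, including 0. In particular the power 0 acts as a unit on all powers of
  \<open>A\<close>.\<close>

lemma mat_powr_mult:
  "A \<in> psd_mats n \<Longrightarrow> mat_powr A r * mat_powr A s = mat_powr A (r + s)"
  by (simp add: mat_powr_psd_eq mat_fun_mult[OF psd_herm] powr_add)

lemma mat_powr_mult_assoc: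
  "A \<in> psd_mats n \<Longrightarrow> dim_row X = n \<Longrightarrow> mat_powr A r * (mat_powr A s * X) = mat_powr A (r + s) * X"
  by (simp add: mat_powr_psd_eq mat_fun_mult_assoc[OF psd_herm] powr_add)

lemma mat_powr_powr: "A \<in> psd_mats n \<Longrightarrow> mat_powr (mat_powr A r) s = mat_powr A (r * s)"
  using mat_powr_psd_eq[OF mat_powr_psd, of A n r s] mat_powr_psd_eq[of A n]
  by (simp add: mat_fun_comp[OF psd_herm] powr_powr)

lemma mat_powr_1 [simp]: "A \<in> psd_mats n \<Longrightarrow> mat_powr A 1 = A"
  unfolding mat_powr_psd_eq
  by (subst mat_fun_cong[OF psd_herm, of A n _ "\<lambda>x. x"])
    (simp_all add: psd_spectrum mat_fun_id[OF psd_herm])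

lemma mat_powr_0 [simp]: "A \<in> pd_mats n \<Longrightarrow> mat_powr A 0 = 1\<^sub>m n"
  using mat_fun_cong[OF pd_herm, of A n "\<lambda>x. x powr 0" "\<lambda>x. 1"] pd_spectrum[of A n]
  by (simp add: mat_powr_psd_eq[OF pd_imp_psd] less_le)

lemma mat_powr_carrier [simp]: "A \<in> psd_mats n \<Longrightarrow> mat_powr A r \<in> carrier_mat n n"
  using mat_powr_psd psd_carrier by blast

lemma mat_powr_dim [simp]:
  "A \<in> psd_mats n \<Longrightarrow> dim_row (mat_powr A r) = n" "A \<in> psd_mats n \<Longrightarrow> dim_col (mat_powr A r) = n"
  using mat_powr_carrier by blast+

lemma mat_powr_herm [simp]: "A \<in> psd_mats n \<Longrightarrow> mat_powr A r \<in> herm_mats n"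
  using mat_powr_psd psd_herm by blast

lemma mat_powr_pd_simps [simp]:
  assumes "A \<in> pd_mats n"
  shows "mat_powr A r \<in> carrier_mat n n" "dim_row (mat_powr A r) = n" "dim_col (mat_powr A r) = n"
    "mat_powr A r \<in> herm_mats n" "mat_powr A r \<in> psd_mats n" "mat_powr A 1 = A"
  using pd_imp_psd[OF assms] by simp_all

lemma one_pd [simp]: "1\<^sub>m n \<in> pd_mats n"
  unfolding pd_iff using herm_one qform_one cscalar_prod_self_pos by metis

section \<open>Congruences of positive matrices\<close>

lemma psd_congruence:
  assumes "X \<in> psd_mats n" "K \<in> carrier_mat n n"
  shows "K * X * mat_adjoint K \<in> psd_mats n"
  unfolding psd_iff
proof (intro conjI ballI)
  fix v :: "complex vec" assume v: "v \<in> carrier_vec n"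
  have "mat_adjoint K *\<^sub>v v \<in> carrier_vec n" using assms v by simp
  then have "0 \<le> qform X (mat_adjoint K *\<^sub>v v)" using assms(1) unfolding psd_iff by blast
  then show "0 \<le> qform (K * X * mat_adjoint K) v"
    using qform_congruence[OF psd_carrier[OF assms(1)] assms(2) v] by simp
qed (use assms herm_congruence[of X n K] in simp)

lemma psd_congruence': "X \<in> psd_mats n \<Longrightarrow> K \<in> herm_mats n \<Longrightarrow> K * X * K \<in> psd_mats n"
  using psd_congruence[of X n K] by (simp add: herm_adjoint)

lemma pd_vec_nonzero:
  assumes "K \<in> pd_mats n" "v \<in> carrier_vec n" "v \<noteq> 0\<^sub>v n"
  shows "K *\<^sub>v v \<noteq> 0\<^sub>v n"
proof
  assume "K *\<^sub>v v = 0\<^sub>v n"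
  then have "qform K v = 0" using assms(2) by (simp add: qform_def)
  then show False using assms unfolding pd_iff by (metis less_irrefl)
qed

lemma pd_congruence':
  assumes "X \<in> pd_mats n" "K \<in> pd_mats n"
  shows "K * X * K \<in> pd_mats n"
  unfolding pd_iff
proof (intro conjI ballI impI)
  fix v :: "complex vec" assume v: "v \<in> carrier_vec n" "v \<noteq> 0\<^sub>v n"
  have "0 < qform X (K *\<^sub>v v)"
    using assms(1) pd_vec_nonzero[OF assms(2) v] v assms(2) unfolding pd_iff[of X] by simp
  then show "0 < qform (K * X * K) v"
    using qform_congruence[OF pd_carrier[OF assms(1)] pd_carrier[OF assms(2)] v(1)]
      herm_adjoint[OF pd_herm[OF assms(2)]] by simp
qed (use assms herm_congruence'[of X n K] in simp)

lemma pd_vec_cancel: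
  assumes "A \<in> pd_mats n" "v \<in> carrier_vec n"
  shows "mat_powr A r *\<^sub>v (mat_powr A (- r) *\<^sub>v v) = v"
proof -
  have "mat_powr A r *\<^sub>v (mat_powr A (- r) *\<^sub>v v) = (mat_powr A r * mat_powr A (- r)) *\<^sub>v v"
    using assms by (simp add: assoc_mult_mat_vec[of _ n n _ n])
  then show ?thesis using assms by (simp add: mat_powr_mult[OF pd_imp_psd])
qed

text \<open>The expansion of |x - y|^2 \<ge> 0 in every coordinate. It takes the place of the
  Cauchy-Schwarz inequality in \<open>qle_inverse\<close> and
  \<open>loewner_heinz_midpoint\<close>.\<close>

lemma two_Re_cscalar_le:
  assumes "x \<in> carrier_vec n" "y \<in> carrier_vec n"
  shows "2 * Re (x \<bullet>c y) \<le> Re (x \<bullet>c x) + Re (y \<bullet>c y)"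
proof -
  have *: "2 * Re (a * cnj b) \<le> (cmod a)\<^sup>2 + (cmod b)\<^sup>2" for a b :: complex
    using zero_le_power2[of "Re a - Re b"] zero_le_power2[of "Im a - Im b"]
    unfolding cmod_power2 by (simp add: power2_eq_square algebra_simps)
  show ?thesis
    using assms sum_mono[of "{..<n}" "\<lambda>i. 2 * Re (x $ i * cnj (y $ i))" "\<lambda>i. (cmod (x $ i))\<^sup>2 + (cmod (y $ i))\<^sup>2"] *
    unfolding cscalar_prod_self_Re[OF assms(1)] cscalar_prod_self_Re[OF assms(2)]
      cscalar_prod_sum[OF assms] Re_sum sum.distrib[symmetric] sum_distrib_left by blast
qed

lemma herm_norm_qform:
  "K \<in> herm_mats n \<Longrightarrow> x \<in> carrier_vec n \<Longrightarrow> Re ((K *\<^sub>v x) \<bullet>c (K *\<^sub>v x)) = qform (K * K) x"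
  using adjoint_cscalar_prod[of K n n x "K *\<^sub>v x"] adjoint_cscalar_prod[of K n n "K *\<^sub>v x" x]
  by (simp add: qform_def herm_adjoint assoc_mult_mat_vec[of _ n n _ n])

lemma mat_powr_norm_qform:
  "A \<in> psd_mats n \<Longrightarrow> x \<in> carrier_vec n \<Longrightarrow>
     Re ((mat_powr A (r / 2) *\<^sub>v x) \<bullet>c (mat_powr A (r / 2) *\<^sub>v x)) = qform (mat_powr A r) x"
  using herm_norm_qform[of "mat_powr A (r / 2)" n x] by (simp add: mat_powr_mult)

section \<open>Scalar bounds, inversion and the Loewner-Heinz inequality\<close>

lemma qle_one_spectrum:
  assumes "X \<in> herm_mats n" "\<And>x. x \<in> real_spectrum X \<Longrightarrow> x \<le> c"
  shows "qle n X (complex_of_real c \<cdot>\<^sub>m 1\<^sub>m n)"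
  using mat_fun_mono[OF assms(1), of "\<lambda>x. x" "\<lambda>x. c * 1"] assms mat_fun_smult[of X n c "\<lambda>x. 1"] by simp

lemma qle_spectrum_le:
  assumes "X \<in> herm_mats n" "qle n X (complex_of_real c \<cdot>\<^sub>m 1\<^sub>m n)" "x \<in> real_spectrum X"
  shows "x \<le> c"
proof -
  obtain v where v: "v \<in> carrier_vec n" "v \<noteq> 0\<^sub>v n" "X *\<^sub>v v = complex_of_real x \<cdot>\<^sub>v v"
    by (rule real_spectrumE[OF assms(3) herm_dim(1)[OF assms(1)]])
  show ?thesis
    using qleD[OF assms(2) v(1)] v eigen_qform[OF v(3,1)] cscalar_prod_self_pos[OF v(1,2)]
    by (simp add: qform_smult[of _ n] qform_one)
qed

text \<open>With y = Y^-1 v the number q = <Y^-1 v, v> is the real part of <a, b>, while |a|^2 = <X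
  y, y> \<le> <Y y, y> = q and |b|^2 = <X^-1 v, v>. Hence 2 q \<le> q + |b|^2.\<close>

lemma qle_inverse:
  assumes X: "X \<in> pd_mats n" and Y: "Y \<in> pd_mats n" and le: "qle n X Y"
  shows "qle n (mat_powr Y (- 1)) (mat_powr X (- 1))"
proof (rule qleI)
  fix v :: "complex vec" assume v: "v \<in> carrier_vec n"
  note p = pd_imp_psd[OF X] pd_imp_psd[OF Y]
  define y where "y = mat_powr Y (- 1) *\<^sub>v v"
  have y: "y \<in> carrier_vec n" using v p y_def by simp
  have Yy: "Y *\<^sub>v y = v" using pd_vec_cancel[OF Y v, of 1] p y_def by simp
  define a where "a = mat_powr X (1 / 2) *\<^sub>v y"
  define b where "b = mat_powr X (- 1 / 2) *\<^sub>v v"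
  have ab: "a \<in> carrier_vec n" "b \<in> carrier_vec n" using y v p a_def b_def by simp_all
  have "a \<bullet>c b = y \<bullet>c (mat_powr X (1 / 2) *\<^sub>v b)"
    unfolding a_def using adjoint_cscalar_prod[of "mat_powr X (1 / 2)" n n y b] p y ab
    by (simp add: herm_adjoint[OF mat_powr_herm])
  also have "mat_powr X (1 / 2) *\<^sub>v b = v"
    unfolding b_def using pd_vec_cancel[OF X v, of "1/2"] by simp
  finally have "Re (a \<bullet>c b) = qform (mat_powr Y (- 1)) v" unfolding qform_def y_def by simp
  moreover have "Re (a \<bullet>c a) = qform X y"
    unfolding a_def using mat_powr_norm_qform[OF p(1) y, of 1] p by simp
  moreover have "qform X y \<le> qform Y y" using le y by (rule qleD)
  moreover have "qform Y y = qform (mat_powr Y (- 1)) v"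
  proof -
    have "qform Y y = Re (v \<bullet>c y)" unfolding qform_def Yy ..
    also have "\<dots> = Re ((mat_powr Y (-1) *\<^sub>v v) \<bullet>c v)"
      using adjoint_cscalar_prod[of "mat_powr Y (- 1)" n n v v] p v
      by (simp add: herm_adjoint[OF mat_powr_herm] y_def)
    finally show ?thesis by (simp add: qform_def)
  qed
  moreover have "Re (b \<bullet>c b) = qform (mat_powr X (- 1)) v"
    unfolding b_def using mat_powr_norm_qform[OF p(1) v, of "- 1"] by simp
  ultimately show "qform (mat_powr Y (- 1)) v \<le> qform (mat_powr X (- 1)) v"
    using two_Re_cscalar_le[OF ab] by linarith
qed

text \<open>An eigenvector of \<open>W\<close> for x gives a vector u with A^m u = x B^m u.
  Splitting A^m into the powers r/2 and s/2 writes x N as the real part of an inner product of two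
  vectors of squared norm at most N, where N = <B^r u, u>. So x \<le> 1, which means A^m \<le>
  B^m.\<close>

lemma loewner_heinz_midpoint:
  assumes A: "A \<in> psd_mats n" and B: "B \<in> pd_mats n"
    and r: "qle n (mat_powr A r) (mat_powr B r)" and s: "qle n (mat_powr A s) (mat_powr B s)"
  shows "qle n (mat_powr A ((r + s) / 2)) (mat_powr B ((r + s) / 2))"
proof -
  define m where "m = (r + s) / 2"
  have Bp: "B \<in> psd_mats n" using B by simp
  define W where "W = mat_powr B (- m / 2) * mat_powr A m * mat_powr B (- m / 2)"
  have W: "W \<in> herm_mats n" unfolding W_def using A Bp by (intro herm_congruence') auto
  have BW: "mat_powr B (m / 2) * W = mat_powr A m * mat_powr B (- m / 2)"
    unfolding W_def using A Bp mat_powr_0[OF B]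
    by (simp add: mat_assoc mat_powr_mult_assoc left_mult_one_mat[of _ n n])
  have "x \<le> 1" if x: "x \<in> real_spectrum W" for x
  proof -
    obtain y where y: "y \<in> carrier_vec n" "y \<noteq> 0\<^sub>v n" "W *\<^sub>v y = complex_of_real x \<cdot>\<^sub>v y"
      by (rule real_spectrumE[OF x herm_dim(1)[OF W]])
    define u where "u = mat_powr B (- m / 2) *\<^sub>v y"
    have u: "u \<in> carrier_vec n" "u \<noteq> 0\<^sub>v n"
      using y Bp pd_vec_nonzero[OF mat_powr_pd[OF B] y(1,2)] by (simp_all add: u_def)
    have "mat_powr A m *\<^sub>v u = (mat_powr A m * mat_powr B (- m / 2)) *\<^sub>v y"
      unfolding u_def using A Bp y by (simp add: assoc_mult_mat_vec[of _ n n _ n])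
    also have "\<dots> = mat_powr B (m / 2) *\<^sub>v (W *\<^sub>v y)"
      unfolding BW[symmetric] using W Bp y(1) by (simp add: assoc_mult_mat_vec[of _ n n _ n])
    also have "\<dots> = complex_of_real x \<cdot>\<^sub>v (mat_powr B (m / 2) *\<^sub>v y)"
      unfolding y(3) using Bp y(1) by (simp add: mult_mat_vec[of _ n n])
    also have "mat_powr B (m / 2) *\<^sub>v y = mat_powr B m *\<^sub>v u"
      unfolding u_def using Bp y(1) assoc_mult_mat_vec[of "mat_powr B m" n n "mat_powr B (- m / 2)" n y]
      by (simp add: mat_powr_mult)
    finally have Au: "mat_powr A m *\<^sub>v u = complex_of_real x \<cdot>\<^sub>v (mat_powr B m *\<^sub>v u)" .
    \<comment> \<open>This choice gives <B^s z, z> = <B^r u, u>, so that both hypotheses lead to the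
      same bound \<open>N\<close>.\<close>
    define z where "z = mat_powr B ((r - s) / 2) *\<^sub>v u"
    have z: "z \<in> carrier_vec n" using u Bp z_def by simp
    define p where "p = mat_powr A (r / 2) *\<^sub>v u"
    define q where "q = mat_powr A (s / 2) *\<^sub>v z"
    have pq: "p \<in> carrier_vec n" "q \<in> carrier_vec n" using A u z p_def q_def by simp_all
    define N where "N = qform (mat_powr B r) u"
    have N: "0 < N" using mat_powr_pd[OF B, of r] u unfolding N_def pd_iff by blast
    have "p \<bullet>c q = (mat_powr A (s / 2) *\<^sub>v p) \<bullet>c z"
      using adjoint_cscalar_prod[of "mat_powr A (s / 2)" n n p z] A pq z
      by (simp add: q_def herm_adjoint[OF mat_powr_herm])
    also have "mat_powr A (s / 2) *\<^sub>v p = mat_powr A m *\<^sub>v u"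
      unfolding p_def using A u(1) assoc_mult_mat_vec[of "mat_powr A (s / 2)" n n "mat_powr A (r / 2)" n u]
      by (simp add: mat_powr_mult m_def add_divide_distrib add.commute)
    also have "(mat_powr A m *\<^sub>v u) \<bullet>c z = complex_of_real x * ((mat_powr B m *\<^sub>v u) \<bullet>c z)"
      unfolding Au using z u Bp by simp
    also have "(mat_powr B m *\<^sub>v u) \<bullet>c z = (mat_powr B ((r - s) / 2) *\<^sub>v (mat_powr B m *\<^sub>v u)) \<bullet>c u"
      using adjoint_cscalar_prod[of "mat_powr B ((r - s) / 2)" n n "mat_powr B m *\<^sub>v u" u] Bp u
      by (simp add: z_def herm_adjoint[OF mat_powr_herm])
    also have "mat_powr B ((r - s) / 2) *\<^sub>v (mat_powr B m *\<^sub>v u) = mat_powr B r *\<^sub>v u"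
    proof -
      have "(r - s) / 2 + m = r" by (simp add: m_def field_simps)
      then show ?thesis
        using Bp u(1) assoc_mult_mat_vec[of "mat_powr B ((r - s) / 2)" n n "mat_powr B m" n u]
        by (simp add: mat_powr_mult)
    qed
    finally have 1: "Re (p \<bullet>c q) = x * N" by (simp add: N_def qform_def)
    have 2: "Re (p \<bullet>c p) \<le> N"
      unfolding p_def N_def using mat_powr_norm_qform[OF A u(1), of r] qleD[OF r u(1)] by simp
    have "Re (q \<bullet>c q) \<le> qform (mat_powr B s) z"
      unfolding q_def using mat_powr_norm_qform[OF A z, of s] qleD[OF s z] by simp
    also have "\<dots> = Re ((mat_powr B (s / 2) *\<^sub>v z) \<bullet>c (mat_powr B (s / 2) *\<^sub>v z))"
      using mat_powr_norm_qform[OF Bp z] by simp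
    also have "mat_powr B (s / 2) *\<^sub>v z = mat_powr B (r / 2) *\<^sub>v u"
    proof -
      have e: "s / 2 + (r - s) / 2 = r / 2" by (simp add: field_simps)
      have "mat_powr B (s / 2) *\<^sub>v z = (mat_powr B (s / 2) * mat_powr B ((r - s) / 2)) *\<^sub>v u"
        unfolding z_def using Bp u(1) by (simp add: assoc_mult_mat_vec[of _ n n _ n])
      then show ?thesis unfolding mat_powr_mult[OF Bp] e .
    qed
    also have "Re ((mat_powr B (r / 2) *\<^sub>v u) \<bullet>c (mat_powr B (r / 2) *\<^sub>v u)) = N"
      unfolding N_def by (rule mat_powr_norm_qform[OF Bp u(1)])
    finally have "2 * (x * N) \<le> 2 * N" using two_Re_cscalar_le[OF pq] 1 2 by linarith
    then show ?thesis using N by simp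
  qed
  then have "qle n W (1\<^sub>m n)" using qle_one_spectrum[OF W, of 1] by simp
  then have "qle n (mat_powr B (m / 2) * W * mat_powr B (m / 2)) (mat_powr B (m / 2) * 1\<^sub>m n * mat_powr B (m / 2))"
    using W Bp by (intro qle_congruence_herm) auto
  also have "mat_powr B (m / 2) * W * mat_powr B (m / 2) = mat_powr A m"
    unfolding BW using A Bp mat_powr_0[OF B]
    by (simp add: mat_assoc mat_powr_mult right_mult_one_mat[of _ n n])
  also have "mat_powr B (m / 2) * 1\<^sub>m n * mat_powr B (m / 2) = mat_powr B m"
    using Bp by (simp add: mat_powr_mult right_mult_one_mat[of _ n n])
  finally show ?thesis unfolding m_def .
qed

text \<open>If r were missing, the nearest points of \<open>S\<close> on both sides of r would bound
  a gap, but their midpoint lies in \<open>S\<close> and inside the gap.\<close>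

lemma closed_midpoint_interval:
  fixes S :: "real set"
  assumes S: "closed S" "0 \<in> S" "1 \<in> S" "\<And>r s. r \<in> S \<Longrightarrow> s \<in> S \<Longrightarrow> (r + s) / 2 \<in> S"
    and r: "0 \<le> r" "r \<le> 1"
  shows "r \<in> S"
proof (rule ccontr)
  assume nr: "r \<notin> S"
  define a where "a = Sup (S \<inter> {0..r})"
  define b where "b = Inf (S \<inter> {r..1})"
  have "a \<in> S \<inter> {0..r}" unfolding a_def
    using S r by (intro closed_contains_Sup bdd_aboveI[of _ r] closed_Int) auto
  moreover have "b \<in> S \<inter> {r..1}" unfolding b_def
    using S r by (intro closed_contains_Inf bdd_belowI[of _ r] closed_Int) auto
  ultimately have ab: "a \<in> S" "b \<in> S" "0 \<le> a" "a < r" "r < b" "b \<le> 1"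
    using nr by (auto simp: less_le)
  have c: "(a + b) / 2 \<in> S" using S ab by blast
  show False
  proof (cases "(a + b) / 2 \<le> r")
    case True
    then have "(a + b) / 2 \<le> a"
      unfolding a_def by (intro cSup_upper bdd_aboveI[of _ r]) (use c ab in \<open>auto simp: a_def\<close>)
    then show False using ab by simp
  next
    case False
    then have "b \<le> (a + b) / 2"
      unfolding b_def by (intro cInf_lower bdd_belowI[of _ r]) (use c ab in \<open>auto simp: b_def\<close>)
    then show False using ab by simp
  qed
qed

text \<open>A zero eigenvalue contributes the constant 0, because \<open>0 powr r = 0\<close> for
  all r; hence continuity holds also at exponent 0.\<close>

lemma continuous_qform_mat_powr:
  assumes "A \<in> psd_mats n" "v \<in> carrier_vec n"
  shows "continuous_on UNIV (\<lambda>r. qform (mat_powr A r) v)"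
proof -
  obtain U d where U: "U \<in> unitary_mats n"
    and mf: "\<And>f. mat_fun f A = U * rdiag n (\<lambda>i. f (d i)) * mat_adjoint U"
    using herm_cases[OF psd_herm[OF assms(1)]] by metis
  have "continuous_on UNIV (\<lambda>r. x powr r)" for x :: real
    by (cases "x = 0") (auto intro!: continuous_intros)
  then show ?thesis
    unfolding mat_powr_psd_eq[OF assms(1)] mf qform_spectral[OF U assms(2)]
    by (intro continuous_on_sum continuous_on_mult continuous_on_const)
qed

text \<open>The admissible exponents form a closed set that contains 0 and 1 and is stable under
  midpoints. Exponent 0 is covered because B^0 = 1 dominates the projection A^0.\<close>

lemma loewner_heinz_pd:
  assumes A: "A \<in> psd_mats n" and B: "B \<in> pd_mats n" and le: "qle n A B" and r: "0 \<le> r" "r \<le> 1"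
  shows "qle n (mat_powr A r) (mat_powr B r)"
proof -
  define S where "S = {r. qle n (mat_powr A r) (mat_powr B r)}"
  have "S = (\<Inter>v \<in> carrier_vec n. {r. qform (mat_powr A r) v \<le> qform (mat_powr B r) v})"
    unfolding S_def qle_def by auto
  moreover have "closed {r. qform (mat_powr A r) v \<le> qform (mat_powr B r) v}" if "v \<in> carrier_vec n" for v
    using continuous_qform_mat_powr[OF A that] continuous_qform_mat_powr[OF pd_imp_psd[OF B] that]
    by (rule closed_Collect_le)
  ultimately have "closed S" by auto
  moreover have "0 \<in> S"
  proof -
    have "qle n (mat_fun (\<lambda>x. x powr 0) A) (mat_fun (\<lambda>x. 1) A)"
      using A by (intro mat_fun_mono) auto
    then show ?thesis
      using mat_powr_0[OF B] mat_fun_const_1[OF psd_herm[OF A]] by (simp only: S_def mat_powr_psd_eq[OF A] mem_Collect_eq)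
  qed
  moreover have "1 \<in> S" using A B le by (simp add: S_def)
  moreover have "(a + b) / 2 \<in> S" if "a \<in> S" "b \<in> S" for a b
    using that loewner_heinz_midpoint[OF A B] by (simp add: S_def)
  ultimately have "r \<in> S" using closed_midpoint_interval[of S r] r by simp
  then show ?thesis by (simp add: S_def)
qed

text \<open>A singular \<open>B\<close> is replaced by B + e, and e tends to 0. At an eigenvalue 0
  the convergence of e^r to \<open>0 powr r\<close> uses r > 0.\<close>

theorem loewner_heinz:
  assumes A: "A \<in> psd_mats n" and B: "B \<in> psd_mats n" and le: "qle n A B" and r: "0 < r" "r \<le> 1"
  shows "qle n (mat_powr A r) (mat_powr B r)"
proof (rule qleI)
  fix v :: "complex vec" assume v: "v \<in> carrier_vec n"
  have Bh: "B \<in> herm_mats n" using B by simp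
  obtain U d where U: "U \<in> unitary_mats n" and sp: "real_spectrum B = d ` {..<n}"
    and mf: "\<And>f. mat_fun f B = U * rdiag n (\<lambda>i. f (d i)) * mat_adjoint U"
    using herm_cases[OF Bh] by metis
  have d: "0 \<le> d i" if "i < n" for i using psd_spectrum[OF B] sp that by auto
  have bound: "qform (mat_powr A r) v \<le> (\<Sum>i<n. (d i + e) powr r * coord U v i)" if e: "0 < e" for e
  proof -
    have Be: "mat_fun (\<lambda>x. x + e) B \<in> pd_mats n"
      using e psd_spectrum[OF B] by (intro mat_fun_pd[OF Bh]) (simp add: add_nonneg_pos)
    have "qle n (mat_fun (\<lambda>x. x) B) (mat_fun (\<lambda>x. x + e) B)" using e by (intro mat_fun_mono[OF Bh]) simp
    then have "qle n A (mat_fun (\<lambda>x. x + e) B)" using le qle_trans Bh by simp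
    then have "qle n (mat_powr A r) (mat_powr (mat_fun (\<lambda>x. x + e) B) r)"
      using r by (intro loewner_heinz_pd[OF A Be]) auto
    also have "mat_powr (mat_fun (\<lambda>x. x + e) B) r = mat_fun (\<lambda>x. (x + e) powr r) B"
      by (simp add: mat_powr_psd_eq[OF pd_imp_psd[OF Be]] mat_fun_comp[OF Bh])
    finally have *: "qle n (mat_powr A r) (mat_fun (\<lambda>x. (x + e) powr r) B)" .
    show ?thesis using qleD[OF * v] unfolding mf qform_spectral[OF U v] .
  qed
  have "((\<lambda>e. \<Sum>i<n. (d i + e) powr r * coord U v i) \<longlongrightarrow> (\<Sum>i<n. (d i + 0) powr r * coord U v i)) (at_right 0)"
  proof (intro tendsto_sum tendsto_mult tendsto_const tendsto_powr' tendsto_add)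
    show "((\<lambda>e::real. e) \<longlongrightarrow> 0) (at_right 0)" by (rule tendsto_ident_at)
    fix i assume "i \<in> {..<n}"
    then show "d i + 0 \<noteq> 0 \<or> 0 < r \<and> (\<forall>\<^sub>F e in at_right 0. 0 \<le> d i + e)"
      using r d[of i] by (auto simp: eventually_at_right_less intro!: eventually_at_rightI[of 0 1])
  qed
  then have "qform (mat_powr A r) v \<le> (\<Sum>i<n. (d i + 0) powr r * coord U v i)"
    by (rule tendsto_lowerbound) (auto intro!: eventually_at_rightI[of 0 1] bound)
  then show "qform (mat_powr A r) v \<le> qform (mat_powr B r) v"
    by (simp add: mat_powr_psd_eq[OF B] mf qform_spectral[OF U v])
qed

section \<open>Monotonicity of the logarithm\<close>

lemma powr_difference_quotient_tendsto:
  assumes "0 \<le> (x :: real)"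
  shows "((\<lambda>r. (x powr r - x powr 0) / r) \<longlongrightarrow> (if x = 0 then 0 else ln x)) (at_right 0)"
proof (cases "x = 0")
  case False
  then have x: "x > 0" using assms by simp
  have "((\<lambda>r. exp (r * ln x)) has_field_derivative ln x) (at 0)"
    by (auto intro!: derivative_eq_intros)
  then have "((\<lambda>r. (exp (r * ln x) - exp (0 * ln x)) / (r - 0)) \<longlongrightarrow> ln x) (at 0)"
    unfolding has_field_derivative_iff .
  then have "((\<lambda>r. (exp (r * ln x) - exp (0 * ln x)) / (r - 0)) \<longlongrightarrow> ln x) (at_right 0)"
    by (rule filterlim_mono) (auto simp: at_le)
  then show ?thesis using x by (simp add: powr_def)
qed simp

text \<open>The logarithm is the right derivative of the powers X^r at r = 0, so difference
  quotients are compared by Loewner-Heinz. The comparison uses that the values at r = 0 agree: since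
  \<open>v\<close> lies in the range of \<open>B\<close>, both equal <v, v>.\<close>

lemma mat_log_monotone:
  assumes B: "B \<in> psd_mats n" and B': "B' \<in> pd_mats n" and le: "qle n B B'"
    and v: "v \<in> carrier_vec n" and supp: "mat_powr B 0 *\<^sub>v v = v"
  shows "qform (mat_log B) v \<le> qform (mat_log B') v"
proof -
  have Bp': "B' \<in> psd_mats n" using B' by simp
  have lim: "((\<lambda>r. (qform (mat_powr C r) v - qform (mat_powr C 0) v) / r) \<longlongrightarrow> qform (mat_log C) v) (at_right 0)"
    if C: "C \<in> psd_mats n" for C
  proof -
    obtain U d where U: "U \<in> unitary_mats n" and sp: "real_spectrum C = d ` {..<n}"
      and mf: "\<And>f. mat_fun f C = U * rdiag n (\<lambda>i. f (d i)) * mat_adjoint U"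
      using herm_cases[OF psd_herm[OF C]] by metis
    have d: "0 \<le> d i" if "i < n" for i using psd_spectrum[OF C] sp that by auto
    have "((\<lambda>r. \<Sum>i<n. (d i powr r - d i powr 0) / r * coord U v i)
        \<longlongrightarrow> (\<Sum>i<n. (if d i = 0 then 0 else ln (d i)) * coord U v i)) (at_right 0)"
      using d by (intro tendsto_sum tendsto_mult tendsto_const powr_difference_quotient_tendsto) auto
    then show ?thesis
      unfolding mat_powr_psd_eq[OF C] mat_log_def mf qform_spectral[OF U v]
      by (simp add: sum_subtractf[symmetric] sum_divide_distrib diff_divide_distrib left_diff_distrib)
  qed
  have N: "qform (mat_powr B 0) v = Re (v \<bullet>c v)" "qform (mat_powr B' 0) v = Re (v \<bullet>c v)"
    using v B' by (simp_all add: qform_def supp)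
  show ?thesis
  proof (rule tendsto_le[OF _ lim[OF Bp'] lim[OF B]])
    show "\<forall>\<^sub>F r in at_right 0. (qform (mat_powr B r) v - qform (mat_powr B 0) v) / r
        \<le> (qform (mat_powr B' r) v - qform (mat_powr B' 0) v) / r"
      unfolding N using qleD[OF loewner_heinz[OF B Bp' le] v]
      by (auto intro!: eventually_at_rightI[of 0 1] divide_right_mono)
  qed simp
qed

section \<open>Powers of a product and of the reversed product\<close>

lemma mat_powr_intertwine:
  "X \<in> psd_mats n \<Longrightarrow> Y \<in> psd_mats n \<Longrightarrow> K \<in> carrier_mat n n \<Longrightarrow> X * K = K * Y \<Longrightarrow>
     mat_powr X r * K = K * mat_powr Y r"
  using mat_fun_intertwine[of X n Y K] by (simp add: mat_powr_psd_eq)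

lemma psd_gram: "K \<in> carrier_mat n n \<Longrightarrow> K * mat_adjoint K \<in> psd_mats n"
  using psd_congruence[of "1\<^sub>m n" n K] by simp

text \<open>Intertwining by \<open>K\<close> moves one factor out of the power. In the proof of
  Furuta's inequality this trades an exponent in (0, 1] for a nonpositive exponent on the reversed
  product, to which \<open>qle_inverse\<close> applies.\<close>

lemma mat_powr_gram:
  assumes K: "K \<in> carrier_mat n n"
  shows "mat_powr (K * mat_adjoint K) r = K * mat_powr (mat_adjoint K * K) (r - 1) * mat_adjoint K"
proof -
  have p: "K * mat_adjoint K \<in> psd_mats n" "mat_adjoint K * K \<in> psd_mats n"
    using psd_gram[OF K] psd_gram[of "mat_adjoint K" n] K by auto
  have "mat_powr (K * mat_adjoint K) r = mat_powr (K * mat_adjoint K) (r - 1) * mat_powr (K * mat_adjoint K) 1"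
    using p by (simp only: mat_powr_mult) simp
  also have "\<dots> = mat_powr (K * mat_adjoint K) (r - 1) * K * mat_adjoint K"
    using p K mat_assoc[of "mat_powr (K * mat_adjoint K) (r - 1)" K "mat_adjoint K"] by simp
  also have "mat_powr (K * mat_adjoint K) (r - 1) * K = K * mat_powr (mat_adjoint K * K) (r - 1)"
    using K by (intro mat_powr_intertwine[OF p K]) (simp add: mat_assoc)
  finally show ?thesis .
qed

section \<open>Eigenvalues, determinant and trace\<close>

lemma spectral_permute:
  assumes U: "U \<in> unitary_mats n" and p: "bij_betw p {..<n} {..<n}"
  defines "V \<equiv> mat n n (\<lambda>(i, j). U $$ (i, p j))"
  shows "V \<in> unitary_mats n"
    "U * rdiag n d * mat_adjoint U = V * rdiag n (\<lambda>i. d (p i)) * mat_adjoint V"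
proof -
  have V: "V \<in> carrier_mat n n" by (simp add: V_def)
  have pn: "p i < n" if "i < n" for i using p that by (auto simp: bij_betw_def)
  have inj: "p i = p j \<longleftrightarrow> i = j" if "i < n" "j < n" for i j
    using p that by (auto simp: bij_betw_def inj_on_def)
  have UU: "(\<Sum>a<n. cnj (U $$ (a, i)) * U $$ (a, j)) = (if i = j then 1 else 0)" if ij: "i < n" "j < n" for i j
  proof -
    have "(mat_adjoint U * U) $$ (i, j) = (\<Sum>a<n. cnj (U $$ (a, i)) * U $$ (a, j))"
      using ij U by (subst mult_mat_index_sum[of _ n n _ n]) auto
    then show ?thesis using ij unfolding unitary_left[OF U] by simp
  qed
  show "V \<in> unitary_mats n"
  proof (rule unitaryI[OF V], rule eq_matI)
    fix i j assume "i < dim_row (1\<^sub>m n :: complex mat)" "j < dim_col (1\<^sub>m n :: complex mat)"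
    then have ij: "i < n" "j < n" by auto
    have "(mat_adjoint V * V) $$ (i, j) = (\<Sum>a<n. cnj (V $$ (a, i)) * V $$ (a, j))"
      using ij V by (subst mult_mat_index_sum[of _ n n _ n]) auto
    also have "\<dots> = (\<Sum>a<n. cnj (U $$ (a, p i)) * U $$ (a, p j))"
      using ij by (intro sum.cong) (auto simp: V_def)
    also have "\<dots> = 1\<^sub>m n $$ (i, j)" using UU[OF pn pn] inj ij by simp
    finally show "(mat_adjoint V * V) $$ (i, j) = 1\<^sub>m n $$ (i, j)" .
  qed (use V in auto)
  have entry: "(W * rdiag n e * mat_adjoint W) $$ (a, b) = (\<Sum>j<n. W $$ (a, j) * complex_of_real (e j) * cnj (W $$ (b, j)))"
    if "a < n" "b < n" "W \<in> carrier_mat n n" for W e a b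
    using that by (subst mult_mat_index_sum[of _ n n _ n]) (auto simp: mat_diag_mult_right[of _ n n])
  show "U * rdiag n d * mat_adjoint U = V * rdiag n (\<lambda>i. d (p i)) * mat_adjoint V"
  proof (rule eq_matI)
    fix a b assume "a < dim_row (V * rdiag n (\<lambda>i. d (p i)) * mat_adjoint V)"
      "b < dim_col (V * rdiag n (\<lambda>i. d (p i)) * mat_adjoint V)"
    then have ab: "a < n" "b < n" using V by auto
    have "(V * rdiag n (\<lambda>i. d (p i)) * mat_adjoint V) $$ (a, b)
       = (\<Sum>j<n. U $$ (a, p j) * complex_of_real (d (p j)) * cnj (U $$ (b, p j)))"
      unfolding entry[OF ab V] using ab by (intro sum.cong) (auto simp: V_def)
    also have "\<dots> = (\<Sum>j<n. U $$ (a, j) * complex_of_real (d j) * cnj (U $$ (b, j)))"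
      by (rule sum.reindex_bij_betw[OF p])
    finally show "(U * rdiag n d * mat_adjoint U) $$ (a, b) = (V * rdiag n (\<lambda>i. d (p i)) * mat_adjoint V) $$ (a, b)"
      using entry[OF ab unitary_carrier[OF U]] by simp
  qed (use V U in auto)
qed

section \<open>The decreasing list of eigenvalues\<close>

lemma char_poly_spectral:
  assumes U: "U \<in> unitary_mats n"
  shows "char_poly (U * mat_diag n f * mat_adjoint U) = (\<Prod>i\<leftarrow>[0..<n]. [:- f i, 1:])"
proof -
  have "similar_mat (U * mat_diag n f * mat_adjoint U) (mat_diag n f)"
    using U by (intro similar_matI[of _ _ U "mat_adjoint U" n]) auto
  then have "char_poly (U * mat_diag n f * mat_adjoint U) = char_poly (mat_diag n f)"
    by (rule char_poly_similar)
  also have "\<dots> = (\<Prod>a\<leftarrow>diag_mat (mat_diag n f). [:- a, 1:])"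
    by (rule char_poly_upper_triangular[of _ n]) (auto simp: mat_diag_def)
  also have "diag_mat (mat_diag n f) = map f [0..<n]"
    by (simp add: diag_mat_def mat_diag_def)
  finally show ?thesis by (simp add: o_def)
qed

text \<open>Ties the list, defined through the roots of the characteristic polynomial, to
  diagonalizations with decreasing entries.\<close>

lemma eigvals_desc_spectral:
  assumes U: "U \<in> unitary_mats n" and dec: "\<And>i j. i \<le> j \<Longrightarrow> j < n \<Longrightarrow> d j \<le> d i"
  shows "eigvals_desc (U * rdiag n d * mat_adjoint U) = map d [0..<n]"
proof -
  have "proots (\<Prod>i\<leftarrow>is. [:- complex_of_real (d i), 1:]) = mset (map (\<lambda>i. complex_of_real (d i)) is)" for "is"
  proof (induction "is")
    case (Cons i "is")
    have "(\<Prod>i\<leftarrow>is. [:- complex_of_real (d i), 1:]) \<noteq> 0" by (auto simp: prod_list_zero_iff)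
    then show ?case using Cons by (simp add: proots_mult del: mult_pCons_left)
  qed simp
  then have "image_mset Re (proots (char_poly (U * rdiag n d * mat_adjoint U))) = mset (map d [0..<n])"
    unfolding char_poly_spectral[OF U] by (simp add: image_mset.compositionality o_def flip: mset_map)
  moreover have "sort (map d [0..<n]) = rev (map d [0..<n])"
    using dec by (intro properties_for_sort) (auto simp: sorted_rev_iff_nth_mono)
  ultimately show ?thesis
    unfolding eigvals_desc_def by (simp only: sorted_list_of_multiset_mset rev_rev_ident)
qed

lemma herm_sorted_cases:
  assumes "A \<in> herm_mats n"
  obtains U d where "U \<in> unitary_mats n" "A = U * rdiag n d * mat_adjoint U"
    "real_spectrum A = d ` {..<n}"
    "\<And>f. mat_fun f A = U * rdiag n (\<lambda>i. f (d i)) * mat_adjoint U"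
    "\<And>i j. i \<le> j \<Longrightarrow> j < n \<Longrightarrow> d j \<le> d i" "eigvals_desc A = map d [0..<n]"
proof -
  obtain U d where U: "U \<in> unitary_mats n" and A: "A = U * rdiag n d * mat_adjoint U"
    using spectral_theorem[OF assms] by blast
  define ps where "ps = sort_key (\<lambda>i. - d i) [0..<n]"
  have ps: "length ps = n" "distinct ps" "set ps = {..<n}" "sorted (map (\<lambda>i. - d i) ps)"
    by (auto simp: ps_def)
  define p where "p i = ps ! i" for i
  have p: "bij_betw p {..<n} {..<n}"
    using bij_betw_nth[OF ps(2)] ps(1,3) by (simp add: p_def[abs_def])
  define V where "V = mat n n (\<lambda>(i, j). U $$ (i, p j))"
  have V: "V \<in> unitary_mats n" and AV: "A = V * rdiag n (\<lambda>i. d (p i)) * mat_adjoint V"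
    using spectral_permute(1)[OF U p] spectral_permute(2)[OF U p, of d] A unfolding V_def by simp_all
  have dec: "d (p j) \<le> d (p i)" if "i \<le> j" "j < n" for i j
    using ps(4) that ps(1) unfolding sorted_iff_nth_mono p_def by force
  show thesis
  proof (rule that[OF V AV])
    show "real_spectrum A = (\<lambda>i. d (p i)) ` {..<n}" using AV real_spectrum_spectral[OF V] by simp
    show "mat_fun f A = V * rdiag n (\<lambda>i. f (d (p i))) * mat_adjoint V" for f
      by (rule mat_fun_eqI[OF V AV])
    show "d (p j) \<le> d (p i)" if "i \<le> j" "j < n" for i j using that by (rule dec)
    show "eigvals_desc A = map (\<lambda>i. d (p i)) [0..<n]"
      using AV eigvals_desc_spectral[OF V, of "\<lambda>i. d (p i)"] dec by simp
  qed
qed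

lemma eigvals_desc_length: "A \<in> herm_mats n \<Longrightarrow> length (eigvals_desc A) = n"
  by (erule herm_sorted_cases) simp

lemma eigvals_desc_mem: "A \<in> herm_mats n \<Longrightarrow> i < n \<Longrightarrow> eigvals_desc A ! i \<in> real_spectrum A"
  by (erule herm_sorted_cases) auto

lemma eigvals_desc_nonneg: "A \<in> psd_mats n \<Longrightarrow> i < n \<Longrightarrow> 0 \<le> eigvals_desc A ! i"
  using eigvals_desc_mem[OF psd_herm] psd_spectrum by blast

lemma eigvals_desc_mat_fun:
  assumes A: "A \<in> herm_mats n"
    and f: "\<And>x y. x \<in> real_spectrum A \<Longrightarrow> y \<in> real_spectrum A \<Longrightarrow> x \<le> y \<Longrightarrow> f x \<le> f y"
  shows "eigvals_desc (mat_fun f A) = map f (eigvals_desc A)"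
proof -
  obtain U d where U: "U \<in> unitary_mats n" "real_spectrum A = d ` {..<n}"
    and mf: "\<And>f. mat_fun f A = U * rdiag n (\<lambda>i. f (d i)) * mat_adjoint U"
    and dec: "\<And>i j. i \<le> j \<Longrightarrow> j < n \<Longrightarrow> d j \<le> d i" and ev: "eigvals_desc A = map d [0..<n]"
    using herm_sorted_cases[OF A] by metis
  have "eigvals_desc (mat_fun f A) = map (\<lambda>i. f (d i)) [0..<n]"
    unfolding mf using U dec by (intro eigvals_desc_spectral f) auto
  then show ?thesis unfolding ev by simp
qed

lemma eigvals_desc_mat_powr:
  assumes "A \<in> psd_mats n" "0 < r"
  shows "eigvals_desc (mat_powr A r) = map (\<lambda>x. x powr r) (eigvals_desc A)"
  unfolding mat_powr_psd_eq[OF assms(1)]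
  using psd_spectrum[OF assms(1)] assms(2)
  by (intro eigvals_desc_mat_fun[OF psd_herm[OF assms(1)]]) (simp add: powr_mono2)

lemma prod_eigvals_mat_powr:
  assumes "A \<in> psd_mats n" "0 < r" "k \<le> n"
  shows "(\<Prod>i<k. eigvals_desc (mat_powr A r) ! i) = (\<Prod>i<k. eigvals_desc A ! i) powr r"
proof -
  have "(\<Prod>i<k. eigvals_desc (mat_powr A r) ! i) = (\<Prod>i<k. eigvals_desc A ! i powr r)"
    using assms eigvals_desc_length[OF psd_herm[OF assms(1)]]
    by (intro prod.cong) (auto simp: eigvals_desc_mat_powr)
  also have "\<dots> = (\<Prod>i<k. eigvals_desc A ! i) powr r"
    by (rule prod_powr_distrib[symmetric])
  finally show ?thesis .
qed

lemma log_maj_mat_powr: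
  assumes X: "X \<in> psd_mats n" and Y: "Y \<in> psd_mats n" and r: "0 < r" and XY: "log_maj n X Y"
  shows "log_maj n (mat_powr X r) (mat_powr Y r)"
proof -
  have "0 \<le> (\<Prod>i<k. eigvals_desc X ! i)" if "k \<le> n" for k
    using eigvals_desc_nonneg[OF X] that by (intro prod_nonneg) auto
  then show ?thesis
    using XY r unfolding log_maj_def
    by (auto simp: prod_eigvals_mat_powr[OF X r] prod_eigvals_mat_powr[OF Y r] intro!: powr_mono2)
qed

lemma max_eigval_le:
  "X \<in> herm_mats n \<Longrightarrow> qle n X (complex_of_real c \<cdot>\<^sub>m 1\<^sub>m n) \<Longrightarrow> 0 < n \<Longrightarrow> eigvals_desc X ! 0 \<le> c"
  using qle_spectrum_le eigvals_desc_mem by blast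

lemma qle_max_eigval:
  assumes "X \<in> herm_mats n"
  shows "qle n X (complex_of_real (eigvals_desc X ! 0) \<cdot>\<^sub>m 1\<^sub>m n)"
proof (rule qle_one_spectrum[OF assms])
  fix x assume "x \<in> real_spectrum X"
  moreover obtain d where "real_spectrum X = d ` {..<n}" "eigvals_desc X = map d [0..<n]"
    "\<And>i j. i \<le> j \<Longrightarrow> j < n \<Longrightarrow> d j \<le> d i" using herm_sorted_cases[OF assms] by metis
  ultimately show "x \<le> eigvals_desc X ! 0" by auto
qed

section \<open>Trace and determinant\<close>

definition real_trace :: "complex mat \<Rightarrow> real" where
  "real_trace F = (\<Sum>i<dim_row F. Re (F $$ (i, i)))"

lemma real_trace_add:
  "F \<in> carrier_mat n n \<Longrightarrow> G \<in> carrier_mat n n \<Longrightarrow> real_trace (F + G) = real_trace F + real_trace G"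
  by (simp add: real_trace_def sum.distrib)

lemma real_trace_smult:
  "F \<in> carrier_mat n n \<Longrightarrow> real_trace (complex_of_real c \<cdot>\<^sub>m F) = c * real_trace F"
  by (simp add: real_trace_def sum_distrib_left)

text \<open>The trace does not depend on the orthonormal basis. The Ky Fan argument needs it in a
  basis of eigenvectors of another matrix.\<close>

lemma sum_qform_cols:
  assumes F: "F \<in> carrier_mat n n" and V: "V \<in> unitary_mats n"
  shows "(\<Sum>i<n. qform F (col V i)) = real_trace F"
proof -
  have Vc: "V \<in> carrier_mat n n" using V by simp
  have "qform F (col V i) = Re (\<Sum>a<n. cnj (V $$ (a, i)) * (F * V) $$ (a, i))" if i: "i < n" for i
  proof -
    have "F *\<^sub>v col V i = col (F * V) i" using col_mult2[OF F Vc i] by (rule sym)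
    then have "qform F (col V i) = Re (col (F * V) i \<bullet>c col V i)" unfolding qform_def by simp
    also have "col (F * V) i \<bullet>c col V i = (\<Sum>a<n. col (F * V) i $ a * cnj (col V i $ a))"
      using F Vc by (intro cscalar_prod_sum) (auto intro!: carrier_vecI)
    also have "\<dots> = (\<Sum>a<n. cnj (V $$ (a, i)) * (F * V) $$ (a, i))"
      using F Vc i by (intro sum.cong refl) simp
    finally show ?thesis .
  qed
  then have "(\<Sum>i<n. qform F (col V i)) = Re (\<Sum>i<n. \<Sum>a<n. cnj (V $$ (a, i)) * (F * V) $$ (a, i))"
    by simp
  also have "\<dots> = Re (\<Sum>a<n. \<Sum>i<n. (F * V) $$ (a, i) * mat_adjoint V $$ (i, a))"
    using Vc by (subst sum.swap) (simp add: mult.commute del: index_mult_mat(1))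
  also have "\<dots> = Re (\<Sum>a<n. (F * V * mat_adjoint V) $$ (a, a))"
    using F Vc by (simp add: mult_mat_index_sum[of "F * V" n n _ n] del: index_mult_mat(1))
  also have "F * V * mat_adjoint V = F"
    using F Vc V mat_assoc[of F V "mat_adjoint V"] by simp
  finally show ?thesis using F by (simp add: real_trace_def)
qed

lemma real_trace_spectral:
  assumes U: "U \<in> unitary_mats n"
  shows "real_trace (U * rdiag n d * mat_adjoint U) = (\<Sum>i<n. d i)"
proof -
  have "qform (U * rdiag n d * mat_adjoint U) (col U i) = d i" if "i < n" for i
    using that U by (simp add: qform_spectral coord_col if_distrib[of "\<lambda>x. _ * x"] cong: if_cong)
  then show ?thesis
    using sum_qform_cols[OF _ U, of "U * rdiag n d * mat_adjoint U"] U by simp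
qed

lemma det_spectral:
  assumes U: "U \<in> unitary_mats n"
  shows "det (U * rdiag n d * mat_adjoint U) = complex_of_real (\<Prod>i<n. d i)"
proof -
  have c: "U \<in> carrier_mat n n" "mat_adjoint U \<in> carrier_mat n n" using U by auto
  have "det (U * rdiag n d * mat_adjoint U) = det (U * mat_adjoint U) * det (rdiag n d)"
    using c det_mult[of "U * rdiag n d" n "mat_adjoint U"] det_mult[of U n "rdiag n d"]
      det_mult[OF c] U by simp
  also have "det (rdiag n d) = prod_list (diag_mat (rdiag n d))"
    by (rule det_upper_triangular[of _ n]) (auto simp: mat_diag_def)
  also have "diag_mat (rdiag n d) = map (\<lambda>i. complex_of_real (d i)) [0..<n]"
    by (simp add: diag_mat_def mat_diag_def)
  finally show ?thesis using U
    by (simp add: prod.distinct_set_conv_list[of "[0..<n]", symmetric] atLeast0LessThan)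
qed

definition real_det :: "complex mat \<Rightarrow> real" where
  "real_det A = Re (det A)"

lemma det_herm: "A \<in> herm_mats n \<Longrightarrow> det A = complex_of_real (real_det A)"
  by (erule herm_cases) (simp add: det_spectral real_det_def del: of_real_prod)

lemma real_det_psd: "A \<in> psd_mats n \<Longrightarrow> real_det A = (\<Prod>i<n. eigvals_desc A ! i)"
  by (rule herm_sorted_cases[OF psd_herm]) (auto simp: det_spectral real_det_def simp del: of_real_prod)

lemma real_det_nonneg: "A \<in> psd_mats n \<Longrightarrow> 0 \<le> real_det A"
  by (auto simp: real_det_psd intro!: prod_nonneg eigvals_desc_nonneg)

lemma real_det_pos: "A \<in> pd_mats n \<Longrightarrow> 0 < real_det A"
  using real_det_psd[OF pd_imp_psd] pd_spectrum eigvals_desc_mem[OF pd_herm]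
  by (metis lessThan_iff prod_pos)

lemma real_det_mult3:
  assumes "A \<in> herm_mats n" "B \<in> herm_mats n" "C \<in> herm_mats n"
  shows "real_det (A * B * C) = real_det A * real_det B * real_det C"
proof -
  have "det (A * B * C) = complex_of_real (real_det A * real_det B * real_det C)"
    using assms det_mult[of "A * B" n C] det_mult[of A n B] det_herm[OF assms(1)] det_herm[OF assms(2)]
      det_herm[OF assms(3)] by simp
  then show ?thesis unfolding real_det_def[of "A * B * C"] by (simp only: Re_complex_of_real)
qed

lemma real_det_mat_powr:
  assumes "A \<in> psd_mats n"
  shows "real_det (mat_powr A r) = real_det A powr r"
proof -
  obtain U d where U: "U \<in> unitary_mats n" and A: "A = U * rdiag n d * mat_adjoint U" and sp: "real_spectrum A = d ` {..<n}"
    and mf: "\<And>f. mat_fun f A = U * rdiag n (\<lambda>i. f (d i)) * mat_adjoint U"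
    using herm_cases[OF psd_herm[OF assms]] by metis
  have "real_det A = (\<Prod>i<n. d i)" using det_spectral[OF U, of d] A by (simp add: real_det_def del: of_real_prod)
  moreover have "real_det (mat_powr A r) = (\<Prod>i<n. d i powr r)"
    unfolding mat_powr_psd_eq[OF assms] mf by (simp add: real_det_def det_spectral[OF U] del: of_real_prod)
  moreover have "0 \<le> d i" if "i < n" for i using psd_spectrum[OF assms] sp that by auto
  ultimately show ?thesis by (simp add: prod_powr_distrib)
qed

lemma real_trace_mat_log:
  assumes "A \<in> pd_mats n"
  shows "real_trace (mat_log A) = ln (real_det A)"
proof -
  obtain U d where U: "U \<in> unitary_mats n" and A: "A = U * rdiag n d * mat_adjoint U" and sp: "real_spectrum A = d ` {..<n}"
    and mf: "\<And>f. mat_fun f A = U * rdiag n (\<lambda>i. f (d i)) * mat_adjoint U"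
    using herm_cases[OF pd_herm[OF assms]] by metis
  have d': "d i \<noteq> 0" if "i < n" for i using pd_spectrum[OF assms, of "d i"] sp that by auto
  have "real_det A = (\<Prod>i<n. d i)" using det_spectral[OF U, of d] A by (simp add: real_det_def del: of_real_prod)
  moreover have "real_trace (mat_log A) = (\<Sum>i<n. if d i = 0 then 0 else ln (d i))"
    unfolding mat_log_def mf by (rule real_trace_spectral[OF U])
  moreover have "ln (\<Prod>i<n. d i) = (\<Sum>i<n. ln (d i))" using d' by (intro ln_prod) auto
  moreover have "(\<Sum>i<n. if d i = 0 then 0 else ln (d i)) = (\<Sum>i<n. ln (d i))"
    using d' by (intro sum.cong) auto
  ultimately show ?thesis by simp
qed

lemma mat_fun_eigenvector:
  assumes X: "X \<in> herm_mats n" and v: "v \<in> carrier_vec n" and ev: "X *\<^sub>v v = complex_of_real x \<cdot>\<^sub>v v"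
  shows "mat_fun f X *\<^sub>v v = complex_of_real (f x) \<cdot>\<^sub>v v"
proof -
  obtain U d where U: "U \<in> unitary_mats n" and Xe: "X = U * rdiag n d * mat_adjoint U"
    and mf: "\<And>f. mat_fun f X = U * rdiag n (\<lambda>i. f (d i)) * mat_adjoint U"
    using herm_cases[OF X] by metis
  have Uc: "U \<in> carrier_mat n n" "mat_adjoint U \<in> carrier_mat n n" using U by auto
  define w where "w = mat_adjoint U *\<^sub>v v"
  have w: "w \<in> carrier_vec n" unfolding w_def using Uc v by simp
  have sp: "(U * rdiag n e * mat_adjoint U) *\<^sub>v v = U *\<^sub>v (rdiag n e *\<^sub>v w)" for e
    unfolding w_def using U v by (simp add: assoc_mult_mat_vec[of _ n n _ n])
  have vw: "v = U *\<^sub>v w" unfolding w_def using unitary_adjoint_vec_cancel[OF U v] by simp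
  have "mat_adjoint U *\<^sub>v (U *\<^sub>v (rdiag n d *\<^sub>v w)) = mat_adjoint U *\<^sub>v (complex_of_real x \<cdot>\<^sub>v v)"
    using ev unfolding Xe sp by simp
  moreover have "mat_adjoint U *\<^sub>v (U *\<^sub>v (rdiag n d *\<^sub>v w)) = rdiag n d *\<^sub>v w"
    using unitary_adjoint_vec_cancel[OF unitary_adjoint[OF U], of "rdiag n d *\<^sub>v w"] w by simp
  moreover have "mat_adjoint U *\<^sub>v (complex_of_real x \<cdot>\<^sub>v v) = complex_of_real x \<cdot>\<^sub>v w"
    unfolding w_def using U v by (simp add: mult_mat_vec[of _ n n])
  ultimately have eq: "rdiag n d *\<^sub>v w = complex_of_real x \<cdot>\<^sub>v w" by simp
  have "rdiag n (\<lambda>i. f (d i)) *\<^sub>v w = complex_of_real (f x) \<cdot>\<^sub>v w"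
  proof (rule eq_vecI)
    fix i assume "i < dim_vec (complex_of_real (f x) \<cdot>\<^sub>v w)"
    then have i: "i < n" using w by simp
    have "(rdiag n d *\<^sub>v w) $ i = complex_of_real x * w $ i" unfolding eq using i w by simp
    then have "w $ i = 0 \<or> d i = x" using mat_diag_mult_vec[OF w i, of "\<lambda>i. complex_of_real (d i)"] by auto
    then show "(rdiag n (\<lambda>i. f (d i)) *\<^sub>v w) $ i = (complex_of_real (f x) \<cdot>\<^sub>v w) $ i"
      using mat_diag_mult_vec[OF w i, of "\<lambda>i. complex_of_real (f (d i))"] i w by auto
  qed (use w in auto)
  then have "mat_fun f X *\<^sub>v v = U *\<^sub>v (complex_of_real (f x) \<cdot>\<^sub>v w)" unfolding mf sp by simp
  also have "\<dots> = complex_of_real (f x) \<cdot>\<^sub>v v" unfolding vw using Uc w by (simp add: mult_mat_vec[of _ n n])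
  finally show ?thesis .
qed

section \<open>Eigenvalues of a product in either order\<close>

lemma poly_char_poly:
  fixes A :: "complex mat"
  assumes A: "A \<in> carrier_mat n n"
  shows "poly (char_poly A) x = det (x \<cdot>\<^sub>m 1\<^sub>m n - A)"
proof -
  have h: "comm_ring_hom (\<lambda>p. poly p x)" by (unfold_locales) auto
  have "map_mat (\<lambda>p. poly p x) (char_poly_matrix A) = x \<cdot>\<^sub>m 1\<^sub>m n - A"
    using A by (intro eq_matI) (auto simp: char_poly_matrix_def)
  then show ?thesis unfolding char_poly_def using comm_ring_hom.hom_det[OF h, of "char_poly_matrix A"] by simp
qed

text \<open>With T = x 1, the block matrix with rows (T, K) and (L, 1) has determinant det(T - KL).
  Conjugation by the block swap \<open>J\<close> gives rows (1, L) and (K, T) and the determinant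
  det(T - LK), while the square of det J is 1.\<close>

lemma det_one_minus_mult_commute:
  fixes K L :: "complex mat"
  assumes K: "K \<in> carrier_mat n n" and L: "L \<in> carrier_mat n n"
  shows "det (x \<cdot>\<^sub>m 1\<^sub>m n - K * L) = det (x \<cdot>\<^sub>m 1\<^sub>m n - L * K)"
proof -
  define T where "T = x \<cdot>\<^sub>m 1\<^sub>m n"
  have T: "T \<in> carrier_mat n n" and TK: "K * T = T * K"
    using K by (auto simp: T_def mat_mult_smult mat_smult_mult right_mult_one_mat[of _ n n] left_mult_one_mat[of _ n n])
  define M where "M = four_block_mat T K L (1\<^sub>m n)"
  define J where "J = four_block_mat (0\<^sub>m n n) (1\<^sub>m n) (1\<^sub>m n) (0\<^sub>m n n :: complex mat)"
  have Jc: "J \<in> carrier_mat (n + n) (n + n)" and Mc: "M \<in> carrier_mat (n + n) (n + n)"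
    using T by (auto simp: J_def M_def)
  have JJ: "J * J = 1\<^sub>m (n + n)"
    unfolding J_def by (subst mult_four_block_mat[of _ n n _ n _ n]) (auto intro!: eq_matI)
  have JM: "J * M = four_block_mat L (1\<^sub>m n) T K"
    unfolding J_def M_def using T K L by (subst mult_four_block_mat[of _ n n _ n _ n]) auto
  have JMJ: "J * M * J = four_block_mat (1\<^sub>m n) L K T"
    unfolding JM unfolding J_def using T K L by (subst mult_four_block_mat[of _ n n _ n _ n]) auto
  have "det J * det J = 1" using det_mult[OF Jc Jc] JJ by simp
  moreover have "det (J * M * J) = det J * det M * det J"
    using det_mult[OF _ Jc, of "J * M"] det_mult[OF Jc Mc] Jc Mc by simp
  ultimately have "det (J * M * J) = det M" by (metis mult.commute mult.left_commute mult.right_neutral)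
  moreover have "det M = det (T - K * L)"
    unfolding M_def using T K L by (subst det_four_block_mat[of _ n]) auto
  moreover have "det (J * M * J) = det (T - L * K)"
    unfolding JMJ using T K L TK by (subst det_four_block_mat[of _ n]) auto
  ultimately show ?thesis unfolding T_def by simp
qed

lemma eigvals_desc_mult_commute:
  assumes "K \<in> carrier_mat n n" "L \<in> carrier_mat n n"
  shows "eigvals_desc (K * L) = eigvals_desc (L * K)"
proof -
  have "poly (char_poly (K * L)) = poly (char_poly (L * K))"
    using assms by (intro ext) (simp add: poly_char_poly[of _ n] det_one_minus_mult_commute)
  then have "char_poly (K * L) = char_poly (L * K)" by (simp add: poly_eq_poly_eq_iff)
  then show ?thesis unfolding eigvals_desc_def by simp
qed

section \<open>Projected exponentials\<close>

lemma smult_smult_mat: "a \<cdot>\<^sub>m (b \<cdot>\<^sub>m A) = (a * b) \<cdot>\<^sub>m (A :: complex mat)"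
  by (intro eq_matI) auto

lemma smult_add_mat:
  "dim_row A = dim_row B \<Longrightarrow> dim_col A = dim_col B \<Longrightarrow>
     a \<cdot>\<^sub>m (A + B) = a \<cdot>\<^sub>m A + a \<cdot>\<^sub>m (B :: complex mat)"
  by (intro eq_matI) (auto simp: distrib_left)

section \<open>Support projections\<close>

lemma mat_range_mult_subset:
  assumes "Y \<in> carrier_mat n n" "Z \<in> carrier_mat n n"
  shows "mat_range (Y * Z) \<subseteq> mat_range Y"
proof -
  have "Y * Z *\<^sub>v v = Y *\<^sub>v (Z *\<^sub>v v)" "Z *\<^sub>v v \<in> carrier_vec n" if "v \<in> carrier_vec n" for v
    using assms that by (auto simp: assoc_mult_mat_vec[of _ n n _ n])
  then show ?thesis unfolding mat_range_def using assms by fastforce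
qed

text \<open>The identities A^0 = A A^-1 and A = A^0 A show that both have the same range. Statements
  on supports thus become identities between powers.\<close>

lemma supp_proj_eq:
  assumes "A \<in> psd_mats n"
  shows "supp_proj A = mat_powr A 0"
proof -
  have "mat_powr A 0 = A * mat_powr A (- 1)" "A = mat_powr A 0 * A"
    using mat_powr_mult[OF assms, of 1 "- 1"] mat_powr_mult[OF assms, of 0 1] assms by simp_all
  then have "mat_range (mat_powr A 0) = mat_range A"
    using mat_range_mult_subset[of A n "mat_powr A (- 1)"] mat_range_mult_subset[of "mat_powr A 0" n A] assms
    by auto
  then show ?thesis
    unfolding supp_proj_def using assms
    by (simp add: orth_proj_eqI herm_adjoint[OF mat_powr_herm] mat_powr_mult)
qed

text \<open>For v in the range of \<open>Q\<close> the order gives <v, v> \<le> <P v, v>, and |v - P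
  v|^2 = <v, v> - <P v, v> is then at most 0. So the order of projections is inclusion of ranges,
  and the meet is the smaller projection.\<close>

lemma supp_absorb:
  assumes A: "A \<in> psd_mats n" and B: "B \<in> psd_mats n" and le: "loewner_le (supp_proj B) (supp_proj A)"
  shows "mat_powr A 0 * mat_powr B 0 = mat_powr B 0"
    and "proj_meet (supp_proj A) (supp_proj B) = mat_powr B 0"
proof -
  define P where "P = mat_powr A 0"
  define Q where "Q = mat_powr B 0"
  have P: "P \<in> carrier_mat n n" "mat_adjoint P = P" "P * P = P" "P \<in> herm_mats n"
    and Q: "Q \<in> carrier_mat n n" "mat_adjoint Q = Q" "Q * Q = Q" "Q \<in> herm_mats n"
    using A B unfolding P_def Q_def by (simp_all add: herm_adjoint[OF mat_powr_herm] mat_powr_mult)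
  have PQ: "P - Q \<in> psd_mats n"
    using le B unfolding loewner_le_def supp_proj_eq[OF A] supp_proj_eq[OF B] P_def Q_def by simp
  have sub: "mat_range Q \<subseteq> mat_range P"
  proof
    fix v assume "v \<in> mat_range Q"
    then obtain x where x: "x \<in> carrier_vec n" "v = Q *\<^sub>v x" using Q unfolding mat_range_def by auto
    have v: "v \<in> carrier_vec n" using x Q by simp
    have Qv: "Q *\<^sub>v v = v" using x Q assoc_mult_mat_vec[of Q n n Q n x] by simp
    have "0 \<le> qform (P - Q) v" using PQ v unfolding psd_iff by blast
    also have "qform (P - Q) v = qform P v - qform Q v"
      unfolding qform_def using P(1) Q(1) v
      by (simp add: minus_mult_distrib_mat_vec[of _ n n] minus_scalar_prod_distrib[of _ n])
    finally have 1: "Re (v \<bullet>c v) \<le> qform P v" by (simp add: qform_def Qv)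
    define w where "w = v - P *\<^sub>v v"
    have w: "w \<in> carrier_vec n" using v P by (simp add: w_def)
    have Pw: "P *\<^sub>v w = 0\<^sub>v n"
      unfolding w_def using v P(1,3) assoc_mult_mat_vec[of P n n P n v]
      by (simp add: mult_minus_distrib_mat_vec[of _ n n])
    have "Re (w \<bullet>c w) = Re (v \<bullet>c w) - Re ((P *\<^sub>v v) \<bullet>c w)"
      unfolding w_def using v P(1) by (simp add: minus_scalar_prod_distrib[of _ n])
    also have "(P *\<^sub>v v) \<bullet>c w = v \<bullet>c (P *\<^sub>v w)" using adjoint_cscalar_prod[OF P(1) v w] P(2) by simp
    also have "v \<bullet>c (P *\<^sub>v w) = 0" unfolding Pw using v by simp
    also have "Re (v \<bullet>c w) = Re (v \<bullet>c v) - Re (v \<bullet>c (P *\<^sub>v v))"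
    proof -
      have "v \<bullet>c w = v \<bullet>c v - v \<bullet>c (P *\<^sub>v v)"
        unfolding w_def using v P(1)
        by (simp add: cscalar_prod_sum[of _ n] sum_subtractf[symmetric] right_diff_distrib del: index_mult_mat_vec)
      then show ?thesis by simp
    qed
    also have "v \<bullet>c (P *\<^sub>v v) = (P *\<^sub>v v) \<bullet>c v" using adjoint_cscalar_prod[OF P(1) v v] P(2) by simp
    finally have "Re (w \<bullet>c w) \<le> 0" using 1 by (simp add: qform_def)
    then have "w = 0\<^sub>v n" using cscalar_prod_self_pos[OF w] by force
    then have "v = P *\<^sub>v v" using v P(1) unfolding w_def
      by (intro eq_vecI) (auto simp: vec_eq_iff simp del: index_mult_mat_vec)
    then show "v \<in> mat_range P" using v P unfolding mat_range_def by auto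
  qed
  show "mat_powr A 0 * mat_powr B 0 = mat_powr B 0"
    using proj_absorb[OF P(1,3) Q(1) sub] unfolding P_def Q_def .
  have "mat_range P \<inter> mat_range Q = mat_range Q" using sub by auto
  then show "proj_meet (supp_proj A) (supp_proj B) = mat_powr B 0"
    unfolding proj_meet_def supp_proj_eq[OF A] supp_proj_eq[OF B] using P Q
    by (simp add: orth_proj_eqI flip: P_def Q_def)
qed

text \<open>Arbitrary weights make the family closed under powers of the mean and under nonzero
  powers of its arguments. The projection is the support of \<open>B\<close> alone, in accordance
  with s(A) \<ge> s(B).\<close>

definition weighted_LE :: "real \<Rightarrow> real \<Rightarrow> complex mat \<Rightarrow> complex mat \<Rightarrow> complex mat" where
  "weighted_LE a b A B = mat_powr B 0 *
     mat_exp (complex_of_real a \<cdot>\<^sub>m (mat_powr B 0 * mat_log A * mat_powr B 0) +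
              complex_of_real b \<cdot>\<^sub>m (mat_powr B 0 * mat_log B * mat_powr B 0))"

lemma LE_mean_eq:
  assumes "A \<in> psd_mats n" "B \<in> psd_mats n" "loewner_le (supp_proj B) (supp_proj A)"
  shows "LE_mean \<alpha> A B = weighted_LE (1 - \<alpha>) \<alpha> A B"
  unfolding LE_mean_def supp_absorb(2)[OF assms] Let_def weighted_LE_def ..

lemma mat_log_herm [simp]: "A \<in> herm_mats n \<Longrightarrow> mat_log A \<in> herm_mats n"
  by (simp add: mat_log_def)

lemma mat_exp_pd [simp]: "A \<in> herm_mats n \<Longrightarrow> mat_exp A \<in> pd_mats n"
  unfolding mat_exp_def by (rule mat_fun_pd) auto

lemma mat_log_mat_powr:
  assumes "A \<in> psd_mats n" "r \<noteq> 0"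
  shows "mat_log (mat_powr A r) = complex_of_real r \<cdot>\<^sub>m mat_log A"
  unfolding mat_log_def mat_powr_psd_eq[OF assms(1)] mat_fun_comp[OF psd_herm[OF assms(1)]]
    mat_fun_smult[OF psd_herm[OF assms(1)]]
  by (rule mat_fun_cong[OF psd_herm[OF assms(1)]]) simp

lemma smult_eq_mat_fun: "A \<in> herm_mats n \<Longrightarrow> complex_of_real c \<cdot>\<^sub>m A = mat_fun (\<lambda>x. c * x) A"
  using mat_fun_smult[of A n c "\<lambda>x. x"] by simp

lemma mat_powr_smult:
  assumes "A \<in> psd_mats n" "0 \<le> c"
  shows "mat_powr (complex_of_real c \<cdot>\<^sub>m A) r = complex_of_real (c powr r) \<cdot>\<^sub>m mat_powr A r"
    and "complex_of_real c \<cdot>\<^sub>m A \<in> psd_mats n"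
proof -
  have Ah: "A \<in> herm_mats n" using assms by simp
  show p: "complex_of_real c \<cdot>\<^sub>m A \<in> psd_mats n"
    unfolding smult_eq_mat_fun[OF Ah] using assms psd_spectrum by (intro mat_fun_psd[OF Ah]) auto
  show "mat_powr (complex_of_real c \<cdot>\<^sub>m A) r = complex_of_real (c powr r) \<cdot>\<^sub>m mat_powr A r"
    unfolding mat_powr_psd_eq[OF p] mat_powr_psd_eq[OF assms(1)] unfolding smult_eq_mat_fun[OF Ah]
      mat_fun_comp[OF Ah] mat_fun_smult[OF Ah]
    using assms psd_spectrum[OF assms(1)] by (intro mat_fun_cong[OF Ah]) (simp add: powr_mult)
qed

lemma pd_smult:
  assumes "A \<in> pd_mats n" "0 < c"
  shows "complex_of_real c \<cdot>\<^sub>m A \<in> pd_mats n"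
    and "mat_log (complex_of_real c \<cdot>\<^sub>m A) = complex_of_real (ln c) \<cdot>\<^sub>m 1\<^sub>m n + mat_log A"
proof -
  have Ah: "A \<in> herm_mats n" using assms by simp
  show p: "complex_of_real c \<cdot>\<^sub>m A \<in> pd_mats n"
    unfolding smult_eq_mat_fun[OF Ah] using assms pd_spectrum by (intro mat_fun_pd[OF Ah]) auto
  have pos: "0 < x" if "x \<in> real_spectrum A" for x using pd_spectrum[OF assms(1) that] .
  have "mat_log (complex_of_real c \<cdot>\<^sub>m A) = mat_fun (\<lambda>x. ln c * 1 + (if x = 0 then 0 else ln x)) A"
    unfolding mat_log_def smult_eq_mat_fun[OF Ah] mat_fun_comp[OF Ah]
    by (intro mat_fun_cong[OF Ah]) (use assms(2) pos in \<open>fastforce simp: ln_mult\<close>)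
  then show "mat_log (complex_of_real c \<cdot>\<^sub>m A) = complex_of_real (ln c) \<cdot>\<^sub>m 1\<^sub>m n + mat_log A"
    unfolding mat_fun_add[OF Ah, symmetric] mat_fun_smult[OF Ah, symmetric] mat_fun_const_1[OF Ah] mat_log_def .
qed

text \<open>The Log-Euclidean mean has the form \<open>P * mat_exp K\<close>, with \<open>P\<close> the common support projection.\<close>

locale projected_exp =
  fixes n :: nat and P K :: "complex mat"
  assumes P_herm: "P \<in> herm_mats n" and P_idem: "P * P = P"
    and K_herm: "K \<in> herm_mats n" and PK: "P * K = K"
begin

lemma KP: "K * P = K"
proof -
  have "mat_adjoint (P * K) = mat_adjoint K" using PK by simp
  then show ?thesis using P_herm K_herm by (simp add: mat_adjoint_times herm_adjoint)
qed

lemma exp_commute: "mat_exp K * P = P * mat_exp K"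
  unfolding mat_exp_def using PK KP P_herm by (intro mat_fun_intertwine[OF K_herm K_herm]) auto

lemma carriers: "P \<in> carrier_mat n n" "K \<in> carrier_mat n n" "mat_exp K \<in> carrier_mat n n"
  using P_herm K_herm mat_exp_pd[OF K_herm] by auto

lemma eq_congruence: "P * mat_exp K = P * mat_exp K * P"
proof -
  have "P * mat_exp K * P = P * (P * mat_exp K)"
    using carriers mat_assoc[of P "mat_exp K" P] by (simp add: exp_commute)
  also have "\<dots> = P * P * mat_exp K" using carriers mat_assoc[of P P "mat_exp K"] by simp
  finally show ?thesis by (simp add: P_idem)
qed

lemma psd: "P * mat_exp K \<in> psd_mats n"
  by (subst eq_congruence) (rule psd_congruence'[OF pd_imp_psd[OF mat_exp_pd[OF K_herm]] P_herm])

text \<open>\<open>P\<close> intertwines P exp(K) with exp(K), so the power acts on the exponential;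
  a power of P exp(K) absorbs \<open>P\<close> from the right.\<close>

lemma powr: "mat_powr (P * mat_exp K) r = P * mat_exp (complex_of_real r \<cdot>\<^sub>m K)"
proof -
  let ?L = "P * mat_exp K"
  have e: "mat_exp K \<in> psd_mats n" using mat_exp_pd[OF K_herm] by simp
  have L: "?L * P = ?L" using eq_congruence by simp
  have "?L * P = P * mat_exp K" using L .
  then have "mat_powr ?L r * P = P * mat_powr (mat_exp K) r"
    by (rule mat_powr_intertwine[OF psd e carriers(1)])
  moreover have "mat_powr (mat_exp K) r = mat_exp (complex_of_real r \<cdot>\<^sub>m K)"
    unfolding mat_powr_psd_eq[OF e] unfolding mat_exp_def smult_eq_mat_fun[OF K_herm] mat_fun_comp[OF K_herm]
    by (rule mat_fun_cong[OF K_herm]) (simp add: powr_def)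
  moreover have "mat_powr ?L r = mat_powr ?L (r - 1) * ?L"
    using mat_powr_mult[OF psd, of "r - 1" 1] psd by simp
  then have "mat_powr ?L r * P = mat_powr ?L r"
    using mat_assoc[of "mat_powr ?L (r - 1)" ?L P] L mat_powr_dim[OF psd, of "r - 1"] carriers by simp
  ultimately show ?thesis by simp
qed

text \<open>A positive eigenvalue excludes the kernel of \<open>P\<close>, where P exp(K) vanishes
  although \<open>K\<close> has the eigenvalue 0. On the range of \<open>P\<close> the logarithm
  recovers \<open>K\<close>.\<close>

lemma eigenvector_in_range:
  assumes v: "v \<in> carrier_vec n" and ev: "(P * mat_exp K) *\<^sub>v v = complex_of_real l \<cdot>\<^sub>v v" and l: "0 < l"
  shows "P *\<^sub>v v = v" "K *\<^sub>v v = complex_of_real (ln l) \<cdot>\<^sub>v v"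
proof -
  have "complex_of_real l \<cdot>\<^sub>v (P *\<^sub>v v) = P *\<^sub>v ((P * mat_exp K) *\<^sub>v v)"
    unfolding ev using v carriers by (simp add: mult_mat_vec[of _ n n])
  also have "\<dots> = (P * P * mat_exp K) *\<^sub>v v"
    using v carriers by (simp add: assoc_mult_mat_vec[of _ n n _ n])
  also have "\<dots> = complex_of_real l \<cdot>\<^sub>v v" unfolding P_idem ev ..
  finally have "inverse (complex_of_real l) \<cdot>\<^sub>v (complex_of_real l \<cdot>\<^sub>v (P *\<^sub>v v))
      = inverse (complex_of_real l) \<cdot>\<^sub>v (complex_of_real l \<cdot>\<^sub>v v)" by simp
  then show Pv: "P *\<^sub>v v = v" using l by (simp add: smult_smult_assoc)
  have "mat_exp K *\<^sub>v v = mat_exp K *\<^sub>v (P *\<^sub>v v)" unfolding Pv ..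
  also have "\<dots> = complex_of_real l \<cdot>\<^sub>v v"
    using ev v carriers exp_commute assoc_mult_mat_vec[of "mat_exp K" n n P n v] by simp
  finally have "mat_fun ln (mat_exp K) *\<^sub>v v = complex_of_real (ln l) \<cdot>\<^sub>v v"
    by (rule mat_fun_eigenvector[OF pd_herm[OF mat_exp_pd[OF K_herm]] v])
  moreover have "mat_fun ln (mat_exp K) = K"
    unfolding mat_exp_def mat_fun_comp[OF K_herm] using K_herm by simp
  ultimately show "K *\<^sub>v v = complex_of_real (ln l) \<cdot>\<^sub>v v" by simp
qed

text \<open>The bound on \<open>K\<close> supplied by \<open>dom\<close> is summed over eigenvectors
  for the k largest eigenvalues, as in Ky Fan's principle. \<open>M\<close> is a function of
  \<open>R\<close>, so the outcome involves only the eigenvalues of \<open>R\<close> and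
  \<open>c\<close>. If one of the first k eigenvalues on the left is 0, the claim is
  immediate.\<close>

lemma prod_eigvals_le:
  assumes R: "R \<in> psd_mats n" and k: "k \<le> n"
    and dom: "\<And>c M. M \<in> pd_mats n \<Longrightarrow> qle n (1\<^sub>m n) M \<Longrightarrow> qle n R (complex_of_real (exp c) \<cdot>\<^sub>m M) \<Longrightarrow>
      \<exists>F \<in> psd_mats n. real_trace F = ln (real_det M) \<and>
        (\<forall>v \<in> carrier_vec n. P *\<^sub>v v = v \<longrightarrow> qform K v \<le> c * Re (v \<bullet>c v) + qform F v)"
  shows "(\<Prod>i<k. eigvals_desc (P * mat_exp K) ! i) \<le> (\<Prod>i<k. eigvals_desc R ! i)"
proof (cases "\<exists>i<k. eigvals_desc (P * mat_exp K) ! i = 0")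
  case True
  then have "(\<Prod>i<k. eigvals_desc (P * mat_exp K) ! i) = 0" by auto
  moreover have "0 \<le> (\<Prod>i<k. eigvals_desc R ! i)"
    using eigvals_desc_nonneg[OF R] k by (intro prod_nonneg) auto
  ultimately show ?thesis by linarith
next
  case False
  obtain V l where V: "V \<in> unitary_mats n" and Le: "P * mat_exp K = V * rdiag n l * mat_adjoint V"
    and evL: "eigvals_desc (P * mat_exp K) = map l [0..<n]"
    using herm_sorted_cases[OF psd_herm[OF psd]] by metis
  have l: "0 < l i" if "i < k" for i
    using False eigvals_desc_nonneg[OF psd, of i] that k evL by (force simp: less_le)
  obtain U r where U: "U \<in> unitary_mats n" and sp: "real_spectrum R = r ` {..<n}"
    and mf: "\<And>f. mat_fun f R = U * rdiag n (\<lambda>i. f (r i)) * mat_adjoint U"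
    and dec: "\<And>i j. i \<le> j \<Longrightarrow> j < n \<Longrightarrow> r j \<le> r i" and evR: "eigvals_desc R = map r [0..<n]"
    using herm_sorted_cases[OF psd_herm[OF R]] by metis
  have r0: "0 \<le> r i" if "i < n" for i using psd_spectrum[OF R] sp that by auto
  define S where "S = (\<Sum>i<k. ln (l i))"
  have Rh: "R \<in> herm_mats n" using R by simp
  \<comment> \<open>One inequality for every real \<open>c\<close>; a suitable \<open>c\<close> is
    picked afterwards.\<close>
  have main: "S \<le> real k * c + (\<Sum>i<n. ln (max (r i * exp (- c)) 1))" for c
  proof -
    define M where "M = mat_fun (\<lambda>x. max (x * exp (- c)) 1) R"
    have M: "M \<in> pd_mats n" unfolding M_def by (rule mat_fun_pd[OF Rh]) (simp add: less_max_iff_disj)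
    have "qle n (mat_fun (\<lambda>x. 1) R) M" unfolding M_def by (rule mat_fun_mono[OF Rh]) simp
    then have M1: "qle n (1\<^sub>m n) M" using Rh by simp
    have "qle n (mat_fun (\<lambda>x. x) R) (mat_fun (\<lambda>x. exp c * max (x * exp (- c)) 1) R)"
    proof (rule mat_fun_mono[OF Rh])
      fix x
      have "exp c * (x * exp (- c)) \<le> exp c * max (x * exp (- c)) 1" by (intro mult_left_mono) auto
      then show "x \<le> exp c * max (x * exp (- c)) 1" by (simp add: exp_minus field_simps)
    qed
    then have M2: "qle n R (complex_of_real (exp c) \<cdot>\<^sub>m M)"
      unfolding M_def mat_fun_smult[OF Rh] using Rh by simp
    obtain F where F: "F \<in> psd_mats n" "real_trace F = ln (real_det M)"
      and Fb: "\<And>v. v \<in> carrier_vec n \<Longrightarrow> P *\<^sub>v v = v \<Longrightarrow> qform K v \<le> c * Re (v \<bullet>c v) + qform F v"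
      using dom[OF M M1 M2] by blast
    have le: "ln (l i) \<le> c + qform F (col V i)" if i: "i < k" for i
    proof -
      have i': "i < n" using i k by simp
      have v: "col V i \<in> carrier_vec n" using V i' by (auto intro!: carrier_vecI)
      have ev: "(P * mat_exp K) *\<^sub>v col V i = complex_of_real (l i) \<cdot>\<^sub>v col V i"
        unfolding Le by (rule spectral_col[OF V i'])
      have one: "Re (col V i \<bullet>c col V i) = 1"
        unfolding sum_coord[OF V v, symmetric] using V i' by (simp add: coord_col)
      show ?thesis
        using eigenvector_in_range[OF v ev l[OF i]] Fb[OF v] eigen_qform[of K "col V i" "ln (l i)" n] v one by simp
    qed
    have "S \<le> (\<Sum>i<k. c + qform F (col V i))" unfolding S_def using le by (intro sum_mono) auto
    also have "\<dots> = real k * c + (\<Sum>i<k. qform F (col V i))" by (simp add: sum.distrib)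
    \<comment> \<open>The partial sum is completed to the trace, which only increases it because F
      \<ge> 0.\<close>
    also have "(\<Sum>i<k. qform F (col V i)) \<le> (\<Sum>i<n. qform F (col V i))"
    proof (rule sum_mono2)
      fix i assume "i \<in> {..<n} - {..<k}"
      then have "col V i \<in> carrier_vec n" using V by (auto intro!: carrier_vecI)
      then show "0 \<le> qform F (col V i)" using F(1) unfolding psd_iff by blast
    qed (use k in auto)
    also have "\<dots> = ln (real_det M)" using sum_qform_cols[OF psd_carrier[OF F(1)] V] F(2) by simp
    also have "\<dots> = ln (\<Prod>i<n. max (r i * exp (- c)) 1)"
      unfolding M_def mf real_det_def by (simp add: det_spectral[OF U] del: of_real_prod)
    also have "\<dots> = (\<Sum>i<n. ln (max (r i * exp (- c)) 1))"
      by (intro ln_prod) (auto simp: max_def)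
    finally show ?thesis by simp
  qed
  have split: "(\<Sum>i<n. f i) = (\<Sum>i<k. f i) + (\<Sum>i=k..<n. f i)" for f :: "nat \<Rightarrow> real"
    using k by (metis sum.atLeastLessThan_concat atLeast0LessThan zero_le)
  have expS: "(\<Prod>i<k. eigvals_desc (P * mat_exp K) ! i) = exp S"
    unfolding S_def using l k by (simp add: exp_sum evL)
  show ?thesis
  proof (cases "k = 0")
    case True then show ?thesis by simp
  next
    case False
    then have k1: "k - 1 < n" "k - 1 < k" using k by auto
    show ?thesis
    proof (cases "r (k - 1) = 0")
      case False
      \<comment> \<open>The index k - 1 belongs to the k-th eigenvalue. With this \<open>c\<close>
        the later eigenvalues are cut off and contribute ln 1 = 0, and the terms -c of the first k
        cancel k c.\<close>
      define c where "c = ln (r (k - 1))"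
      have rk: "0 < r (k - 1)" using False r0[OF k1(1)] by simp
      have ri: "r (k - 1) \<le> r i" "0 < r i" if "i < k" for i
      proof -
        show *: "r (k - 1) \<le> r i" using dec[of i "k - 1"] k1 that by simp
        show "0 < r i" using rk * by simp
      qed
      have ec: "exp (- c) = 1 / r (k - 1)" using rk by (simp add: c_def exp_minus inverse_eq_divide)
      have "(\<Sum>i<k. ln (max (r i * exp (- c)) 1)) = (\<Sum>i<k. ln (r i) - c)"
      proof (rule sum.cong[OF refl])
        fix i assume "i \<in> {..<k}"
        then have "r (k - 1) \<le> r i" "0 < r i" using ri by auto
        then have "max (r i * exp (- c)) 1 = r i / r (k - 1)" using rk by (simp add: ec max_def field_simps)
        then show "ln (max (r i * exp (- c)) 1) = ln (r i) - c"
          using rk \<open>0 < r i\<close> by (simp add: ln_div c_def)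
      qed
      moreover have "(\<Sum>i=k..<n. ln (max (r i * exp (- c)) 1)) = 0"
      proof (rule sum.neutral, rule ballI)
        fix i assume "i \<in> {k..<n}"
        then have "r i \<le> r (k - 1)" using k1 by (intro dec) auto
        then have "max (r i * exp (- c)) 1 = 1" using rk by (simp add: ec max_def)
        then show "ln (max (r i * exp (- c)) 1) = 0" by simp
      qed
      ultimately have "S \<le> (\<Sum>i<k. ln (r i))"
        using main[of c] split[of "\<lambda>i. ln (max (r i * exp (- c)) 1)"] by (simp add: sum_subtractf)
      then have "exp S \<le> exp (\<Sum>i<k. ln (r i))" by simp
      also have "\<dots> = (\<Prod>i<k. eigvals_desc R ! i)" using ri k by (simp add: exp_sum evR)
      finally show ?thesis unfolding expS .
    next
      case True
      \<comment> \<open>Now at most k - 1 eigenvalues of \<open>R\<close> are nonzero. For c \<le> 0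
        the sum grows at most like -(k - 1) c, which leaves S \<le> c + C; a very negative c makes
        this absurd.\<close>
      have rz: "r i = 0" if "k - 1 \<le> i" "i < n" for i
        using dec[OF that] r0[OF that(2)] True by simp
      define C where "C = (\<Sum>i<k - 1. ln (max (r i) 1))"
      have bd: "S \<le> c + C" if c: "c \<le> 0" for c
      proof -
        have "(\<Sum>i<n. ln (max (r i * exp (- c)) 1)) = (\<Sum>i<k - 1. ln (max (r i * exp (- c)) 1))"
          using rz k by (intro sum.mono_neutral_right) (auto simp: not_less)
        also have "\<dots> \<le> (\<Sum>i<k - 1. ln (max (r i) 1) - c)"
        proof (rule sum_mono)
          fix i assume "i \<in> {..<k - 1}"
          have "1 \<le> exp (- c)" using c by simp
          then have "1 * 1 \<le> max (r i) 1 * exp (- c)" by (intro mult_mono) auto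
          moreover have "r i * exp (- c) \<le> max (r i) 1 * exp (- c)" by (intro mult_right_mono) auto
          ultimately have "max (r i * exp (- c)) 1 \<le> max (r i) 1 * exp (- c)" by simp
          then have "ln (max (r i * exp (- c)) 1) \<le> ln (max (r i) 1 * exp (- c))"
            by (subst ln_le_cancel_iff) (auto simp: less_max_iff_disj)
          also have "\<dots> = ln (max (r i) 1) - c" by (subst ln_mult) (auto simp: max_def)
          finally show "ln (max (r i * exp (- c)) 1) \<le> ln (max (r i) 1) - c" .
        qed
        also have "\<dots> = C - (real k - 1) * c" using False by (simp add: sum_subtractf C_def of_nat_diff)
        finally show ?thesis using main[of c] by (simp add: algebra_simps)
      qed
      have "S \<le> min 0 (S - C - 1) + C" by (rule bd) simp
      then show ?thesis by simp
    qed
  qed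
qed

end

section \<open>The weighted mean as a projected exponential\<close>

lemma weighted_LE_projected_exp:
  assumes "A \<in> psd_mats n" "B \<in> psd_mats n"
  shows "projected_exp n (mat_powr B 0)
     (complex_of_real a \<cdot>\<^sub>m (mat_powr B 0 * mat_log A * mat_powr B 0) +
              complex_of_real b \<cdot>\<^sub>m (mat_powr B 0 * mat_log B * mat_powr B 0))"
proof
  let ?P = "mat_powr B 0"
  show P: "?P \<in> herm_mats n" and PP: "?P * ?P = ?P" using assms by (simp_all add: mat_powr_mult)
  have L: "mat_log A \<in> herm_mats n" "mat_log B \<in> herm_mats n" using assms by auto
  let ?K = "complex_of_real a \<cdot>\<^sub>m (?P * mat_log A * ?P) + complex_of_real b \<cdot>\<^sub>m (?P * mat_log B * ?P)"
  show "?K \<in> herm_mats n"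
    using herm_congruence'[OF L(1) P] herm_congruence'[OF L(2) P] by (intro herm_add herm_smult)
  have *: "?P * (?P * Z * ?P) = ?P * Z * ?P" if "Z \<in> herm_mats n" for Z
    using that P mat_assoc[of ?P ?P "Z * ?P"] by (simp add: mat_assoc PP)
  show "?P * ?K = ?K"
    using *[OF L(1)] *[OF L(2)] P L by (simp add: mat_mult_add mat_mult_smult)
qed

lemma weighted_LE_psd: "A \<in> psd_mats n \<Longrightarrow> B \<in> psd_mats n \<Longrightarrow> weighted_LE a b A B \<in> psd_mats n"
  unfolding weighted_LE_def by (rule projected_exp.psd[OF weighted_LE_projected_exp])

lemma weighted_LE_powr:
  assumes A: "A \<in> psd_mats n" and B: "B \<in> psd_mats n"
  shows "mat_powr (weighted_LE a b A B) r = weighted_LE (r * a) (r * b) A B"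
proof -
  have L: "mat_log A \<in> herm_mats n" "mat_log B \<in> herm_mats n" "mat_powr B 0 \<in> herm_mats n" using A B by auto
  show ?thesis
    unfolding weighted_LE_def projected_exp.powr[OF weighted_LE_projected_exp[OF A B]]
    using L by (simp add: smult_add_mat smult_smult_mat)
qed

lemma weighted_LE_mat_powr:
  assumes A: "A \<in> psd_mats n" and B: "B \<in> psd_mats n" and "p \<noteq> 0" "q \<noteq> 0"
  shows "weighted_LE a b (mat_powr A p) (mat_powr B q) = weighted_LE (a * p) (b * q) A B"
proof -
  have L: "mat_log A \<in> herm_mats n" "mat_log B \<in> herm_mats n" "mat_powr B 0 \<in> herm_mats n" using A B by auto
  show ?thesis
    unfolding weighted_LE_def mat_log_mat_powr[OF A assms(3)] mat_log_mat_powr[OF B assms(4)] mat_powr_powr[OF B]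
    using L by (simp add: mat_mult_smult mat_smult_mult smult_smult_mat)
qed

section \<open>Log-majorization by operator monotonicity and Furuta's inequality\<close>

lemma mat_log_mat_powr_pd:
  assumes "A \<in> pd_mats n"
  shows "mat_log (mat_powr A r) = complex_of_real r \<cdot>\<^sub>m mat_log A"
  unfolding mat_log_def mat_powr_psd_eq[OF pd_imp_psd[OF assms]] mat_fun_comp[OF pd_herm[OF assms]]
    mat_fun_smult[OF pd_herm[OF assms]]
  by (rule mat_fun_cong[OF pd_herm[OF assms]]) (auto dest: pd_spectrum[OF assms])

lemma mat_log_monotone_pd:
  assumes "B \<in> pd_mats n" "B' \<in> pd_mats n" "qle n B B'" "v \<in> carrier_vec n"
  shows "qform (mat_log B) v \<le> qform (mat_log B') v"
  using mat_log_monotone[OF pd_imp_psd[OF assms(1)] assms(2-4)] assms by simp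

lemma real_det_mat_exp:
  assumes "K \<in> herm_mats n"
  shows "real_det (mat_exp K) = exp (real_trace K)"
proof -
  have "mat_log (mat_exp K) = mat_fun (\<lambda>x. x) K"
    unfolding mat_log_def mat_exp_def mat_fun_comp[OF assms] by (rule mat_fun_cong[OF assms]) simp
  then have "real_trace K = ln (real_det (mat_exp K))"
    using real_trace_mat_log[OF mat_exp_pd[OF assms]] assms by simp
  then show ?thesis using real_det_pos[OF mat_exp_pd[OF assms]] by simp
qed

lemma psd_real_det_pos_imp_pd:
  assumes "A \<in> psd_mats n" "real_det A \<noteq> 0"
  shows "A \<in> pd_mats n"
proof -
  obtain U d where U: "U \<in> unitary_mats n" and A: "A = U * rdiag n d * mat_adjoint U" and sp: "real_spectrum A = d ` {..<n}"
    using herm_cases[OF psd_herm[OF assms(1)]] by metis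
  have "real_det A = (\<Prod>i<n. d i)" using det_spectral[OF U, of d] A by (simp add: real_det_def del: of_real_prod)
  then have "0 < x" if "x \<in> real_spectrum A" for x
    using assms(2) psd_spectrum[OF assms(1) that] that sp by (auto simp: less_le)
  then show ?thesis unfolding pd_spectrum_iff using assms(1) by auto
qed

lemma pd_sandwich_cancel:
  assumes X: "X \<in> pd_mats n" and Z: "Z \<in> carrier_mat n n"
  shows "mat_powr X r * (mat_powr X (- r) * Z * mat_powr X (- r)) * mat_powr X r = Z"
    "mat_powr X (- r) * (mat_powr X r * Z * mat_powr X r) * mat_powr X (- r) = Z"
  using mat_powr_mult_assoc[OF pd_imp_psd[OF X]] mat_powr_mult[OF pd_imp_psd[OF X]] mat_powr_0[OF X] X Z
  by (simp_all add: mat_assoc right_mult_one_mat[of _ n n] left_mult_one_mat[of _ n n])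

lemma pd_sandwich_powr:
  assumes X: "X \<in> pd_mats n"
  shows "mat_powr X r * mat_powr X s * mat_powr X r = mat_powr X (2 * r + s)"
  using mat_powr_mult[OF pd_imp_psd[OF X]] by (simp add: algebra_simps)

lemma qform_mat_log_smult:
  assumes "B \<in> pd_mats n" "0 < c" "v \<in> carrier_vec n"
  shows "qform (mat_log (complex_of_real c \<cdot>\<^sub>m B)) v = ln c * Re (v \<bullet>c v) + qform (mat_log B) v"
proof -
  have "mat_log B \<in> carrier_mat n n" using mat_log_herm[OF pd_herm[OF assms(1)]] by simp
  then show ?thesis unfolding pd_smult(2)[OF assms(1,2)] using assms(3)
    by (simp add: qform_add[of _ n] qform_smult[of _ n] qform_one)
qed

text \<open>The geometric mean is the case \<open>u = 1/2\<close>, \<open>w = - 1/2\<close>; the eigenvalues of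
  \<open>SGt_mean\<close> come from \<open>u = - 1/2\<close>, \<open>w = \<alpha> - 1/2\<close>. Since \<open>b \<ge> 1\<close>, the matrix \<open>Y\<close> is an operator
  monotone function of \<open>R\<close>.\<close>

theorem weighted_LE_log_maj:
  assumes X: "X \<in> pd_mats n" and Y: "Y \<in> psd_mats n" and b: "1 \<le> b" and a: "a = - (2 * u * b + 2 * w)"
  defines "R \<equiv> mat_powr X (- w) * mat_powr (mat_powr X (- u) * Y * mat_powr X (- u)) b * mat_powr X (- w)"
  shows "log_maj n (weighted_LE a b X Y) R"
proof -
  let ?P = "mat_powr Y 0"
  let ?K = "complex_of_real a \<cdot>\<^sub>m (?P * mat_log X * ?P) + complex_of_real b \<cdot>\<^sub>m (?P * mat_log Y * ?P)"
  note Xp = pd_imp_psd[OF X]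
  interpret projected_exp n ?P ?K by (rule weighted_LE_projected_exp[OF Xp Y])
  define W where "W = mat_powr X (- u) * Y * mat_powr X (- u)"
  have W: "W \<in> psd_mats n" unfolding W_def using Y Xp by (intro psd_congruence') auto
  have Wb: "mat_powr W b \<in> psd_mats n" using W by simp
  have Req: "R = mat_powr X (- w) * mat_powr W b * mat_powr X (- w)" unfolding R_def W_def ..
  have R: "R \<in> psd_mats n" unfolding Req using W Xp by (intro psd_congruence') auto
  have LX: "mat_log X \<in> herm_mats n" and LY: "mat_log Y \<in> herm_mats n" using X Y by auto
  have weak: "(\<Prod>i<k. eigvals_desc (weighted_LE a b X Y) ! i) \<le> (\<Prod>i<k. eigvals_desc R ! i)" if k: "k \<le> n" for k
    unfolding weighted_LE_def
  proof (rule prod_eigvals_le[OF R k])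
    fix c M assume M: "M \<in> pd_mats n" and M1: "qle n (1\<^sub>m n) M" and RM: "qle n R (complex_of_real (exp c) \<cdot>\<^sub>m M)"
    \<comment> \<open>\<open>V\<close> and \<open>B\<close> are what W^b and \<open>Y\<close> become
      when \<open>R\<close> is replaced by \<open>M\<close> in the relation between \<open>R\<close>
      and \<open>Y\<close>.\<close>
    define V where "V = mat_powr X w * M * mat_powr X w"
    have V: "V \<in> pd_mats n" unfolding V_def using M X by (intro pd_congruence') auto
    have Vb: "mat_powr V (1 / b) \<in> pd_mats n" using V by simp
    define B where "B = mat_powr X u * mat_powr V (1 / b) * mat_powr X u"
    have B: "B \<in> pd_mats n" unfolding B_def using V X by (intro pd_congruence') auto
    have "qle n (mat_powr X w * R * mat_powr X w) (mat_powr X w * (complex_of_real (exp c) \<cdot>\<^sub>m M) * mat_powr X w)"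
      using M R Xp by (intro qle_congruence_herm[OF RM]) auto
    moreover have "mat_powr X w * R * mat_powr X w = mat_powr W b"
      unfolding Req using pd_sandwich_cancel(1)[OF X psd_carrier[OF Wb], of w] .
    moreover have "mat_powr X w * (complex_of_real (exp c) \<cdot>\<^sub>m M) * mat_powr X w = complex_of_real (exp c) \<cdot>\<^sub>m V"
      unfolding V_def using M Xp by (simp add: mat_mult_smult mat_smult_mult)
    ultimately have "qle n (mat_powr W b) (complex_of_real (exp c) \<cdot>\<^sub>m V)" by simp
    \<comment> \<open>The only place where \<open>Y\<close> is bounded through a power: 1/b \<le> 1
      keeps it operator monotone.\<close>
    then have "qle n (mat_powr (mat_powr W b) (1 / b)) (mat_powr (complex_of_real (exp c) \<cdot>\<^sub>m V) (1 / b))"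
      using b V by (intro loewner_heinz[OF Wb] pd_imp_psd[OF pd_smult(1)]) auto
    then have "qle n W (complex_of_real (exp c powr (1 / b)) \<cdot>\<^sub>m mat_powr V (1 / b))"
      unfolding mat_powr_powr[OF W] using b W mat_powr_smult(1)[OF pd_imp_psd[OF V], of "exp c" "1/b"] by simp
    then have "qle n (mat_powr X u * W * mat_powr X u) (mat_powr X u * (complex_of_real (exp c powr (1 / b)) \<cdot>\<^sub>m mat_powr V (1 / b)) * mat_powr X u)"
      using W V Xp pd_imp_psd[OF V] by (intro qle_congruence_herm) auto
    moreover have "mat_powr X u * W * mat_powr X u = Y"
      unfolding W_def using pd_sandwich_cancel(1)[OF X psd_carrier[OF Y], of u] .
    moreover have "mat_powr X u * (complex_of_real (exp c powr (1 / b)) \<cdot>\<^sub>m mat_powr V (1 / b)) * mat_powr X u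
        = complex_of_real (exp c powr (1 / b)) \<cdot>\<^sub>m B"
      unfolding B_def using V X by (simp add: mat_mult_smult mat_smult_mult)
    ultimately have YB: "qle n Y (complex_of_real (exp c powr (1 / b)) \<cdot>\<^sub>m B)" by simp
    \<comment> \<open>The exponent of the weighted mean with \<open>Y\<close> replaced by
      \<open>B\<close> and without the projection.\<close>
    define F where "F = complex_of_real b \<cdot>\<^sub>m mat_log B + complex_of_real a \<cdot>\<^sub>m mat_log X"
    have LB: "mat_log B \<in> herm_mats n" using B by auto
    have qF: "qform F v = b * qform (mat_log B) v + a * qform (mat_log X) v" if "v \<in> carrier_vec n" for v
      unfolding F_def using LB LX that by (simp add: qform_add[of _ n] qform_smult[of _ n])
    \<comment> \<open>For M = 1 the matrix \<open>B\<close> would be X^(-a/b), and \<open>F\<close>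
      would be 0. Monotonicity in M \<ge> 1 therefore gives B \<ge> X^(-a/b), hence F \<ge> 0 after
      taking logarithms.\<close>
    have "qle n (mat_powr X (2 * w)) V"
    proof -
      have "qle n (mat_powr X w * 1\<^sub>m n * mat_powr X w) V"
        unfolding V_def using M X by (intro qle_congruence_herm[OF M1]) auto
      also have "mat_powr X w * 1\<^sub>m n * mat_powr X w = mat_powr X (2 * w)"
        using pd_sandwich_powr[OF X, of w 0] mat_powr_0[OF X] by simp
      finally show ?thesis .
    qed
    then have "qle n (mat_powr (mat_powr X (2 * w)) (1 / b)) (mat_powr V (1 / b))"
      using b V Xp by (intro loewner_heinz) auto
    then have "qle n (mat_powr X u * mat_powr X (2 * w / b) * mat_powr X u) B"
      unfolding B_def mat_powr_powr[OF Xp] using V X by (intro qle_congruence_herm) auto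
    then have XB: "qle n (mat_powr X (- a / b)) B"
    proof -
      have "2 * u + 2 * w / b = - a / b" unfolding a using b by (simp add: diff_divide_distrib add_divide_distrib)
      then show ?thesis using \<open>qle n (mat_powr X u * mat_powr X (2 * w / b) * mat_powr X u) B\<close>
        unfolding pd_sandwich_powr[OF X] by simp
    qed
    have Fpsd: "F \<in> psd_mats n" unfolding psd_iff
    proof (intro conjI ballI)
      show "F \<in> herm_mats n" unfolding F_def using LB LX by (intro herm_add herm_smult)
      fix v :: "complex vec" assume v: "v \<in> carrier_vec n"
      have "qform (mat_log (mat_powr X (- a / b))) v \<le> qform (mat_log B) v"
        using X by (intro mat_log_monotone_pd[OF _ B XB v]) auto
      then have "- a / b * qform (mat_log X) v \<le> qform (mat_log B) v"
        unfolding mat_log_mat_powr_pd[OF X] using LX v qform_smult[of "mat_log X" n v "- a / b"] by simp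
      then have "b * (- a / b * qform (mat_log X) v) \<le> b * qform (mat_log B) v"
        using b by (intro mult_left_mono) auto
      then show "0 \<le> qform F v" unfolding qF[OF v] using b by simp
    qed
    have dpos: "0 < real_det X" "0 < real_det M" "0 < real_det V" using X M V by (simp_all add: real_det_pos)
    \<comment> \<open>The value of \<open>a\<close> is such that the multiples of ln det X cancel in
      the trace of \<open>F\<close>.\<close>
    have dV: "ln (real_det V) = 2 * w * ln (real_det X) + ln (real_det M)"
      unfolding V_def using dpos real_det_mult3[of "mat_powr X w" n M "mat_powr X w"] M Xp
      by (simp add: real_det_mat_powr[OF Xp] ln_mult)
    have dB: "ln (real_det B) = 2 * u * ln (real_det X) + ln (real_det V) / b"
      unfolding B_def using dpos real_det_mult3[of "mat_powr X u" n "mat_powr V (1 / b)" "mat_powr X u"] V X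
      by (simp add: real_det_mat_powr[OF Xp] real_det_mat_powr[OF pd_imp_psd[OF V]] ln_mult)
    have "real_trace F = b * ln (real_det B) + a * ln (real_det X)"
      unfolding F_def using LB LX
      by (simp add: real_trace_add[of _ n] real_trace_smult[of _ n] real_trace_mat_log[OF B] real_trace_mat_log[OF X])
    also have "\<dots> = ln (real_det M)" unfolding dB dV a using b by (simp add: field_simps)
    finally have tr: "real_trace F = ln (real_det M)" .
    \<comment> \<open>The logarithm of Y \<le> e^(c/b) B on the range of \<open>?P\<close>,
      multiplied by b.\<close>
    have bound: "qform ?K v \<le> c * Re (v \<bullet>c v) + qform F v" if v: "v \<in> carrier_vec n" and Pv: "?P *\<^sub>v v = v" for v
    proof -
      have q: "qform (?P * Z * ?P) v = qform Z v" if "Z \<in> herm_mats n" for Z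
        using qform_congruence[OF herm_carrier[OF that] mat_powr_carrier[OF Y] v, of 0] Pv
        by (simp add: herm_adjoint[OF mat_powr_herm[OF Y]])
      have "qform (mat_log Y) v \<le> qform (mat_log (complex_of_real (exp c powr (1 / b)) \<cdot>\<^sub>m B)) v"
        by (intro mat_log_monotone[OF Y pd_smult(1)[OF B] YB v Pv]) simp
      also have "\<dots> = c / b * Re (v \<bullet>c v) + qform (mat_log B) v"
        by (subst qform_mat_log_smult[OF B _ v]) simp_all
      finally have "b * qform (mat_log Y) v \<le> b * (c / b * Re (v \<bullet>c v) + qform (mat_log B) v)"
        using b by (intro mult_left_mono) auto
      moreover have "qform ?K v = a * qform (mat_log X) v + b * qform (mat_log Y) v"
        using qform_add[of "complex_of_real a \<cdot>\<^sub>m (?P * mat_log X * ?P)" n "complex_of_real b \<cdot>\<^sub>m (?P * mat_log Y * ?P)" v]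
          qform_smult[of "?P * mat_log X * ?P" n v a] qform_smult[of "?P * mat_log Y * ?P" n v b] LX LY Y v q
        by simp
      ultimately show ?thesis unfolding qF[OF v] using b by (simp add: distrib_left)
    qed
    show "\<exists>F \<in> psd_mats n. real_trace F = ln (real_det M) \<and>
        (\<forall>v \<in> carrier_vec n. ?P *\<^sub>v v = v \<longrightarrow> qform ?K v \<le> c * Re (v \<bullet>c v) + qform F v)"
      using Fpsd tr bound by blast
  qed
  have LE: "weighted_LE a b X Y \<in> psd_mats n" by (rule weighted_LE_psd[OF Xp Y])
  have dR: "real_det R = real_det X powr (- w) * (real_det X powr (- u) * real_det Y * real_det X powr (- u)) powr b * real_det X powr (- w)"
  proof -
    have "real_det W = real_det X powr (- u) * real_det Y * real_det X powr (- u)"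
      unfolding W_def using real_det_mult3[of "mat_powr X (- u)" n Y "mat_powr X (- u)"] Xp Y
      by (simp add: real_det_mat_powr[OF Xp])
    moreover have "real_det R = real_det X powr (- w) * real_det W powr b * real_det X powr (- w)"
      unfolding Req real_det_mult3[OF mat_powr_herm[OF Xp] mat_powr_herm[OF W] mat_powr_herm[OF Xp]]
        real_det_mat_powr[OF W] real_det_mat_powr[OF Xp] ..
    ultimately show ?thesis by simp
  qed
  have "real_det (weighted_LE a b X Y) = real_det R"
  \<comment> \<open>If det Y = 0 the support projection has determinant \<open>0 powr 0 = 0\<close>,
    so both sides vanish. Otherwise the projection is 1 and the trace of the exponent gives the
    determinant.\<close>
  proof (cases "real_det Y = 0")
    case True
    have "real_det (weighted_LE a b X Y) = 0"
      unfolding weighted_LE_def real_det_def det_mult[OF carriers(1,3)]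
      using det_herm[OF P_herm] real_det_mat_powr[OF Y, of 0] True by simp
    then show ?thesis unfolding dR using True b by simp
  next
    case False
    then have Ypd: "Y \<in> pd_mats n" using psd_real_det_pos_imp_pd[OF Y] by simp
    have pos: "0 < real_det X" "0 < real_det Y" using X Ypd by (simp_all add: real_det_pos)
    have P1: "?P = 1\<^sub>m n" using mat_powr_0[OF Ypd] .
    have c: "mat_log X \<in> carrier_mat n n" "mat_log Y \<in> carrier_mat n n" using LX LY by auto
    have Keq: "?K = complex_of_real a \<cdot>\<^sub>m mat_log X + complex_of_real b \<cdot>\<^sub>m mat_log Y"
      unfolding P1 using c by (simp add: right_mult_one_mat[of _ n n] left_mult_one_mat[of _ n n])
    have "real_trace ?K = a * ln (real_det X) + b * ln (real_det Y)"
      unfolding Keq using c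
      by (simp add: real_trace_add[of _ n] real_trace_smult[of _ n] real_trace_mat_log[OF Ypd] real_trace_mat_log[OF X])
    moreover have "weighted_LE a b X Y = mat_exp ?K"
      unfolding weighted_LE_def using P1 carriers(3) by simp
    ultimately have "ln (real_det (weighted_LE a b X Y)) = a * ln (real_det X) + b * ln (real_det Y)"
      using real_det_mat_exp[OF K_herm] by simp
    also have "\<dots> = ln (real_det R)"
      unfolding dR a using pos by (simp add: ln_mult algebra_simps)
    finally show ?thesis
      using real_det_pos[OF mat_exp_pd[OF K_herm]] \<open>weighted_LE a b X Y = mat_exp ?K\<close> pos dR by simp
  qed
  then show ?thesis
    unfolding log_maj_def using weak real_det_psd[OF LE] real_det_psd[OF R] by simp
qed

text \<open>Let W be the sandwiched Q^s and K = P^(d/2) W^(1/2). The hypothesis raised to d/r \<le>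
  1 shows that the reversed product W^(1/2) P^d W^(1/2) is at least W^(1 + d/(r+s)). A power of this
  is inverted and carried back by \<open>mat_powr_gram\<close>, which yields the bound P^(d/2)
  W^(r/(r+s)) P^(d/2); the hypothesis bounds it by P^(r+d).\<close>

lemma furuta_step:
  assumes P: "P \<in> pd_mats n" and Q: "Q \<in> pd_mats n" and s: "0 < s" and r: "0 < r" and d: "0 \<le> d" "d \<le> r"
    and le: "qle n (mat_powr (mat_powr P (r / 2) * mat_powr Q s * mat_powr P (r / 2)) (r / (r + s))) (mat_powr P r)"
  shows "qle n (mat_powr (mat_powr P ((r + d) / 2) * mat_powr Q s * mat_powr P ((r + d) / 2)) ((r + d) / (r + d + s)))
    (mat_powr P (r + d))"
proof (cases "d = 0")
  case True then show ?thesis using le by simp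
next
  case False
  then have d0: "0 < d" using d by simp
  note Pp = pd_imp_psd[OF P]
  define W where "W = mat_powr P (r / 2) * mat_powr Q s * mat_powr P (r / 2)"
  have W: "W \<in> pd_mats n" unfolding W_def using P Q by (intro pd_congruence') auto
  note Wp = pd_imp_psd[OF W]
  define K where "K = mat_powr P (d / 2) * mat_powr W (1 / 2)"
  have K: "K \<in> carrier_mat n n" unfolding K_def using Pp Wp by simp
  have Ka: "mat_adjoint K = mat_powr W (1 / 2) * mat_powr P (d / 2)"
    unfolding K_def using Pp Wp by (simp add: mat_adjoint_times herm_adjoint[OF mat_powr_herm])
  have KK: "K * mat_adjoint K = mat_powr P ((r + d) / 2) * mat_powr Q s * mat_powr P ((r + d) / 2)"
  proof -
    have "K * mat_adjoint K = mat_powr P (d / 2) * W * mat_powr P (d / 2)"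
      unfolding Ka unfolding K_def using Pp Wp by (simp add: mat_assoc mat_powr_mult_assoc[OF Wp])
    also have "\<dots> = mat_powr P (d / 2 + r / 2) * mat_powr Q s * mat_powr P (r / 2 + d / 2)"
      unfolding W_def using Pp pd_imp_psd[OF Q] mat_powr_mult[OF Pp, of "r/2" "d/2"]
      by (simp add: mat_assoc mat_powr_mult_assoc[OF Pp])
    finally show ?thesis by (simp add: add_divide_distrib add.commute)
  qed
  have KK': "mat_adjoint K * K = mat_powr W (1 / 2) * mat_powr P d * mat_powr W (1 / 2)"
    unfolding Ka unfolding K_def using Pp Wp by (simp add: mat_assoc mat_powr_mult_assoc[OF Pp])
  have L: "mat_adjoint K * K \<in> pd_mats n" unfolding KK' using P W by (intro pd_congruence') auto
  \<comment> \<open>Here 1 - m is the wanted exponent, and (1 + d/(r+s)) m = s/(r+s) is the exponent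
    that combines with the two factors W^(1/2) to r/(r+s).\<close>
  define m where "m = s / (r + d + s)"
  have m: "0 \<le> m" "m \<le> 1" "(r + d) / (r + d + s) - 1 = - m" using s r d by (auto simp: m_def field_simps)
  have "qle n (mat_powr (mat_powr W (r / (r + s))) (d / r)) (mat_powr (mat_powr P r) (d / r))"
    using le d d0 r Pp Wp unfolding W_def[symmetric] by (intro loewner_heinz) auto
  then have "qle n (mat_powr W (d / (r + s))) (mat_powr P d)"
    unfolding mat_powr_powr[OF Wp] mat_powr_powr[OF Pp] using r by simp
  then have "qle n (mat_powr W (1 / 2) * mat_powr W (d / (r + s)) * mat_powr W (1 / 2)) (mat_adjoint K * K)"
    unfolding KK' using Pp Wp by (intro qle_congruence_herm) auto
  then have "qle n (mat_powr (mat_powr W (1 + d / (r + s))) m) (mat_powr (mat_adjoint K * K) m)"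
    unfolding pd_sandwich_powr[OF W] using m W by (intro loewner_heinz_pd[OF _ L]) auto
  moreover have "(1 + d / (r + s)) * m = s / (r + s)"
  proof -
    have "1 + d / (r + s) = (r + d + s) / (r + s)" using r s by (simp add: field_simps)
    then show ?thesis using r s d by (simp add: m_def)
  qed
  ultimately have "qle n (mat_powr W (s / (r + s))) (mat_powr (mat_adjoint K * K) m)"
    unfolding mat_powr_powr[OF Wp] by simp
  then have "qle n (mat_powr (mat_powr (mat_adjoint K * K) m) (- 1)) (mat_powr (mat_powr W (s / (r + s))) (- 1))"
    using W L by (intro qle_inverse) auto
  then have "qle n (mat_powr (mat_adjoint K * K) (- m)) (mat_powr W (- (s / (r + s))))"
    unfolding mat_powr_powr[OF Wp] mat_powr_powr[OF pd_imp_psd[OF L]] by simp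
  then have "qle n (K * mat_powr (mat_adjoint K * K) (- m) * mat_adjoint K) (K * mat_powr W (- (s / (r + s))) * mat_adjoint K)"
    using K W L by (intro qle_congruence) auto
  also have "K * mat_powr W (- (s / (r + s))) * mat_adjoint K = mat_powr P (d / 2) * mat_powr W (r / (r + s)) * mat_powr P (d / 2)"
  proof -
    have e: "1 / 2 + (- (s / (r + s)) + 1 / 2) = r / (r + s)" using r s by (simp add: field_simps)
    have "mat_powr W (1 / 2) * (mat_powr W (- (s / (r + s))) * (mat_powr W (1 / 2) * mat_powr P (d / 2)))
       = mat_powr W (r / (r + s)) * mat_powr P (d / 2)"
      using Pp mat_powr_mult_assoc[OF Wp, of "mat_powr W (1 / 2) * mat_powr P (d / 2)" "1/2" "- (s / (r + s))"]
        mat_powr_mult_assoc[OF Wp, of "mat_powr P (d / 2)" "1/2 + - (s / (r + s))" "1/2"] Wp e by (simp add: add.assoc)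
    then show ?thesis unfolding Ka unfolding K_def using Pp Wp by (simp add: mat_assoc)
  qed
  also have "qle n \<dots> (mat_powr P (d / 2) * mat_powr P r * mat_powr P (d / 2))"
    using le Pp Wp unfolding W_def[symmetric] by (intro qle_congruence_herm) auto
  also have "mat_powr P (d / 2) * mat_powr P r * mat_powr P (d / 2) = mat_powr P (r + d)"
    unfolding pd_sandwich_powr[OF P] by (simp add: add.commute)
  finally show ?thesis
    unfolding KK[symmetric] mat_powr_gram[OF K] m(3) .
qed

text \<open>The case r = 1. From Q \<le> P follows Q^(s+1) \<le> Q^(s/2) P Q^(s/2). Raised to
  (s-1)/(s+1), inverted and carried to the reversed product, this bounds its power 2/(s+1) by
  P^(1/2) Q P^(1/2) \<le> P^2; a square root finishes.\<close>

lemma furuta_base: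
  assumes P: "P \<in> pd_mats n" and Q: "Q \<in> pd_mats n" and le: "qle n Q P" and s: "1 \<le> s"
  shows "qle n (mat_powr (mat_powr P (1 / 2) * mat_powr Q s * mat_powr P (1 / 2)) (1 / (1 + s))) (mat_powr P 1)"
proof -
  note Pp = pd_imp_psd[OF P] and Qp = pd_imp_psd[OF Q]
  define K where "K = mat_powr P (1 / 2) * mat_powr Q (s / 2)"
  have K: "K \<in> carrier_mat n n" unfolding K_def using Pp Qp by simp
  have Ka: "mat_adjoint K = mat_powr Q (s / 2) * mat_powr P (1 / 2)"
    unfolding K_def using Pp Qp by (simp add: mat_adjoint_times herm_adjoint[OF mat_powr_herm])
  have KK: "K * mat_adjoint K = mat_powr P (1 / 2) * mat_powr Q s * mat_powr P (1 / 2)"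
    unfolding Ka unfolding K_def using Pp Qp by (simp add: mat_assoc mat_powr_mult_assoc[OF Qp])
  have KK': "mat_adjoint K * K = mat_powr Q (s / 2) * P * mat_powr Q (s / 2)"
    unfolding Ka unfolding K_def using Pp Qp by (simp add: mat_assoc mat_powr_mult_assoc[OF Pp])
  have L: "mat_adjoint K * K \<in> pd_mats n" unfolding KK' using P Q by (intro pd_congruence') auto
  define m where "m = (s - 1) / (s + 1)"
  have m: "0 \<le> m" "m \<le> 1" "2 / (s + 1) - 1 = - m" using s by (auto simp: m_def field_simps)
  have "qle n (mat_powr Q (s / 2) * mat_powr Q 1 * mat_powr Q (s / 2)) (mat_adjoint K * K)"
    unfolding KK' using Pp Qp le by (intro qle_congruence_herm) auto
  then have "qle n (mat_powr (mat_powr Q (s + 1)) m) (mat_powr (mat_adjoint K * K) m)"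
    unfolding pd_sandwich_powr[OF Q] using m Q by (intro loewner_heinz_pd[OF _ L]) auto
  then have "qle n (mat_powr Q (s - 1)) (mat_powr (mat_adjoint K * K) m)"
    unfolding mat_powr_powr[OF Qp] using s by (simp add: m_def)
  then have "qle n (mat_powr (mat_powr (mat_adjoint K * K) m) (- 1)) (mat_powr (mat_powr Q (s - 1)) (- 1))"
    using Q L by (intro qle_inverse) auto
  then have "qle n (mat_powr (mat_adjoint K * K) (- m)) (mat_powr Q (- (s - 1)))"
    unfolding mat_powr_powr[OF Qp] mat_powr_powr[OF pd_imp_psd[OF L]] by simp
  then have "qle n (K * mat_powr (mat_adjoint K * K) (- m) * mat_adjoint K) (K * mat_powr Q (- (s - 1)) * mat_adjoint K)"
    using K Q L by (intro qle_congruence) auto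
  also have "K * mat_powr Q (- (s - 1)) * mat_adjoint K = mat_powr P (1 / 2) * Q * mat_powr P (1 / 2)"
  proof -
    have "mat_powr Q (s / 2) * (mat_powr Q (- (s - 1)) * (mat_powr Q (s / 2) * mat_powr P (1 / 2))) = Q * mat_powr P (1 / 2)"
      using Pp Qp mat_powr_mult_assoc[OF Qp, of "mat_powr Q (s / 2) * mat_powr P (1 / 2)" "s / 2" "- (s - 1)"]
        mat_powr_mult_assoc[OF Qp, of "mat_powr P (1 / 2)" "s / 2 + - (s - 1)" "s / 2"] by simp
    then show ?thesis unfolding Ka unfolding K_def using Pp Qp by (simp add: mat_assoc)
  qed
  also have "qle n \<dots> (mat_powr P (1 / 2) * mat_powr P 1 * mat_powr P (1 / 2))"
    using le Pp Qp by (intro qle_congruence_herm) auto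
  also have "mat_powr P (1 / 2) * mat_powr P 1 * mat_powr P (1 / 2) = mat_powr P 2"
    unfolding pd_sandwich_powr[OF P] by simp
  finally have "qle n (mat_powr (K * mat_adjoint K) (2 / (s + 1))) (mat_powr P 2)"
    unfolding mat_powr_gram[OF K] m(3) .
  then have "qle n (mat_powr (mat_powr (K * mat_adjoint K) (2 / (s + 1))) (1 / 2)) (mat_powr (mat_powr P 2) (1 / 2))"
    using Pp psd_gram[OF K] by (intro loewner_heinz) auto
  moreover have "2 / (s + 1) * (1 / 2) = 1 / (1 + s)" by (simp add: field_simps)
  ultimately show ?thesis
    unfolding mat_powr_powr[OF Pp] mat_powr_powr[OF psd_gram[OF K]] unfolding KK by simp
qed

text \<open>Each step at most doubles \<open>r\<close>, so an induction covers r \<le> 2^m: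
  exponents up to 2 come from r = 1, larger ones by doubling r/2.\<close>

lemma furuta_pd:
  assumes P: "P \<in> pd_mats n" and Q: "Q \<in> pd_mats n" and le: "qle n Q P" and s: "1 \<le> s" and r: "1 \<le> r"
  shows "qle n (mat_powr (mat_powr P (r / 2) * mat_powr Q s * mat_powr P (r / 2)) (r / (r + s))) (mat_powr P r)"
proof -
  have *: "qle n (mat_powr (mat_powr P (r / 2) * mat_powr Q s * mat_powr P (r / 2)) (r / (r + s))) (mat_powr P r)"
    if "1 \<le> r" "r \<le> 2 ^ m" for r m
    using that
  proof (induction m arbitrary: r)
    case 0
    then have "r = 1" by simp
    then show ?case using furuta_base[OF P Q le s] by simp
  next
    case (Suc m)
    show ?case
    proof (cases "r \<le> 2")
      case True
      then show ?thesis
        using furuta_step[OF P Q _ _ _ _ furuta_base[OF P Q le s], of "r - 1"] Suc.prems s by simp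
    next
      case False
      then have "1 \<le> r / 2" "r / 2 \<le> 2 ^ m" using Suc.prems by auto
      from furuta_step[OF P Q _ _ _ _ Suc.IH[OF this], of "r / 2"] show ?thesis using s Suc.prems by simp
    qed
  qed
  obtain m where "r < 2 ^ m" using real_arch_pow[of 2 r] by auto
  then show ?thesis using *[of r m] r by simp
qed

text \<open>A singular \<open>Q\<close> is approximated by invertible matrices. To keep the order,
  \<open>P\<close> is enlarged to (1 + e k) P with 1 \<le> k P, and homogeneity turns the
  enlargement into scalar factors that tend to 1.\<close>

theorem furuta:
  assumes P: "P \<in> pd_mats n" and Q: "Q \<in> psd_mats n" and le: "qle n Q P" and s: "1 \<le> s" and r: "1 \<le> r"
  shows "qle n (mat_powr (mat_powr P (r / 2) * mat_powr Q s * mat_powr P (r / 2)) (r / (r + s))) (mat_powr P r)"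
proof (rule qleI)
  fix v :: "complex vec" assume v: "v \<in> carrier_vec n"
  note Pp = pd_imp_psd[OF P]
  have Qh: "Q \<in> herm_mats n" using Q by simp
  define t where "t = r / (r + s)"
  have t: "0 < t" "t \<le> 1" using r s by (auto simp: t_def)
  \<comment> \<open>The largest eigenvalue of P^-1; the absolute value ensures k \<ge> 0 also in
    dimension 0.\<close>
  define k where "k = \<bar>eigvals_desc (mat_powr P (- 1)) ! 0\<bar>"
  have kP: "qle n (1\<^sub>m n) (complex_of_real k \<cdot>\<^sub>m P)"
  proof -
    have "qle n (mat_powr P (- 1)) (complex_of_real k \<cdot>\<^sub>m 1\<^sub>m n)"
    proof (rule qle_one_spectrum)
      fix x assume "x \<in> real_spectrum (mat_powr P (- 1))"
      then show "x \<le> k" using qle_spectrum_le[OF _ qle_max_eigval, of "mat_powr P (- 1)" n x] Pp k_def by fastforce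
    qed (use Pp in simp)
    then have "qle n (mat_powr P (1 / 2) * mat_powr P (- 1) * mat_powr P (1 / 2)) (mat_powr P (1 / 2) * (complex_of_real k \<cdot>\<^sub>m 1\<^sub>m n) * mat_powr P (1 / 2))"
      using Pp by (intro qle_congruence_herm) auto
    also have "mat_powr P (1 / 2) * (complex_of_real k \<cdot>\<^sub>m 1\<^sub>m n) * mat_powr P (1 / 2) = complex_of_real k \<cdot>\<^sub>m P"
      using Pp by (simp add: mat_mult_smult mat_smult_mult right_mult_one_mat[of _ n n] mat_powr_mult)
    finally show ?thesis unfolding pd_sandwich_powr[OF P] using P by simp
  qed
  define Z where "Z = mat_powr P (r / 2) * mat_powr Q s * mat_powr P (r / 2)"
  have Z: "Z \<in> psd_mats n" unfolding Z_def using Pp Q by (intro psd_congruence') auto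
  have bound: "(1 + e * k) powr (r * t) * qform (mat_powr Z t) v \<le> (1 + e * k) powr r * qform (mat_powr P r) v" if e: "0 < e" for e
  proof -
    define c where "c = 1 + e * k"
    have c: "0 < c" using e by (simp add: c_def k_def add_pos_nonneg)
    \<comment> \<open>Only the zero eigenvalues are raised, to \<open>e\<close>. Since
      \<open>Qe\<close> is a function of \<open>Q\<close>, Q^s \<le> Qe^s follows from the
      functional calculus, although s may exceed 1.\<close>
    define Qe where "Qe = mat_fun (\<lambda>x. if x = 0 then e else x) Q"
    have Qe: "Qe \<in> pd_mats n" unfolding Qe_def using e psd_spectrum[OF Q] by (intro mat_fun_pd[OF Qh]) (auto simp: less_le)
    have cP: "complex_of_real c \<cdot>\<^sub>m P \<in> pd_mats n" using pd_smult(1)[OF P c] .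
    have "qle n Qe (mat_fun (\<lambda>x. x + e * 1) Q)"
      unfolding Qe_def using e by (intro mat_fun_mono[OF Qh]) auto
    also have "mat_fun (\<lambda>x. x + e * 1) Q = Q + complex_of_real e \<cdot>\<^sub>m 1\<^sub>m n"
      unfolding mat_fun_add[OF Qh, symmetric] mat_fun_smult[OF Qh, symmetric] mat_fun_const_1[OF Qh] mat_fun_id[OF Qh] ..
    also have "qle n \<dots> (complex_of_real c \<cdot>\<^sub>m P)"
    proof (rule qleI)
      fix x :: "complex vec" assume x: "x \<in> carrier_vec n"
      have "e * qform (1\<^sub>m n) x \<le> e * (k * qform P x)"
        using qleD[OF kP x] x P e by (intro mult_left_mono) (auto simp: qform_smult[of _ n])
      then show "qform (Q + complex_of_real e \<cdot>\<^sub>m 1\<^sub>m n) x \<le> qform (complex_of_real c \<cdot>\<^sub>m P) x"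
        using qleD[OF le x] qform_smult[OF pd_carrier[OF P] x, of c] x Q qform_smult[of "1\<^sub>m n" n x e]
          qform_add[of Q n "complex_of_real e \<cdot>\<^sub>m 1\<^sub>m n" x]
        by (simp add: c_def distrib_right mult.assoc del: of_real_add of_real_mult)
    qed
    finally have fu: "qle n (mat_powr (mat_powr (complex_of_real c \<cdot>\<^sub>m P) (r / 2) * mat_powr Qe s * mat_powr (complex_of_real c \<cdot>\<^sub>m P) (r / 2)) t) (mat_powr (complex_of_real c \<cdot>\<^sub>m P) r)"
      unfolding t_def by (rule furuta_pd[OF cP Qe _ s r])
    have Qes: "mat_powr Qe s \<in> psd_mats n" using Qe by simp
    define Ze where "Ze = mat_powr P (r / 2) * mat_powr Qe s * mat_powr P (r / 2)"
    have Ze: "Ze \<in> psd_mats n" unfolding Ze_def using Pp Qe by (intro psd_congruence') auto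
    have pc: "mat_powr (complex_of_real c \<cdot>\<^sub>m P) x = complex_of_real (c powr x) \<cdot>\<^sub>m mat_powr P x" for x
      using mat_powr_smult(1)[OF Pp, of c x] c by simp
    have cc: "c powr (r / 2) * c powr (r / 2) = c powr r" by (simp add: powr_add[symmetric])
    have "mat_powr (complex_of_real c \<cdot>\<^sub>m P) (r / 2) * mat_powr Qe s * mat_powr (complex_of_real c \<cdot>\<^sub>m P) (r / 2)
        = complex_of_real (c powr r) \<cdot>\<^sub>m Ze"
      unfolding pc Ze_def cc[symmetric] using Pp Qe by (simp add: mat_mult_smult mat_smult_mult smult_smult_mat)
    then have "qle n (complex_of_real (c powr (r * t)) \<cdot>\<^sub>m mat_powr Ze t) (complex_of_real (c powr r) \<cdot>\<^sub>m mat_powr P r)"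
      using fu mat_powr_smult(1)[OF Ze, of "c powr r" t] by (simp add: pc powr_powr)
    then have 1: "c powr (r * t) * qform (mat_powr Ze t) v \<le> c powr r * qform (mat_powr P r) v"
      using qleD[OF _ v] Ze Pp v by (fastforce simp: qform_smult[of _ n])
    have "qle n (mat_powr Q s) (mat_powr Qe s)"
      unfolding mat_powr_psd_eq[OF Q] mat_powr_psd_eq[OF pd_imp_psd[OF Qe]]
      unfolding Qe_def mat_fun_comp[OF Qh] using s by (intro mat_fun_mono[OF Qh]) auto
    then have "qle n Z Ze" unfolding Z_def Ze_def using Pp Q Qe by (intro qle_congruence_herm) auto
    then have "qform (mat_powr Z t) v \<le> qform (mat_powr Ze t) v"
      using loewner_heinz[OF Z Ze _ t] qleD[OF _ v] by blast
    then have "c powr (r * t) * qform (mat_powr Z t) v \<le> c powr (r * t) * qform (mat_powr Ze t) v"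
      by (intro mult_left_mono) auto
    then show ?thesis using 1 unfolding c_def by linarith
  qed
  have lim: "((\<lambda>e. (1 + e * k) powr x * y) \<longlongrightarrow> (1 + 0 * k) powr x * y) (at_right 0)" for x y
    by (intro tendsto_intros) auto
  have "(1 + 0 * k) powr (r * t) * qform (mat_powr Z t) v \<le> (1 + 0 * k) powr r * qform (mat_powr P r) v"
    by (rule tendsto_le[OF _ lim lim]) (auto intro!: eventually_at_rightI[of 0 1] bound)
  then show "qform (mat_powr (mat_powr P (r / 2) * mat_powr Q s * mat_powr P (r / 2)) (r / (r + s))) v \<le> qform (mat_powr P r) v"
    unfolding Z_def t_def by simp
qed

text \<open>The hypothesis says D^\<alpha> \<le> P with D = X^(1/2) Y X^(1/2) and P = c X^(2\<alpha>
  - 1). In Furuta's inequality s = 1/\<alpha> restores D, and r = 1/(1 - 2\<alpha>) makes P^(r/2) a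
  multiple of X^(-1/2), which strips D down to Y. The exponent r/(r+s) is then \<alpha>/(1 -
  \<alpha>), and a multiple of that power of Y is bounded by a multiple of X^-1.\<close>

lemma sandwiched_bound:
  assumes X: "X \<in> pd_mats n" and Y: "Y \<in> psd_mats n" and \<alpha>: "0 < \<alpha>" "\<alpha> < 1/2" and c: "0 < c"
    and le: "qle n (mat_powr X (1/2 - \<alpha>) * mat_powr (mat_powr X (1/2) * Y * mat_powr X (1/2)) \<alpha> * mat_powr X (1/2 - \<alpha>))
      (complex_of_real c \<cdot>\<^sub>m 1\<^sub>m n)"
  shows "qle n (mat_powr X (1/2) * mat_powr Y (\<alpha> / (1 - \<alpha>)) * mat_powr X (1/2)) (complex_of_real (c powr (1 / (1 - \<alpha>))) \<cdot>\<^sub>m 1\<^sub>m n)"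
proof -
  note Xp = pd_imp_psd[OF X]
  define D where "D = mat_powr X (1/2) * Y * mat_powr X (1/2)"
  have D: "D \<in> psd_mats n" unfolding D_def using Xp Y by (intro psd_congruence') auto
  have Da: "mat_powr D \<alpha> \<in> psd_mats n" using D by simp
  define s where "s = 1 / \<alpha>"
  define r where "r = 1 / (1 - 2 * \<alpha>)"
  define t where "t = \<alpha> / (1 - \<alpha>)"
  have rs: "1 \<le> s" "1 \<le> r" "r / (r + s) = t"
  proof -
    have nz: "\<alpha> \<noteq> 0" "1 - 2 * \<alpha> \<noteq> 0" "1 - \<alpha> \<noteq> 0" using \<alpha> by auto
    have "r + s = (1 - \<alpha>) / (\<alpha> * (1 - 2 * \<alpha>))"
      unfolding r_def s_def using nz by (simp add: add_frac_eq)
    then show "r / (r + s) = t" unfolding r_def t_def using nz by simp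
  qed (use \<alpha> in \<open>auto simp: s_def r_def\<close>)
  define P where "P = complex_of_real c \<cdot>\<^sub>m mat_powr X (2 * \<alpha> - 1)"
  have P: "P \<in> pd_mats n" unfolding P_def using X c by (intro pd_smult) auto
  have Pr: "mat_powr P x = complex_of_real (c powr x) \<cdot>\<^sub>m mat_powr X ((2 * \<alpha> - 1) * x)" for x
    unfolding P_def using mat_powr_smult(1)[of "mat_powr X (2 * \<alpha> - 1)" n c x] Xp c
    by (simp add: mat_powr_powr[OF Xp])
  have "qle n (mat_powr X (- (1/2 - \<alpha>)) * (mat_powr X (1/2 - \<alpha>) * mat_powr D \<alpha> * mat_powr X (1/2 - \<alpha>)) * mat_powr X (- (1/2 - \<alpha>)))
     (mat_powr X (- (1/2 - \<alpha>)) * (complex_of_real c \<cdot>\<^sub>m 1\<^sub>m n) * mat_powr X (- (1/2 - \<alpha>)))"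
    using le Xp D unfolding D_def[symmetric] by (intro qle_congruence_herm) auto
  moreover have "mat_powr X (- (1/2 - \<alpha>)) * (complex_of_real c \<cdot>\<^sub>m 1\<^sub>m n) * mat_powr X (- (1/2 - \<alpha>)) = P"
    unfolding P_def using Xp
    by (simp add: mat_mult_smult mat_smult_mult right_mult_one_mat[of _ n n] mat_powr_mult)
  ultimately have "qle n (mat_powr D \<alpha>) P"
    unfolding pd_sandwich_cancel(2)[OF X psd_carrier[OF Da]] by simp
  from furuta[OF P Da this rs(1,2)]
  have "qle n (mat_powr (mat_powr P (r / 2) * mat_powr (mat_powr D \<alpha>) s * mat_powr P (r / 2)) t) (mat_powr P r)"
    unfolding rs(3) .
  moreover have "mat_powr (mat_powr D \<alpha>) s = D" using D \<alpha> by (simp add: mat_powr_powr s_def)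
  moreover have e: "(2 * \<alpha> - 1) * (r / 2) = - (1 / 2)" "(2 * \<alpha> - 1) * r = - 1" using \<alpha> by (auto simp: r_def field_simps)
  have cc: "c powr (r / 2) * c powr (r / 2) = c powr r" by (simp add: powr_add[symmetric])
  have "mat_powr P (r / 2) * D * mat_powr P (r / 2) = complex_of_real (c powr r) \<cdot>\<^sub>m (mat_powr X (- (1 / 2)) * D * mat_powr X (- (1 / 2)))"
    unfolding Pr e cc[symmetric] using Xp D by (simp add: mat_mult_smult mat_smult_mult smult_smult_mat)
  moreover have "mat_powr X (- (1 / 2)) * D * mat_powr X (- (1 / 2)) = Y"
    unfolding D_def using pd_sandwich_cancel(2)[OF X psd_carrier[OF Y], of "1/2"] by simp
  moreover have "mat_powr (complex_of_real (c powr r) \<cdot>\<^sub>m Y) t = complex_of_real (c powr (r * t)) \<cdot>\<^sub>m mat_powr Y t"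
    using mat_powr_smult(1)[OF Y, of "c powr r" t] by (simp add: powr_powr)
  ultimately have "qle n (complex_of_real (c powr (r * t)) \<cdot>\<^sub>m mat_powr Y t) (complex_of_real (c powr r) \<cdot>\<^sub>m mat_powr X (- 1))"
    unfolding Pr[of r] e by simp
  then have "qle n (complex_of_real (c powr (- (r * t))) \<cdot>\<^sub>m (complex_of_real (c powr (r * t)) \<cdot>\<^sub>m mat_powr Y t)) (complex_of_real (c powr (- (r * t))) \<cdot>\<^sub>m (complex_of_real (c powr r) \<cdot>\<^sub>m mat_powr X (- 1)))"
    using Xp Y by (intro qle_smult) auto
  moreover have "c powr (- (r * t)) * c powr (r * t) = 1" "c powr (- (r * t)) * c powr r = c powr (1 / (1 - \<alpha>))"
  proof -
    show "c powr (- (r * t)) * c powr (r * t) = 1" using c by (simp add: powr_add[symmetric])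
    have "- (r * t) + r = 1 / (1 - \<alpha>)"
    proof -
      have "1 - t = (1 - 2 * \<alpha>) / (1 - \<alpha>)" using \<alpha> by (simp add: t_def field_simps)
      then have "r * (1 - t) = 1 / (1 - \<alpha>)" using \<alpha> by (simp add: r_def)
      then show ?thesis by (simp add: algebra_simps)
    qed
    then show "c powr (- (r * t)) * c powr r = c powr (1 / (1 - \<alpha>))" by (simp only: powr_add[symmetric])
  qed
  ultimately have "qle n (mat_powr Y t) (complex_of_real (c powr (1 / (1 - \<alpha>))) \<cdot>\<^sub>m mat_powr X (- 1))"
    unfolding smult_smult_mat of_real_mult[symmetric] by simp
  then have "qle n (mat_powr X (1/2) * mat_powr Y t * mat_powr X (1/2)) (mat_powr X (1/2) * (complex_of_real (c powr (1 / (1 - \<alpha>))) \<cdot>\<^sub>m mat_powr X (- 1)) * mat_powr X (1/2))"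
    using Xp Y by (intro qle_congruence_herm) auto
  also have "mat_powr X (1/2) * (complex_of_real (c powr (1 / (1 - \<alpha>))) \<cdot>\<^sub>m mat_powr X (- 1)) * mat_powr X (1/2)
     = complex_of_real (c powr (1 / (1 - \<alpha>))) \<cdot>\<^sub>m (mat_powr X (1/2) * mat_powr X (- 1) * mat_powr X (1/2))"
    using Xp by (simp add: mat_mult_smult mat_smult_mult)
  also have "mat_powr X (1/2) * mat_powr X (- 1) * mat_powr X (1/2) = 1\<^sub>m n"
    unfolding pd_sandwich_powr[OF X] using X by simp
  finally show ?thesis unfolding t_def .
qed

section \<open>Compound matrices\<close>

text \<open>The k-element subsets of {..<n}, as increasing lists so that \<open>(!)\<close> selects
  rows and columns.\<close>

definition increasing_lists :: "nat \<Rightarrow> nat \<Rightarrow> nat list set" where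
  "increasing_lists n k = {xs. sorted xs \<and> distinct xs \<and> set xs \<subseteq> {..<n} \<and> length xs = k}"

lemma finite_increasing_lists [simp]: "finite (increasing_lists n k)"
  unfolding increasing_lists_def
  by (rule finite_subset[OF _ finite_lists_length_eq[of "{..<n}" k]]) auto

text \<open>Selections are arbitrary functions, because the expansion behind the Cauchy-Binet
  formula runs through unsorted and repeated ones.\<close>

definition submat :: "nat \<Rightarrow> complex mat \<Rightarrow> (nat \<Rightarrow> nat) \<Rightarrow> (nat \<Rightarrow> nat) \<Rightarrow> complex mat" where
  "submat k A f g = mat k k (\<lambda>(a, b). A $$ (f a, g b))"

lemma submat_carrier [simp]: "submat k A f g \<in> carrier_mat k k"
  by (simp add: submat_def)

lemma det_submat:
  "det (submat k A f g) = (\<Sum>p | p permutes {0..<k}. signof p * (\<Prod>a=0..<k. A $$ (f a, g (p a))))"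
proof -
  have "(\<Prod>a=0..<k. submat k A f g $$ (a, p a)) = (\<Prod>a=0..<k. A $$ (f a, g (p a)))" if "p permutes {0..<k}" for p
    using permutes_in_image[OF that] by (intro prod.cong) (auto simp: submat_def)
  then show ?thesis by (simp add: det_def'[OF submat_carrier])
qed

section \<open>Minors and the Cauchy-Binet formula\<close>

lemma det_submat_permute:
  assumes "p permutes {0..<k}"
  shows "det (submat k A (f \<circ> p) g) = signof p * det (submat k A f g)"
proof -
  have "submat k A (f \<circ> p) g = mat k k (\<lambda>(i, j). submat k A f g $$ (p i, j))"
    using permutes_in_image[OF assms] by (intro eq_matI) (auto simp: submat_def)
  then show ?thesis using det_permute_rows[OF submat_carrier assms, of A f g] by simp
qed

lemma det_submat_not_inj:
  assumes "\<not> inj_on f {0..<k}"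
  shows "det (submat k A f g) = 0"
proof -
  obtain i j where "i < k" "j < k" "i \<noteq> j" "f i = f j" using assms unfolding inj_on_def by auto
  then show ?thesis
    by (intro det_identical_rows[OF submat_carrier, of i j]) (auto simp: submat_def intro!: eq_vecI)
qed

text \<open>An injective selection is its sorted image composed with a unique permutation.
  \<open>restrict\<close> makes the composites extensional, to match the maps that index an expanded
  product of sums.\<close>

lemma bij_betw_increasing_permutation:
  "bij_betw (\<lambda>(zs, p). restrict (\<lambda>a. zs ! p a) {0..<k})
     (increasing_lists n k \<times> {p. p permutes {0..<k}})
     {f \<in> {0..<k} \<rightarrow>\<^sub>E {..<n}. inj_on f {0..<k}}"
  unfolding bij_betw_def
proof (intro conjI)
  let ?h = "\<lambda>(zs, p). restrict (\<lambda>a. zs ! p a) {0..<k}"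
  have img: "(\<lambda>a. zs ! p a) ` {0..<k} = set zs" if "length zs = k" "p permutes {0..<k}" for zs :: "nat list" and p
    using permutes_image[OF that(2)] that(1) by (metis image_image list.set_map map_nth set_upt)
  show "inj_on ?h (increasing_lists n k \<times> {p. p permutes {0..<k}})"
  proof (rule inj_onI, clarify)
    fix zs p zs' p'
    assume zs: "zs \<in> increasing_lists n k" and zs': "zs' \<in> increasing_lists n k"
      and p: "p permutes {0..<k}" and p': "p' permutes {0..<k}"
      and eq: "restrict (\<lambda>a. zs ! p a) {0..<k} = restrict (\<lambda>a. zs' ! p' a) {0..<k}"
    have len: "length zs = k" "length zs' = k" and d: "distinct zs" using zs zs' by (auto simp: increasing_lists_def)
    have e: "zs ! p a = zs' ! p' a" if "a \<in> {0..<k}" for a using fun_cong[OF eq, of a] that by simp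
    have "set zs = set zs'" using img[OF len(1) p] img[OF len(2) p'] e by (metis (no_types, lifting) image_cong)
    then have z: "zs = zs'" using zs zs' by (intro sorted_distinct_set_unique) (auto simp: increasing_lists_def)
    have "p a = p' a" for a
    proof (cases "a \<in> {0..<k}")
      case True
      then have "p a < k" "p' a < k" using permutes_in_image[OF p, of a] permutes_in_image[OF p', of a] by auto
      then show ?thesis using e[OF True] d len nth_eq_iff_index_eq unfolding z by blast
    next
      case False
      then show ?thesis using permutes_not_in[OF p] permutes_not_in[OF p'] by simp
    qed
    then show "zs = zs' \<and> p = p'" using z by auto
  qed
  show "?h ` (increasing_lists n k \<times> {p. p permutes {0..<k}}) = {f \<in> {0..<k} \<rightarrow>\<^sub>E {..<n}. inj_on f {0..<k}}"
  proof (intro equalityI subsetI)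
    fix f assume "f \<in> ?h ` (increasing_lists n k \<times> {p. p permutes {0..<k}})"
    then obtain zs p where zs: "zs \<in> increasing_lists n k" and p: "p permutes {0..<k}"
      and f: "f = restrict (\<lambda>a. zs ! p a) {0..<k}" by auto
    have pk: "p a < k" if "a < k" for a using permutes_in_image[OF p, of a] that by simp
    have "inj_on (\<lambda>a. zs ! p a) {0..<k}"
      using zs pk permutes_inj[OF p] by (auto simp: inj_on_def increasing_lists_def nth_eq_iff_index_eq dest: injD)
    moreover have "zs ! p a < n" if "a < k" for a
      using zs pk[OF that] by (auto simp: increasing_lists_def dest!: nth_mem)
    ultimately show "f \<in> {f \<in> {0..<k} \<rightarrow>\<^sub>E {..<n}. inj_on f {0..<k}}"
      unfolding f by (auto simp: inj_on_def)
  next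
    fix f assume "f \<in> {f \<in> {0..<k} \<rightarrow>\<^sub>E {..<n}. inj_on f {0..<k}}"
    then have f: "f \<in> {0..<k} \<rightarrow>\<^sub>E {..<n}" and inj: "inj_on f {0..<k}" by auto
    define zs where "zs = sorted_list_of_set (f ` {0..<k})"
    have zs: "zs \<in> increasing_lists n k" "set zs = f ` {0..<k}" "length zs = k" "distinct zs"
      using f inj by (auto simp: zs_def increasing_lists_def card_image)
    have "\<exists>b. b < k \<and> zs ! b = f a" if "a \<in> {0..<k}" for a
    proof -
      have "f a \<in> set zs" unfolding zs(2) using that by blast
      then show ?thesis unfolding in_set_conv_nth zs(3) .
    qed
    then obtain q where q: "\<And>a. a \<in> {0..<k} \<Longrightarrow> q a < k \<and> zs ! q a = f a"
      using bchoice[of "{0..<k}" "\<lambda>a b. b < k \<and> zs ! b = f a"] by blast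
    define p where "p a = (if a < k then q a else a)" for a
    have "p permutes {0..<k}"
    proof (rule inj_imp_permutes)
      show "inj_on p {0..<k}"
      proof (rule inj_onI)
        fix a b assume ab: "a \<in> {0..<k}" "b \<in> {0..<k}" "p a = p b"
        then have "f a = f b" using q[OF ab(1)] q[OF ab(2)] by (simp add: p_def)
        then show "a = b" using inj ab by (simp add: inj_on_def)
      qed
    qed (use q in \<open>auto simp: p_def\<close>)
    moreover have "f = restrict (\<lambda>a. zs ! p a) {0..<k}"
      using f q by (intro ext) (auto simp: p_def restrict_def PiE_def extensional_def)
    ultimately show "f \<in> ?h ` (increasing_lists n k \<times> {p. p permutes {0..<k}})" using zs(1) by force
  qed
qed

text \<open>The product of sums expands over all maps h. Maps with repeated values give equal rows
  and drop out; the injective ones are grouped by their image, and the signs of the permutations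
  assemble the minor of \<open>A\<close>.\<close>

theorem cauchy_binet:
  assumes A: "A \<in> carrier_mat n n" and B: "B \<in> carrier_mat n n"
    and f: "\<And>a. a < k \<Longrightarrow> f a < n" and g: "\<And>a. a < k \<Longrightarrow> g a < n"
  shows "det (submat k (A * B) f g) =
    (\<Sum>zs \<in> increasing_lists n k. det (submat k A f ((!) zs)) * det (submat k B ((!) zs) g))"
proof -
  let ?F = "{0..<k} \<rightarrow>\<^sub>E {..<n}"
  have "det (submat k (A * B) f g)
      = (\<Sum>p | p permutes {0..<k}. signof p * (\<Prod>a=0..<k. \<Sum>m<n. A $$ (f a, m) * B $$ (m, g (p a))))"
    unfolding det_submat
  proof (rule sum.cong[OF refl])
    fix p assume "p \<in> {p. p permutes {0..<k}}"
    then have p: "p a < k" if "a < k" for a using permutes_in_image[of p "{0..<k}" a] that by simp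
    have "(A * B) $$ (f a, g (p a)) = (\<Sum>m<n. A $$ (f a, m) * B $$ (m, g (p a)))" if "a < k" for a
      using f[OF that] g[OF p[OF that]] by (rule mult_mat_index_sum[OF A B])
    then show "signof p * (\<Prod>a=0..<k. (A * B) $$ (f a, g (p a)))
        = signof p * (\<Prod>a=0..<k. \<Sum>m<n. A $$ (f a, m) * B $$ (m, g (p a)))" by simp
  qed
  also have "\<dots> = (\<Sum>p | p permutes {0..<k}. \<Sum>h\<in>?F. (\<Prod>a=0..<k. A $$ (f a, h a)) * (signof p * (\<Prod>a=0..<k. B $$ (h a, g (p a)))))"
    by (simp add: prod_sum_PiE sum_distrib_left prod.distrib mult_ac)
  also have "\<dots> = (\<Sum>h\<in>?F. (\<Prod>a=0..<k. A $$ (f a, h a)) * det (submat k B h g))"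
    unfolding det_submat sum_distrib_left by (rule sum.swap)
  also have "\<dots> = (\<Sum>h | h \<in> ?F \<and> inj_on h {0..<k}. (\<Prod>a=0..<k. A $$ (f a, h a)) * det (submat k B h g))"
    by (intro sum.mono_neutral_right) (auto simp: det_submat_not_inj intro!: finite_PiE)
  also have "\<dots> = (\<Sum>(zs, p) \<in> increasing_lists n k \<times> {p. p permutes {0..<k}}.
      (\<Prod>a=0..<k. A $$ (f a, zs ! p a)) * (signof p * det (submat k B ((!) zs) g)))"
  proof (subst sum.reindex_bij_betw[OF bij_betw_increasing_permutation, symmetric], intro sum.cong refl, clarify)
    fix zs p assume p: "p permutes {0..<k}"
    have "submat k B (restrict (\<lambda>a. zs ! p a) {0..<k}) g = submat k B ((!) zs \<circ> p) g"
      by (intro eq_matI) (auto simp: submat_def)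
    then show "(\<Prod>a=0..<k. A $$ (f a, restrict (\<lambda>a. zs ! p a) {0..<k} a)) * det (submat k B (restrict (\<lambda>a. zs ! p a) {0..<k}) g)
      = (\<Prod>a=0..<k. A $$ (f a, zs ! p a)) * (signof p * det (submat k B ((!) zs) g))"
      using det_submat_permute[OF p, of B "(!) zs" g] by simp
  qed
  also have "\<dots> = (\<Sum>zs \<in> increasing_lists n k. \<Sum>p | p permutes {0..<k}.
      (\<Prod>a=0..<k. A $$ (f a, zs ! p a)) * (signof p * det (submat k B ((!) zs) g)))"
    by (rule sum.cartesian_product[symmetric])
  also have "\<dots> = (\<Sum>zs \<in> increasing_lists n k. det (submat k A f ((!) zs)) * det (submat k B ((!) zs) g))"
    by (simp add: det_submat[of k A f] sum_distrib_left sum_distrib_right mult_ac)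
  finally show ?thesis .
qed

text \<open>An arbitrary enumeration; another order would only conjugate the compound by a
  permutation matrix.\<close>

definition index_list :: "nat \<Rightarrow> nat \<Rightarrow> nat list list" where
  "index_list n k = (SOME es. set es = increasing_lists n k \<and> distinct es)"

lemma index_list: "set (index_list n k) = increasing_lists n k" "distinct (index_list n k)"
  using someI_ex[OF finite_distinct_list[OF finite_increasing_lists[of n k]]] unfolding index_list_def by blast+

abbreviation compound_dim :: "nat \<Rightarrow> nat \<Rightarrow> nat" where
  "compound_dim n k \<equiv> length (index_list n k)"

text \<open>The matrix of the k-th exterior power of \<open>A\<close>.\<close>

definition compound :: "nat \<Rightarrow> nat \<Rightarrow> complex mat \<Rightarrow> complex mat" where
  "compound n k A = mat (compound_dim n k) (compound_dim n k)
     (\<lambda>(i, j). det (submat k A ((!) (index_list n k ! i)) ((!) (index_list n k ! j))))"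

lemma compound_carrier [simp]: "compound n k A \<in> carrier_mat (compound_dim n k) (compound_dim n k)"
  by (simp add: compound_def)

lemma compound_dims [simp]:
  "dim_row (compound n k A) = compound_dim n k" "dim_col (compound n k A) = compound_dim n k"
  by (simp_all add: compound_def)

section \<open>Algebra and spectrum of compounds\<close>

lemma index_list_nth:
  assumes "i < compound_dim n k"
  shows "sorted (index_list n k ! i)" "distinct (index_list n k ! i)" "length (index_list n k ! i) = k"
    "a < k \<Longrightarrow> index_list n k ! i ! a < n"
proof -
  have "index_list n k ! i \<in> increasing_lists n k" using assms index_list(1) nth_mem by blast
  then have e: "sorted (index_list n k ! i)" "distinct (index_list n k ! i)" "length (index_list n k ! i) = k"
    "set (index_list n k ! i) \<subseteq> {..<n}" unfolding increasing_lists_def by auto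
  then show "sorted (index_list n k ! i)" "distinct (index_list n k ! i)" "length (index_list n k ! i) = k" by auto
  show "index_list n k ! i ! a < n" if "a < k"
  proof -
    have "index_list n k ! i ! a \<in> set (index_list n k ! i)" using that e(3) by (intro nth_mem) simp
    then show ?thesis using e(4) by blast
  qed
qed

lemma compound_mult:
  assumes A: "A \<in> carrier_mat n n" and B: "B \<in> carrier_mat n n"
  shows "compound n k (A * B) = compound n k A * compound n k B"
proof (rule eq_matI)
  let ?N = "compound_dim n k" and ?e = "index_list n k"
  fix i j assume "i < dim_row (compound n k A * compound n k B)" "j < dim_col (compound n k A * compound n k B)"
  then have ij: "i < ?N" "j < ?N" by auto
  have "compound n k (A * B) $$ (i, j) =
    (\<Sum>zs \<in> increasing_lists n k. det (submat k A ((!) (?e ! i)) ((!) zs)) * det (submat k B ((!) zs) ((!) (?e ! j))))"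
    using ij cauchy_binet[OF A B, of k "(!) (?e ! i)" "(!) (?e ! j)"] index_list_nth(4)
    by (simp add: compound_def)
  also have "\<dots> = (\<Sum>l<?N. det (submat k A ((!) (?e ! i)) ((!) (?e ! l))) * det (submat k B ((!) (?e ! l)) ((!) (?e ! j))))"
    by (rule sum.reindex_bij_betw[OF bij_betw_nth[OF index_list(2) refl index_list(1)[symmetric]], symmetric])
  also have "\<dots> = (\<Sum>l<?N. compound n k A $$ (i, l) * compound n k B $$ (l, j))"
    using ij by (simp add: compound_def)
  also have "\<dots> = (compound n k A * compound n k B) $$ (i, j)"
    by (rule mult_mat_index_sum[OF compound_carrier compound_carrier ij, symmetric])
  finally show "compound n k (A * B) $$ (i, j) = (compound n k A * compound n k B) $$ (i, j)" .
qed auto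

lemma det_mat_adjoint: "A \<in> carrier_mat n n \<Longrightarrow> det (mat_adjoint A) = cnj (det (A :: complex mat))"
proof -
  assume A: "A \<in> carrier_mat n n"
  have s: "cnj (signof p) = signof p" for p by (simp add: sign_def)
  have "det (mat_adjoint A) = (\<Sum>p | p permutes {0..<n}. signof p * (\<Prod>i=0..<n. cnj (A $$ (p i, i))))"
    using A unfolding det_def'[OF mat_adjoint_carrier[OF A]]
    by (intro sum.cong refl arg_cong2[of _ _ _ _ "(*)"] prod.cong)
      (auto dest: permutes_in_image[THEN iffD2])
  also have "\<dots> = cnj (\<Sum>p | p permutes {0..<n}. signof p * (\<Prod>j<n. A $$ (p j, j)))"
    by (simp add: s atLeast0LessThan)
  finally show ?thesis unfolding det_col[OF A] .
qed

lemma compound_adjoint: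
  assumes A: "A \<in> carrier_mat n n"
  shows "compound n k (mat_adjoint A) = mat_adjoint (compound n k A)"
proof (rule eq_matI)
  fix i j assume "i < dim_row (mat_adjoint (compound n k A))" "j < dim_col (mat_adjoint (compound n k A))"
  then have ij: "i < compound_dim n k" "j < compound_dim n k" by auto
  have "submat k (mat_adjoint A) ((!) (index_list n k ! i)) ((!) (index_list n k ! j))
     = mat_adjoint (submat k A ((!) (index_list n k ! j)) ((!) (index_list n k ! i)))"
    using A index_list_nth(4)[OF ij(1)] index_list_nth(4)[OF ij(2)]
    by (intro eq_matI) (auto simp: submat_def)
  then show "compound n k (mat_adjoint A) $$ (i, j) = mat_adjoint (compound n k A) $$ (i, j)"
    using ij by (simp add: compound_def det_mat_adjoint[OF submat_carrier])
qed auto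

text \<open>Two different index sets of equal size leave a row index that is not a column index, so
  such a minor of a diagonal matrix has a zero row.\<close>

lemma compound_diag:
  "compound n k (mat_diag n f) = mat_diag (compound_dim n k) (\<lambda>i. \<Prod>a<k. f (index_list n k ! i ! a))"
proof (rule eq_matI)
  let ?N = "compound_dim n k" and ?e = "index_list n k"
  fix i j assume "i < dim_row (mat_diag ?N (\<lambda>i. \<Prod>a<k. f (?e ! i ! a)))" "j < dim_col (mat_diag ?N (\<lambda>i. \<Prod>a<k. f (?e ! i ! a)))"
  then have ij: "i < ?N" "j < ?N" by auto
  note e = index_list_nth[OF ij(1)] and e' = index_list_nth[OF ij(2)]
  let ?M = "submat k (mat_diag n f) ((!) (?e ! i)) ((!) (?e ! j))"
  have "det ?M = (if i = j then \<Prod>a<k. f (?e ! i ! a) else 0)"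
  proof (cases "i = j")
    case True
    have entry: "?M $$ (a, b) = (if a = b then f (?e ! i ! a) else 0)" if "a < k" "b < k" for a b
      using that e e' True by (simp add: submat_def mat_diag_def nth_eq_iff_index_eq)
    have "det ?M = prod_list (diag_mat ?M)"
      by (rule det_upper_triangular[of _ k]) (auto simp: upper_triangular_def entry carrier_matD[OF submat_carrier])
    also have "diag_mat ?M = map (\<lambda>a. f (?e ! i ! a)) [0..<k]"
      unfolding diag_mat_def by (intro map_cong) (auto simp: entry carrier_matD[OF submat_carrier])
    finally show ?thesis using True
      by (simp add: prod.distinct_set_conv_list[of "[0..<k]", symmetric] atLeast0LessThan)
  next
    case False
    have "set (?e ! i) \<noteq> set (?e ! j)"
      using sorted_distinct_set_unique[OF e(1,2) e'(1,2)] False index_list(2) ij nth_eq_iff_index_eq by blast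
    moreover have "card (set (?e ! i)) = k" "card (set (?e ! j)) = k"
      using distinct_card[OF e(2)] distinct_card[OF e'(2)] e(3) e'(3) by auto
    ultimately obtain x where x: "x \<in> set (?e ! i)" "x \<notin> set (?e ! j)"
      by (metis List.finite_set card_subset_eq subsetI)
    then obtain a where a: "a < k" "?e ! i ! a = x" using e(3) by (auto simp: in_set_conv_nth)
    have z: "(\<Prod>b=0..<k. mat_diag n f $$ (?e ! i ! b, ?e ! j ! p b)) = 0" if "p permutes {0..<k}" for p
    proof (rule prod_zero)
      have "p a < k" using permutes_in_image[OF that, of a] a by simp
      then have "?e ! j ! p a \<noteq> x" using x(2) e'(3) nth_mem by metis
      then show "\<exists>b\<in>{0..<k}. mat_diag n f $$ (?e ! i ! b, ?e ! j ! p b) = 0"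
        using a e(4)[OF a(1)] e'(4)[OF \<open>p a < k\<close>] by (intro bexI[of _ a]) (auto simp: mat_diag_def)
    qed simp
    have "det ?M = 0" unfolding det_submat
    proof (rule sum.neutral, rule ballI)
      fix p assume "p \<in> {p. p permutes {0..<k}}"
      then show "signof p * (\<Prod>b=0..<k. mat_diag n f $$ (?e ! i ! b, ?e ! j ! p b)) = 0"
        using z[of p] by (simp only: mem_Collect_eq mult_zero_right)
    qed
    then show ?thesis using False by simp
  qed
  then show "compound n k (mat_diag n f) $$ (i, j) = mat_diag ?N (\<lambda>i. \<Prod>a<k. f (?e ! i ! a)) $$ (i, j)"
    using ij by (simp add: compound_def mat_diag_def)
qed auto

lemma compound_one: "compound n k (1\<^sub>m n) = 1\<^sub>m (compound_dim n k)"
  using compound_diag[of n k "\<lambda>_. 1"] by simp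

lemma compound_unitary: "U \<in> unitary_mats n \<Longrightarrow> compound n k U \<in> unitary_mats (compound_dim n k)"
  using compound_mult[of "mat_adjoint U" n U k] compound_adjoint[of U n k]
  by (intro unitaryI) (simp_all add: compound_one)

lemma compound_spectral:
  assumes U: "U \<in> unitary_mats n"
  shows "compound n k (U * rdiag n d * mat_adjoint U) =
    compound n k U * rdiag (compound_dim n k) (\<lambda>i. \<Prod>a<k. d (index_list n k ! i ! a)) * mat_adjoint (compound n k U)"
  using U compound_mult[of "U * rdiag n d" n "mat_adjoint U" k] compound_mult[of U n "rdiag n d" k]
  by (simp add: compound_adjoint[of _ n] compound_diag)

text \<open>The eigenvalues of the compound are products of k eigenvalues of \<open>A\<close>, and
  \<open>powr\<close> is multiplicative, so powers pass through the compound.\<close>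

lemma compound_psd:
  assumes A: "A \<in> psd_mats n"
  shows "compound n k A \<in> psd_mats (compound_dim n k)"
    and "mat_powr (compound n k A) r = compound n k (mat_powr A r)"
proof -
  obtain U d where U: "U \<in> unitary_mats n" and Ae: "A = U * rdiag n d * mat_adjoint U" and sp: "real_spectrum A = d ` {..<n}"
    and mf: "\<And>f. mat_fun f A = U * rdiag n (\<lambda>i. f (d i)) * mat_adjoint U"
    using herm_cases[OF psd_herm[OF A]] by metis
  note CU = compound_unitary[OF U, of k]
  have d: "0 \<le> d i" if "i < n" for i using psd_spectrum[OF A] sp that by auto
  have CA: "compound n k A = compound n k U * rdiag (compound_dim n k) (\<lambda>i. \<Prod>a<k. d (index_list n k ! i ! a)) * mat_adjoint (compound n k U)"
    unfolding Ae by (rule compound_spectral[OF U])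
  show p: "compound n k A \<in> psd_mats (compound_dim n k)"
    unfolding psd_spectrum_iff
  proof (intro conjI ballI)
    show "compound n k A \<in> herm_mats (compound_dim n k)" unfolding CA by (rule herm_spectral[OF CU])
    fix x assume "x \<in> real_spectrum (compound n k A)"
    then show "0 \<le> x"
      unfolding CA real_spectrum_spectral[OF CU] using d index_list_nth(4) by (auto intro!: prod_nonneg)
  qed
  show "mat_powr (compound n k A) r = compound n k (mat_powr A r)"
    unfolding mat_powr_psd_eq[OF p] mat_powr_psd_eq[OF A] mf compound_spectral[OF U]
    by (subst mat_fun_eqI[OF CU CA]) (simp only: prod_powr_distrib)
qed

lemma compound_pd:
  assumes A: "A \<in> pd_mats n"
  shows "compound n k A \<in> pd_mats (compound_dim n k)"
proof -
  note Ap = pd_imp_psd[OF A]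
  have "mat_powr (compound n k A) 0 = 1\<^sub>m (compound_dim n k)"
    using compound_psd(2)[OF Ap, of k 0] mat_powr_0[OF A] compound_one by simp
  moreover have "real_det (mat_powr (compound n k A) 0) = real_det (compound n k A) powr 0"
    by (rule real_det_mat_powr[OF compound_psd(1)[OF Ap]])
  \<comment> \<open>The left side is det 1 = 1, whereas \<open>0 powr 0 = 0\<close>.\<close>
  ultimately have "real_det (compound n k A) \<noteq> 0" by (auto simp: real_det_def split: if_splits)
  then show ?thesis by (rule psd_real_det_pos_imp_pd[OF compound_psd(1)[OF Ap]])
qed

lemma increasing_list_ge:
  assumes "sorted zs" "distinct zs" "a < length zs"
  shows "a \<le> zs ! (a :: nat)"
  using assms(3)
proof (induction a)
  case (Suc a)
  have "zs ! a \<le> zs ! Suc a" using assms(1) Suc.prems by (simp add: sorted_iff_nth_mono)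
  moreover have "zs ! a \<noteq> zs ! Suc a" using assms(2) Suc.prems by (simp add: nth_eq_iff_index_eq)
  ultimately show ?case using Suc by simp
qed simp

text \<open>The largest eigenvalue of the compound is the product of the k largest eigenvalues of
  \<open>A\<close>: it occurs at the index list \<open>[0..<k]\<close>, and it is maximal because
  position a of an increasing list holds at least a.\<close>

lemma compound_le_iff:
  assumes A: "A \<in> psd_mats n" and k: "k \<le> n"
  shows "qle (compound_dim n k) (compound n k A) (complex_of_real c \<cdot>\<^sub>m 1\<^sub>m (compound_dim n k))
    \<longleftrightarrow> (\<Prod>i<k. eigvals_desc A ! i) \<le> c"
proof -
  obtain U d where U: "U \<in> unitary_mats n" and Ae: "A = U * rdiag n d * mat_adjoint U" and sp: "real_spectrum A = d ` {..<n}"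
    and dec: "\<And>i j. i \<le> j \<Longrightarrow> j < n \<Longrightarrow> d j \<le> d i" and ev: "eigvals_desc A = map d [0..<n]"
    using herm_sorted_cases[OF psd_herm[OF A]] by metis
  have d: "0 \<le> d i" if "i < n" for i using psd_spectrum[OF A] sp that by auto
  have spC: "real_spectrum (compound n k A) = (\<lambda>i. \<Prod>a<k. d (index_list n k ! i ! a)) ` {..<compound_dim n k}"
    unfolding Ae compound_spectral[OF U] by (rule real_spectrum_spectral[OF compound_unitary[OF U]])
  have Ch: "compound n k A \<in> herm_mats (compound_dim n k)" using compound_psd(1)[OF A] by simp
  have prod: "(\<Prod>i<k. eigvals_desc A ! i) = (\<Prod>a<k. d a)" using k by (simp add: ev)
  have "[0..<k] \<in> increasing_lists n k" using k by (auto simp: increasing_lists_def)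
  then obtain i where i: "i < compound_dim n k" "index_list n k ! i = [0..<k]"
    using index_list(1) by (metis in_set_conv_nth)
  then have "(\<Prod>a<k. d a) = (\<Prod>a<k. d (index_list n k ! i ! a))" by simp
  then have mem: "(\<Prod>a<k. d a) \<in> real_spectrum (compound n k A)" unfolding spC using i by blast
  have max: "x \<le> (\<Prod>a<k. d a)" if x: "x \<in> real_spectrum (compound n k A)" for x
  proof -
    obtain j where j: "j < compound_dim n k" "x = (\<Prod>a<k. d (index_list n k ! j ! a))" using x unfolding spC by auto
    have le: "a \<le> index_list n k ! j ! a" "index_list n k ! j ! a < n" if "a < k" for a
      using increasing_list_ge[of "index_list n k ! j" a] index_list_nth[OF j(1)] that by auto
    show ?thesis unfolding j(2) using le d dec by (intro prod_mono) auto
  qed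
  show ?thesis unfolding prod
    using qle_spectrum_le[OF Ch _ mem] qle_one_spectrum[OF Ch, of c] max by (meson order_trans)
qed

text \<open>\<open>sandwiched_bound\<close> is applied to the compounds of \<open>X\<close> and
  \<open>Y\<close>. Products and powers pass through the compound, so both matrices keep their shape
  while their largest eigenvalues become products of the k largest.\<close>

lemma prod_eigvals_sandwiched:
  assumes X: "X \<in> pd_mats n" and Y: "Y \<in> psd_mats n" and \<alpha>: "0 < \<alpha>" "\<alpha> < 1/2" and k: "k \<le> n"
  defines "R \<equiv> mat_powr X (1/2 - \<alpha>) * mat_powr (mat_powr X (1/2) * Y * mat_powr X (1/2)) \<alpha> * mat_powr X (1/2 - \<alpha>)"
    and "S \<equiv> mat_powr X (1/2) * mat_powr Y (\<alpha> / (1 - \<alpha>)) * mat_powr X (1/2)"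
  shows "(\<Prod>i<k. eigvals_desc S ! i) \<le> (\<Prod>i<k. eigvals_desc R ! i) powr (1 / (1 - \<alpha>))"
proof -
  let ?N = "compound_dim n k" and ?C = "compound n k"
  note Xp = pd_imp_psd[OF X]
  define D where "D = mat_powr X (1/2) * Y * mat_powr X (1/2)"
  have D: "D \<in> psd_mats n" unfolding D_def using Xp Y by (intro psd_congruence') auto
  have R: "R \<in> psd_mats n" unfolding R_def D_def[symmetric] using Xp D by (intro psd_congruence') auto
  have S: "S \<in> psd_mats n" unfolding S_def using Xp Y by (intro psd_congruence') auto
  have c3: "?C (E * F * G) = ?C E * ?C F * ?C G" if "E \<in> psd_mats n" "F \<in> psd_mats n" "G \<in> psd_mats n" for E F G
    using compound_mult[of "E * F" n G k] compound_mult[of E n F k] that by simp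
  have CD: "?C D = mat_powr (?C X) (1/2) * ?C Y * mat_powr (?C X) (1/2)"
    unfolding D_def using Xp Y by (simp add: c3 compound_psd(2)[OF Xp])
  have CR: "?C R = mat_powr (?C X) (1/2 - \<alpha>) * mat_powr (mat_powr (?C X) (1/2) * ?C Y * mat_powr (?C X) (1/2)) \<alpha> * mat_powr (?C X) (1/2 - \<alpha>)"
    unfolding R_def D_def[symmetric] CD[symmetric] using Xp D by (simp add: c3 compound_psd(2)[OF Xp] compound_psd(2)[OF D])
  have CS: "?C S = mat_powr (?C X) (1/2) * mat_powr (?C Y) (\<alpha> / (1 - \<alpha>)) * mat_powr (?C X) (1/2)"
    unfolding S_def using Xp Y by (simp add: c3 compound_psd(2)[OF Xp] compound_psd(2)[OF Y])
  have bound: "(\<Prod>i<k. eigvals_desc S ! i) \<le> c powr (1 / (1 - \<alpha>))" if c: "0 < c" "(\<Prod>i<k. eigvals_desc R ! i) \<le> c" for c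
  proof -
    have "qle ?N (?C R) (complex_of_real c \<cdot>\<^sub>m 1\<^sub>m ?N)" using compound_le_iff[OF R k] c by simp
    then have "qle ?N (?C S) (complex_of_real (c powr (1 / (1 - \<alpha>))) \<cdot>\<^sub>m 1\<^sub>m ?N)"
      unfolding CR CS by (rule sandwiched_bound[OF compound_pd[OF X] compound_psd(1)[OF Y] \<alpha> c(1)])
    then show ?thesis using compound_le_iff[OF S k] by simp
  qed
  have nn: "0 \<le> (\<Prod>i<k. eigvals_desc R ! i)" using eigvals_desc_nonneg[OF R] k by (intro prod_nonneg) auto
  show ?thesis
  proof (cases "(\<Prod>i<k. eigvals_desc R ! i) = 0")
    case False
    then have "0 < (\<Prod>i<k. eigvals_desc R ! i)" using nn by linarith
    then show ?thesis by (rule bound) simp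
  next
    case True
    have "(\<Prod>i<k. eigvals_desc S ! i) \<le> 0"
    proof (rule ccontr)
      define x where "x = (\<Prod>i<k. eigvals_desc S ! i)"
      assume "\<not> (\<Prod>i<k. eigvals_desc S ! i) \<le> 0"
      then have x: "0 < x" by (simp add: x_def)
      \<comment> \<open>When the product for \<open>R\<close> is 0, every positive c is an
        admissible bound; this one yields x \<le> x/2.\<close>
      have c: "0 < (x / 2) powr (1 - \<alpha>)" using x by simp
      have "(\<Prod>i<k. eigvals_desc R ! i) \<le> (x / 2) powr (1 - \<alpha>)" using True c by linarith
      from bound[OF c this] have "x \<le> ((x / 2) powr (1 - \<alpha>)) powr (1 / (1 - \<alpha>))" by (simp only: x_def)
      also have "\<dots> = x / 2" using \<alpha> x by (simp add: powr_powr)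
      finally show False using x by simp
    qed
    then show ?thesis by (simp only: True) simp
  qed
qed

section \<open>Comparison of the means\<close>

lemma geo_mean_psd:
  "A \<in> psd_mats n \<Longrightarrow> B \<in> psd_mats n \<Longrightarrow> geo_mean \<alpha> A B \<in> psd_mats n"
  unfolding geo_mean_def
  by (intro psd_congruence' mat_powr_psd mat_powr_herm)

lemma geo_mean_inverse:
  assumes "X \<in> psd_mats n"
  shows "geo_mean \<alpha> (mat_powr X (- 1)) Y =
    mat_powr X (- (1/2)) * mat_powr (mat_powr X (1/2) * Y * mat_powr X (1/2)) \<alpha> * mat_powr X (- (1/2))"
  unfolding geo_mean_def mat_powr_powr[OF assms] by simp

text \<open>The exponent \<open>p\<close> only rescales: with \<open>X = A\<^sup>p\<close> and \<open>Y = B\<^sup>p\<close> all means are \<open>1/p\<close>-th powers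
  of the means of \<open>X\<close> and \<open>Y\<close> with exponent \<open>1\<close>.\<close>

definition SGt_core :: "real \<Rightarrow> complex mat \<Rightarrow> complex mat \<Rightarrow> complex mat" where
  "SGt_core \<alpha> X Y = (let C = mat_powr (geo_mean \<alpha> (mat_powr X (- 1)) Y) (1/2)
     in C * mat_powr X (2 * (1 - \<alpha>)) * C)"

lemma SGt_core_psd:
  "X \<in> psd_mats n \<Longrightarrow> Y \<in> psd_mats n \<Longrightarrow> SGt_core \<alpha> X Y \<in> psd_mats n"
  unfolding SGt_core_def Let_def
  by (intro psd_congruence' mat_powr_psd mat_powr_herm geo_mean_psd)

lemma SGt_mean_eq:
  assumes "A \<in> psd_mats n"
  shows "SGt_mean \<alpha> p A B = mat_powr (SGt_core \<alpha> (mat_powr A p) (mat_powr B p)) (1/p)"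
  unfolding SGt_mean_def SGt_core_def Let_def mat_powr_powr[OF assms] by (simp add: mult_ac)

lemma weighted_LE_exponent:
  assumes "A \<in> psd_mats n" "B \<in> psd_mats n" "p \<noteq> 0"
  shows "weighted_LE a b A B = mat_powr (weighted_LE a b (mat_powr A p) (mat_powr B p)) (1/p)"
  using assms by (simp add: weighted_LE_powr weighted_LE_mat_powr)

lemma log_maj_eigvals_cong: "eigvals_desc Y = eigvals_desc Z \<Longrightarrow> log_maj n X Y = log_maj n X Z"
  by (simp add: log_maj_def)

text \<open>With E the geometric mean, the core is K L for K = E^(1/2) X^(1-\<alpha>) and L its
  adjoint. In the order L K the square roots of E merge, and E = X^(-1/2) D X^(-1/2) leaves the
  outer exponent 1 - \<alpha> - 1/2.\<close>

lemma eigvals_SGt_core: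
  assumes X: "X \<in> pd_mats n" and Y: "Y \<in> psd_mats n"
  shows "eigvals_desc (SGt_core \<alpha> X Y) = eigvals_desc (mat_powr X (1/2 - \<alpha>) *
    mat_powr (mat_powr X (1/2) * Y * mat_powr X (1/2)) \<alpha> * mat_powr X (1/2 - \<alpha>))"
proof -
  note Xp = pd_imp_psd[OF X]
  define D where "D = mat_powr (mat_powr X (1/2) * Y * mat_powr X (1/2)) \<alpha>"
  have D: "D \<in> psd_mats n" unfolding D_def using Xp Y by (intro mat_powr_psd psd_congruence') auto
  define E where "E = mat_powr X (- (1/2)) * D * mat_powr X (- (1/2))"
  have E: "E \<in> psd_mats n" unfolding E_def using Xp D by (intro psd_congruence') auto
  define K where "K = mat_powr E (1/2) * mat_powr X (1 - \<alpha>)"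
  define L where "L = mat_powr X (1 - \<alpha>) * mat_powr E (1/2)"
  have KL: "K \<in> carrier_mat n n" "L \<in> carrier_mat n n" using E Xp by (simp_all add: K_def L_def)
  have "SGt_core \<alpha> X Y = mat_powr E (1/2) * mat_powr X (2 * (1 - \<alpha>)) * mat_powr E (1/2)"
    unfolding SGt_core_def Let_def geo_mean_inverse[OF Xp] E_def D_def ..
  also have "\<dots> = K * L"
    unfolding K_def L_def using E Xp mat_powr_mult_assoc[OF Xp, of "mat_powr E (1/2)" "1 - \<alpha>" "1 - \<alpha>"]
    by (simp add: mat_assoc algebra_simps)
  finally have "eigvals_desc (SGt_core \<alpha> X Y) = eigvals_desc (L * K)"
    using eigvals_desc_mult_commute[OF KL] by simp
  also have "L * K = mat_powr X (1 - \<alpha>) * E * mat_powr X (1 - \<alpha>)"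
    unfolding K_def L_def using E Xp by (simp add: mat_assoc mat_powr_mult_assoc[OF E])
  also have "\<dots> = mat_powr X (1 - \<alpha> + - (1/2)) * D * mat_powr X (- (1/2) + (1 - \<alpha>))"
    unfolding E_def using D Xp mat_powr_mult[OF Xp, of "- (1/2)" "1 - \<alpha>"]
    by (simp add: mat_assoc mat_powr_mult_assoc[OF Xp])
  finally show ?thesis unfolding D_def by simp
qed

text \<open>The means of \<open>A\<close> and \<open>B\<close> with \<open>s(A) \<ge> s(B)\<close> depend only on what \<open>A\<close> does on its support, so \<open>A\<close>
  may be replaced by the invertible \<open>fill A\<close>.\<close>

definition fill :: "complex mat \<Rightarrow> complex mat" where
  "fill A = mat_fun (\<lambda>x. if x = 0 then 1 else x) A"

lemma fill_pd: "A \<in> psd_mats n \<Longrightarrow> fill A \<in> pd_mats n"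
  unfolding fill_def using psd_spectrum[of A n]
  by (intro mat_fun_pd[OF psd_herm]) (auto simp: less_le)

lemma mat_log_fill: "A \<in> psd_mats n \<Longrightarrow> mat_log (fill A) = mat_log A"
  unfolding mat_log_def fill_def mat_fun_comp[OF psd_herm]
  by (intro mat_fun_cong[OF psd_herm]) auto

lemma fill_mat_powr: "A \<in> psd_mats n \<Longrightarrow> mat_powr (fill A) r = fill (mat_powr A r)"
  unfolding mat_powr_psd_eq[OF pd_imp_psd[OF fill_pd]] mat_powr_psd_eq
  unfolding fill_def mat_fun_comp[OF psd_herm]
  by (intro mat_fun_cong[OF psd_herm]) auto

section \<open>Filling the kernel leaves the means unchanged\<close>

lemma supported_right:
  assumes "X \<in> psd_mats n" "Z \<in> herm_mats n" "mat_powr X 0 * Z = Z"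
  shows "Z * mat_powr X 0 = Z"
proof -
  have "Z = mat_adjoint (mat_powr X 0 * Z)" using assms by (simp add: herm_adjoint)
  also have "\<dots> = Z * mat_powr X 0"
    using assms(1,2) by (simp add: mat_adjoint_times herm_adjoint[OF mat_powr_herm] herm_adjoint)
  finally show ?thesis ..
qed

lemma supported_mat_powr:
  assumes "X \<in> psd_mats n" "W \<in> psd_mats n" "mat_powr X 0 * W = W"
  shows "mat_powr X 0 * mat_powr W s = mat_powr W s"
proof -
  have "mat_powr W s = W * mat_powr W (s - 1)" using mat_powr_mult[OF assms(2), of 1 "s - 1"] assms(2) by simp
  then show ?thesis using assms mat_assoc[of "mat_powr X 0" W "mat_powr W (s - 1)"] by simp
qed

text \<open>Multiplication by the support projection turns a power of \<open>fill X\<close> into the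
  same power of \<open>X\<close>, and \<open>Z\<close> absorbs this projection on either
  side.\<close>

lemma fill_mult:
  assumes X: "X \<in> psd_mats n" and Z: "Z \<in> herm_mats n" "mat_powr X 0 * Z = Z"
  shows "mat_powr (fill X) r * Z = mat_powr X r * Z" "Z * mat_powr (fill X) r = Z * mat_powr X r"
proof -
  have Xh: "X \<in> herm_mats n" using X by simp
  note Fp = pd_imp_psd[OF fill_pd[OF X]]
  have F: "mat_powr (fill X) r = mat_fun (\<lambda>x. (if x = 0 then 1 else x) powr r) X"
    unfolding mat_powr_psd_eq[OF Fp] unfolding fill_def mat_fun_comp[OF Xh] ..
  have 1: "mat_powr (fill X) r * mat_powr X 0 = mat_powr X r" "mat_powr X 0 * mat_powr (fill X) r = mat_powr X r"
    unfolding F mat_powr_psd_eq[OF X] mat_fun_mult[OF Xh] by (intro mat_fun_cong[OF Xh]; simp)+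
  have "mat_powr (fill X) r * Z = mat_powr (fill X) r * (mat_powr X 0 * Z)" using Z by simp
  then show "mat_powr (fill X) r * Z = mat_powr X r * Z"
    using mat_assoc[of "mat_powr (fill X) r" "mat_powr X 0" Z] 1 X Z Fp by simp
  have "Z * mat_powr (fill X) r = Z * mat_powr X 0 * mat_powr (fill X) r"
    using supported_right[OF X Z] by simp
  then show "Z * mat_powr (fill X) r = Z * mat_powr X r"
    using mat_assoc[of Z "mat_powr X 0" "mat_powr (fill X) r"] 1 X Z Fp by simp
qed

lemma fill_sandwich:
  assumes X: "X \<in> psd_mats n" and Z: "Z \<in> herm_mats n" "mat_powr X 0 * Z = Z"
  shows "mat_powr (fill X) r * Z * mat_powr (fill X) r = mat_powr X r * Z * mat_powr X r"
  using fill_mult[OF assms, of r] mat_assoc[of "mat_powr X r" Z "mat_powr (fill X) r"]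
    mat_assoc[of "mat_powr X r" Z "mat_powr X r"] X Z pd_imp_psd[OF fill_pd[OF X]] by simp

lemma supported_sandwich:
  assumes "X \<in> psd_mats n" "Z \<in> carrier_mat n n"
  shows "mat_powr X 0 * (mat_powr X r * Z * mat_powr X r) = mat_powr X r * Z * mat_powr X r"
  using assms by (simp add: mat_assoc mat_powr_mult_assoc)

lemma geo_mean_fill:
  assumes X: "X \<in> psd_mats n" and Y: "Y \<in> psd_mats n" and s: "mat_powr X 0 * Y = Y"
  shows "geo_mean \<alpha> (fill X) Y = geo_mean \<alpha> X Y"
proof -
  define W where "W = mat_powr X (- 1/2) * Y * mat_powr X (- 1/2)"
  have W: "W \<in> psd_mats n" unfolding W_def using X Y by (intro psd_congruence') auto
  have "mat_powr X 0 * W = W" unfolding W_def using X Y by (intro supported_sandwich) auto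
  then have "mat_powr X 0 * mat_powr W \<alpha> = mat_powr W \<alpha>" by (rule supported_mat_powr[OF X W])
  then show ?thesis
    unfolding geo_mean_def fill_sandwich[OF X psd_herm[OF Y] s] W_def[symmetric]
    by (intro fill_sandwich[OF X mat_powr_herm[OF W]])
qed

lemma SGt_core_fill:
  assumes X: "X \<in> psd_mats n" and Y: "Y \<in> psd_mats n" and s: "mat_powr X 0 * Y = Y"
  shows "SGt_core \<alpha> (fill X) Y = SGt_core \<alpha> X Y"
proof -
  have Xi: "mat_powr X (- 1) \<in> psd_mats n" using X by simp
  define E where "E = geo_mean \<alpha> (mat_powr X (- 1)) Y"
  have E: "E \<in> psd_mats n" unfolding E_def by (rule geo_mean_psd[OF Xi Y])
  have Ce: "mat_powr E (1/2) \<in> herm_mats n" using E by simp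
  have "mat_powr X 0 * E = E"
    unfolding E_def geo_mean_inverse[OF X] using X Y
    by (intro supported_sandwich psd_carrier[OF mat_powr_psd] psd_congruence') auto
  then have C: "mat_powr X 0 * mat_powr E (1/2) = mat_powr E (1/2)" by (rule supported_mat_powr[OF X E])
  have "mat_powr (mat_powr X (- 1)) 0 * Y = Y" using s by (simp add: mat_powr_powr[OF X])
  then have "geo_mean \<alpha> (mat_powr (fill X) (- 1)) Y = E"
    unfolding fill_mat_powr[OF X] E_def by (rule geo_mean_fill[OF Xi Y])
  then show ?thesis
    unfolding SGt_core_def Let_def using fill_mult(2)[OF X Ce C] by (simp add: E_def)
qed

lemma weighted_LE_fill: "X \<in> psd_mats n \<Longrightarrow> weighted_LE a b (fill X) Y = weighted_LE a b X Y"
  by (simp add: weighted_LE_def mat_log_fill)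

section \<open>Majorization for an invertible first argument\<close>

lemma weighted_LE_geo_mean_pd:
  assumes "X \<in> pd_mats n" "Y \<in> psd_mats n" "1 \<le> \<alpha>"
  shows "log_maj n (weighted_LE (1 - \<alpha>) \<alpha> X Y) (geo_mean \<alpha> X Y)"
  using weighted_LE_log_maj[OF assms, of "1 - \<alpha>" "1/2" "- 1/2"] by (simp add: geo_mean_def)

lemma weighted_LE_SGt_core_pd:
  assumes X: "X \<in> pd_mats n" and Y: "Y \<in> psd_mats n" and \<alpha>: "1 \<le> \<alpha>"
  shows "log_maj n (weighted_LE (1 - \<alpha>) \<alpha> X Y) (SGt_core \<alpha> X Y)"
  unfolding log_maj_eigvals_cong[OF eigvals_SGt_core[OF X Y]]
  using weighted_LE_log_maj[OF assms, of "1 - \<alpha>" "- 1/2" "\<alpha> - 1/2"] by simp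

text \<open>The mean is the power 1 - \<alpha> of the projected exponential \<open>L\<close> with
  weights 1 and t. \<open>L\<close> is log-majorized by \<open>S\<close>, and
  \<open>prod_eigvals_sandwiched\<close> compares \<open>S\<close> with the power 1/(1 - \<alpha>)
  of \<open>R\<close>. At \<alpha> = 1/2, where the exponent used in Furuta's inequality
  degenerates, t = 1 and \<open>R\<close> is the square root of \<open>S\<close>.\<close>

lemma weighted_LE_SGt_core_pd_small:
  assumes X: "X \<in> pd_mats n" and Y: "Y \<in> psd_mats n" and \<alpha>: "0 < \<alpha>" "\<alpha> \<le> 1/2"
  shows "log_maj n (weighted_LE (1 - \<alpha>) \<alpha> X Y) (SGt_core \<alpha> X Y)"
proof -
  note Xp = pd_imp_psd[OF X]
  define t where "t = \<alpha> / (1 - \<alpha>)"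
  have t: "t \<noteq> 0" "(1 - \<alpha>) * t = \<alpha>" using \<alpha> by (auto simp: t_def)
  define D where "D = mat_powr X (1/2) * Y * mat_powr X (1/2)"
  have D: "D \<in> psd_mats n" unfolding D_def using Xp Y by (intro psd_congruence') auto
  define R where "R = mat_powr X (1/2 - \<alpha>) * mat_powr D \<alpha> * mat_powr X (1/2 - \<alpha>)"
  have R: "R \<in> psd_mats n" unfolding R_def using Xp D by (intro psd_congruence') auto
  define S where "S = mat_powr X (1/2) * mat_powr Y t * mat_powr X (1/2)"
  have S: "S \<in> psd_mats n" unfolding S_def using Xp Y by (intro psd_congruence') auto
  define L where "L = weighted_LE 1 t X Y"
  have L: "L \<in> psd_mats n" unfolding L_def by (rule weighted_LE_psd[OF Xp Y])
  have Leq: "mat_powr L (1 - \<alpha>) = weighted_LE (1 - \<alpha>) \<alpha> X Y"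
    unfolding L_def weighted_LE_powr[OF Xp Y] by (simp add: t)
  \<comment> \<open>The case b = 1: the log-majorization behind the Golden-Thompson
    inequality.\<close>
  have "log_maj n (weighted_LE 1 1 X (mat_powr Y t)) S"
    using weighted_LE_log_maj[OF X mat_powr_psd[OF Y, of t], of 1 1 "- 1/2" 0] S Xp Y
    by (simp add: S_def mat_powr_0[OF X] left_mult_one_mat[of _ n n] right_mult_one_mat[of _ n n])
  moreover have "weighted_LE 1 1 X (mat_powr Y t) = L"
    using weighted_LE_mat_powr[OF Xp Y, of 1 t 1 1] t Xp by (simp add: L_def)
  ultimately have LS: "log_maj n L S" by simp
  have "log_maj n (weighted_LE (1 - \<alpha>) \<alpha> X Y) R"
  proof (cases "\<alpha> = 1/2")
    case True
    have "log_maj n (mat_powr L (1/2)) (mat_powr S (1/2))" by (rule log_maj_mat_powr[OF L S _ LS]) simp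
    moreover have "t = 1" using True by (simp add: t_def)
    then have "S = D" unfolding S_def D_def using Y by simp
    moreover have "R = mat_powr D (1/2)"
      unfolding R_def True using D by (simp add: mat_powr_0[OF X] left_mult_one_mat[of _ n n] right_mult_one_mat[of _ n n])
    moreover have h: "1 - \<alpha> = 1/2" using True by simp
    have "mat_powr L (1/2) = weighted_LE (1 - \<alpha>) \<alpha> X Y" using Leq unfolding h .
    ultimately show ?thesis by simp
  next
    case False
    then have a: "\<alpha> < 1/2" "0 < 1 - \<alpha>" using \<alpha> by auto
    have weak: "(\<Prod>i<k. eigvals_desc (weighted_LE (1 - \<alpha>) \<alpha> X Y) ! i) \<le> (\<Prod>i<k. eigvals_desc R ! i)" if k: "k \<le> n" for k
    proof -
      have nn: "0 \<le> (\<Prod>i<k. eigvals_desc Z ! i)" if "Z \<in> psd_mats n" for Z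
        using eigvals_desc_nonneg[OF that] k by (intro prod_nonneg) auto
      have "(\<Prod>i<k. eigvals_desc L ! i) \<le> (\<Prod>i<k. eigvals_desc S ! i)"
        using LS k by (cases "k = 0") (auto simp: log_maj_def)
      also have "\<dots> \<le> (\<Prod>i<k. eigvals_desc R ! i) powr (1 / (1 - \<alpha>))"
        unfolding S_def R_def D_def t_def by (rule prod_eigvals_sandwiched[OF X Y \<alpha>(1) a(1) k])
      finally have "(\<Prod>i<k. eigvals_desc L ! i) powr (1 - \<alpha>) \<le> ((\<Prod>i<k. eigvals_desc R ! i) powr (1 / (1 - \<alpha>))) powr (1 - \<alpha>)"
        using nn[OF L] a by (intro powr_mono2) auto
      also have "\<dots> = (\<Prod>i<k. eigvals_desc R ! i)" using nn[OF R] a by (simp add: powr_powr)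
      also have "(\<Prod>i<k. eigvals_desc L ! i) powr (1 - \<alpha>) = (\<Prod>i<k. eigvals_desc (weighted_LE (1 - \<alpha>) \<alpha> X Y) ! i)"
        unfolding Leq[symmetric] using prod_eigvals_mat_powr[OF L a(2) k] by simp
      finally show ?thesis .
    qed
    have x: "0 < real_det X" and y: "0 \<le> real_det Y" using X Y by (simp_all add: real_det_pos real_det_nonneg)
    have Yt: "mat_powr Y t \<in> herm_mats n" and Da: "mat_powr D \<alpha> \<in> herm_mats n" using Y D by auto
    \<comment> \<open>Equality at k = n: both full products equal det(X)^(1-\<alpha>)
      det(Y)^\<alpha>.\<close>
    have "(\<Prod>i<n. eigvals_desc (weighted_LE (1 - \<alpha>) \<alpha> X Y) ! i) = (\<Prod>i<n. eigvals_desc S ! i) powr (1 - \<alpha>)"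
      unfolding Leq[symmetric] using prod_eigvals_mat_powr[OF L a(2), of n] LS by (simp add: log_maj_def)
    also have "\<dots> = (real_det X powr (1/2) * real_det Y powr t * real_det X powr (1/2)) powr (1 - \<alpha>)"
      unfolding real_det_psd[OF S, symmetric]
      unfolding S_def real_det_mult3[OF mat_powr_herm[OF Xp] Yt mat_powr_herm[OF Xp]] real_det_mat_powr[OF Xp] real_det_mat_powr[OF Y] ..
    also have "\<dots> = real_det X powr (1 - \<alpha>) * real_det Y powr \<alpha>"
    proof -
      have *: "(real_det X powr (1/2) * real_det Y powr t * real_det X powr (1/2)) = real_det X * real_det Y powr t"
        using x by (simp add: powr_half_sqrt)
      have "t * (1 - \<alpha>) = \<alpha>" using t by (simp add: mult.commute)
      then show ?thesis unfolding * by (simp add: powr_mult powr_powr)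
    qed
    also have "\<dots> = real_det X powr (1/2 - \<alpha>) * (real_det X powr (1/2) * real_det Y * real_det X powr (1/2)) powr \<alpha> * real_det X powr (1/2 - \<alpha>)"
    proof -
      have e: "1 - \<alpha> = (1/2 - \<alpha>) + \<alpha> + (1/2 - \<alpha>)" by simp
      have h1: "real_det X powr (1 - \<alpha>) = real_det X powr (1/2 - \<alpha>) * real_det X powr \<alpha> * real_det X powr (1/2 - \<alpha>)"
        unfolding powr_add[symmetric] using arg_cong[OF e, of "\<lambda>z. real_det X powr z"] .
      have h2: "real_det X powr (1/2) * real_det Y * real_det X powr (1/2) = real_det X * real_det Y"
        using x by (simp add: powr_half_sqrt)
      show ?thesis unfolding h2 h1 by (simp add: powr_mult)
    qed
    also have "\<dots> = (\<Prod>i<n. eigvals_desc R ! i)"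
      unfolding real_det_psd[OF R, symmetric]
      unfolding R_def real_det_mult3[OF mat_powr_herm[OF Xp] Da mat_powr_herm[OF Xp]] real_det_mat_powr[OF Xp] real_det_mat_powr[OF D]
      unfolding D_def real_det_mult3[OF mat_powr_herm[OF Xp] psd_herm[OF Y] mat_powr_herm[OF Xp]] real_det_mat_powr[OF Xp] ..
    finally show ?thesis unfolding log_maj_def using weak by simp
  qed
  then show ?thesis unfolding log_maj_eigvals_cong[OF eigvals_SGt_core[OF X Y]] R_def D_def .
qed

section \<open>Passing to general exponents and supports\<close>

lemma exponent_support:
  assumes A: "A \<in> psd_mats n" and B: "B \<in> psd_mats n" and le: "loewner_le (supp_proj B) (supp_proj A)"
  shows "mat_powr (mat_powr A p) 0 * mat_powr B p = mat_powr B p"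
proof -
  have "mat_powr A 0 * mat_powr B p = mat_powr A 0 * (mat_powr B 0 * mat_powr B p)"
    using B by (simp add: mat_powr_mult)
  also have "\<dots> = mat_powr A 0 * mat_powr B 0 * mat_powr B p"
    using mat_assoc[of "mat_powr A 0" "mat_powr B 0" "mat_powr B p"] A B by simp
  also have "\<dots> = mat_powr B p" using supp_absorb(1)[OF A B le] B by (simp add: mat_powr_mult)
  finally show ?thesis by (simp add: mat_powr_powr[OF A])
qed

text \<open>\<open>fill\<close> makes A^p invertible without changing either side, and the outer
  power 1/p preserves log-majorization.\<close>

theorem LE_mean_log_maj_G_mean:
  assumes A: "A \<in> psd_mats n" and B: "B \<in> psd_mats n" and le: "loewner_le (supp_proj B) (supp_proj A)"
    and \<alpha>: "1 \<le> \<alpha>" and p: "0 < p"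
  shows "log_maj n (LE_mean \<alpha> A B) (G_mean \<alpha> p A B)"
proof -
  have X: "mat_powr A p \<in> psd_mats n" and Y: "mat_powr B p \<in> psd_mats n" using A B by auto
  have "log_maj n (weighted_LE (1 - \<alpha>) \<alpha> (mat_powr A p) (mat_powr B p)) (geo_mean \<alpha> (mat_powr A p) (mat_powr B p))"
    using weighted_LE_geo_mean_pd[OF fill_pd[OF X] Y \<alpha>]
    unfolding weighted_LE_fill[OF X] geo_mean_fill[OF X Y exponent_support[OF A B le]] .
  then show ?thesis
    unfolding LE_mean_eq[OF A B le] weighted_LE_exponent[OF A B less_imp_neq[OF p, symmetric]] G_mean_def
    using p by (intro log_maj_mat_powr weighted_LE_psd[OF X Y] geo_mean_psd[OF X Y]) auto
qed

theorem LE_mean_log_maj_SGt_mean: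
  assumes A: "A \<in> psd_mats n" and B: "B \<in> psd_mats n" and le: "loewner_le (supp_proj B) (supp_proj A)"
    and \<alpha>: "0 < \<alpha> \<and> \<alpha> \<le> 1/2 \<or> 1 \<le> \<alpha>" and p: "0 < p"
  shows "log_maj n (LE_mean \<alpha> A B) (SGt_mean \<alpha> p A B)"
proof -
  have X: "mat_powr A p \<in> psd_mats n" and Y: "mat_powr B p \<in> psd_mats n" using A B by auto
  have "log_maj n (weighted_LE (1 - \<alpha>) \<alpha> (fill (mat_powr A p)) (mat_powr B p)) (SGt_core \<alpha> (fill (mat_powr A p)) (mat_powr B p))"
    using \<alpha> weighted_LE_SGt_core_pd[OF fill_pd[OF X] Y] weighted_LE_SGt_core_pd_small[OF fill_pd[OF X] Y] by blast
  then have "log_maj n (weighted_LE (1 - \<alpha>) \<alpha> (mat_powr A p) (mat_powr B p)) (SGt_core \<alpha> (mat_powr A p) (mat_powr B p))"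
    unfolding weighted_LE_fill[OF X] SGt_core_fill[OF X Y exponent_support[OF A B le]] .
  then show ?thesis
    unfolding LE_mean_eq[OF A B le] weighted_LE_exponent[OF A B less_imp_neq[OF p, symmetric]] SGt_mean_eq[OF A]
    using p by (intro log_maj_mat_powr weighted_LE_psd[OF X Y] SGt_core_psd[OF X Y]) auto
qed

section \<open>Counterexamples\<close>

text \<open>The analogue of \<open>SGt_core\<close>: the exponent p is absorbed into the
  arguments.\<close>

definition SG_core :: "real \<Rightarrow> complex mat \<Rightarrow> complex mat \<Rightarrow> complex mat" where
  "SG_core \<alpha> X Y = (let C = mat_powr (geo_mean (1/2) (mat_powr X (- 1)) Y) \<alpha> in C * X * C)"

lemma SG_core_psd:
  "X \<in> psd_mats n \<Longrightarrow> Y \<in> psd_mats n \<Longrightarrow> SG_core \<alpha> X Y \<in> psd_mats n"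
  unfolding SG_core_def Let_def
  by (intro psd_congruence' mat_powr_psd mat_powr_herm geo_mean_psd)

lemma SG_mean_eq:
  assumes "A \<in> psd_mats n"
  shows "SG_mean \<alpha> p A B = mat_powr (SG_core \<alpha> (mat_powr A p) (mat_powr B p)) (1/p)"
  unfolding SG_mean_def SG_core_def Let_def mat_powr_powr[OF assms] by simp

lemma log_maj_mat_powr_iff:
  assumes "X \<in> psd_mats n" "Y \<in> psd_mats n" "0 < r"
  shows "log_maj n (mat_powr X r) (mat_powr Y r) \<longleftrightarrow> log_maj n X Y"
  using log_maj_mat_powr[OF assms] log_maj_mat_powr[of "mat_powr X r" n "mat_powr Y r" "1/r"] assms
  by (auto simp: mat_powr_powr)

lemma LE_mean_pd:
  assumes "A \<in> pd_mats n" "B \<in> pd_mats n" "p \<noteq> 0"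
  shows "LE_mean \<alpha> A B = mat_powr (weighted_LE (1 - \<alpha>) \<alpha> (mat_powr A p) (mat_powr B p)) (1/p)"
proof -
  have Ap: "A \<in> psd_mats n" and Bp: "B \<in> psd_mats n" using assms by auto
  have "0\<^sub>m n n = complex_of_real 0 \<cdot>\<^sub>m A" by (intro eq_matI) (use Ap in auto)
  then have zero: "0\<^sub>m n n \<in> psd_mats n" using mat_powr_smult(2)[OF Ap, of 0] by simp
  have diff: "1\<^sub>m n - 1\<^sub>m n = (0\<^sub>m n n :: complex mat)" by (intro eq_matI) auto
  have supp: "supp_proj A = 1\<^sub>m n" "supp_proj B = 1\<^sub>m n"
    using supp_proj_eq[OF Ap] supp_proj_eq[OF Bp] mat_powr_0[OF assms(1)] mat_powr_0[OF assms(2)] by simp_all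
  have "loewner_le (supp_proj B) (supp_proj A)"
    unfolding loewner_le_def supp diff using zero by simp
  then show ?thesis using LE_mean_eq[OF Ap Bp] weighted_LE_exponent[OF Ap Bp assms(3)] by simp
qed

text \<open>With A = X^(1/p) and B = Y^(1/p) the exponent is absorbed, so a counterexample for p = 1
  provides one for every p.\<close>

lemma counterexample_exponent:
  assumes X: "X \<in> pd_mats n" and Y: "Y \<in> pd_mats n" and p: "0 < p"
  shows "\<exists>A \<in> pd_mats n. \<exists>B \<in> pd_mats n. \<forall>\<alpha>.
    LE_mean \<alpha> A B = mat_powr (weighted_LE (1 - \<alpha>) \<alpha> X Y) (1/p) \<and>
    SG_mean \<alpha> p A B = mat_powr (SG_core \<alpha> X Y) (1/p) \<and>
    SGt_mean \<alpha> p A B = mat_powr (SGt_core \<alpha> X Y) (1/p)"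
proof -
  have A: "mat_powr X (1/p) \<in> pd_mats n" and B: "mat_powr Y (1/p) \<in> pd_mats n" using X Y by auto
  have e: "mat_powr (mat_powr X (1/p)) p = X" "mat_powr (mat_powr Y (1/p)) p = Y"
    using X Y p by (simp_all add: mat_powr_powr[OF pd_imp_psd])
  have "LE_mean \<alpha> (mat_powr X (1/p)) (mat_powr Y (1/p)) = mat_powr (weighted_LE (1 - \<alpha>) \<alpha> X Y) (1/p)" for \<alpha>
    using LE_mean_pd[OF A B, of p \<alpha>] p unfolding e by simp
  moreover have "SG_mean \<alpha> p (mat_powr X (1/p)) (mat_powr Y (1/p)) = mat_powr (SG_core \<alpha> X Y) (1/p)" for \<alpha>
    using SG_mean_eq[OF pd_imp_psd[OF A], of \<alpha> p "mat_powr Y (1/p)"] unfolding e .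
  moreover have "SGt_mean \<alpha> p (mat_powr X (1/p)) (mat_powr Y (1/p)) = mat_powr (SGt_core \<alpha> X Y) (1/p)" for \<alpha>
    using SGt_mean_eq[OF pd_imp_psd[OF A], of \<alpha> p "mat_powr Y (1/p)"] unfolding e .
  ultimately show ?thesis using A B by blast
qed

section \<open>Lower bounds for the largest eigenvalue\<close>

lemma qform_unit_vec:
  assumes "M \<in> carrier_mat n n" "i < n"
  shows "qform M (unit_vec n i) = Re (M $$ (i, i))"
proof -
  have "conjugate (unit_vec n i) = (unit_vec n i :: complex vec)"
    by (intro eq_vecI) (use assms in auto)
  then show ?thesis
    using assms unfolding qform_def by (simp add: mult_mat_vec_index_sum[of _ n n] scalar_prod_right_unit[of _ n])
qed

lemma max_eigval_ge_qform:
  assumes "M \<in> herm_mats n" "v \<in> carrier_vec n"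
  shows "qform M v \<le> eigvals_desc M ! 0 * Re (v \<bullet>c v)"
  using qleD[OF qle_max_eigval[OF assms(1)] assms(2)] assms(2) by (simp add: qform_smult[of _ n] qform_one)

lemma max_eigval_ge_diag:
  assumes "M \<in> herm_mats n" "i < n"
  shows "Re (M $$ (i, i)) \<le> eigvals_desc M ! 0"
proof -
  have "Re (unit_vec n i \<bullet>c (unit_vec n i :: complex vec)) = 1"
    using qform_unit_vec[of "1\<^sub>m n" n i] assms(2) by (simp add: qform_one)
  then show ?thesis
    using max_eigval_ge_qform[OF assms(1), of "unit_vec n i"] qform_unit_vec[of M n i] assms by simp
qed

lemma sum_lessThan_2: "(\<Sum>i<2. f i) = f 0 + f (1::nat)"
  by (simp add: numeral_2_eq_2)

text \<open>The test pair is \<open>X = diag(1, e\<^bsup>-s\<^esup>)\<close> and \<open>Y = exp (- u J)\<close>, where \<open>J\<close> is the projection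
  onto the line orthogonal to \<open>(1, 1)\<close>. For large \<open>u\<close> the matrix \<open>Y\<close> is nearly of rank one, and
  there the means differ by arbitrarily large factors as \<open>s\<close> grows.\<close>

definition proj_J :: "complex mat" where
  "proj_J = mat 2 2 (\<lambda>(i, j). if i = j then 1/2 else - 1/2)"

definition test_X :: "real \<Rightarrow> complex mat" where
  "test_X s = rdiag 2 (\<lambda>i. if i = 0 then 1 else exp (- s))"

definition test_Y :: "real \<Rightarrow> complex mat" where
  "test_Y u = mat_exp (complex_of_real (- u) \<cdot>\<^sub>m proj_J)"

section \<open>The test pair\<close>

lemma proj_J_herm [simp]: "proj_J \<in> herm_mats 2"
  by (rule hermI) (auto simp: proj_J_def intro!: eq_matI)

lemma proj_J_idem: "proj_J * proj_J = proj_J"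
proof (rule eq_matI)
  fix i j assume "i < dim_row proj_J" "j < dim_col proj_J"
  then have ij: "i < 2" "j < 2" by (auto simp: proj_J_def)
  have "(proj_J * proj_J) $$ (i, j) = (\<Sum>l<2. proj_J $$ (i, l) * proj_J $$ (l, j))"
    by (rule mult_mat_index_sum[OF _ _ ij]) (simp_all add: proj_J_def)
  also have "\<dots> = proj_J $$ (i, j)"
    using ij by (auto simp: proj_J_def sum_lessThan_2 less_2_cases_iff)
  finally show "(proj_J * proj_J) $$ (i, j) = proj_J $$ (i, j)" .
qed (auto simp: proj_J_def)

lemma qform_proj_J:
  assumes "v \<in> carrier_vec 2"
  shows "qform proj_J v = (cmod (v $ 0 - v $ 1))\<^sup>2 / 2"
proof -
  have "proj_J *\<^sub>v v \<in> carrier_vec 2" using assms herm_carrier[OF proj_J_herm] by simp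
  then have "(proj_J *\<^sub>v v) \<bullet>c v = (\<Sum>i<2. (\<Sum>j<2. proj_J $$ (i, j) * v $ j) * cnj (v $ i))"
    using assms by (simp add: cscalar_prod_sum[of _ 2] mult_mat_vec_index_sum[OF herm_carrier[OF proj_J_herm]]
        del: index_mult_mat_vec)
  also have "\<dots> = (v $ 0 - v $ 1) * cnj (v $ 0 - v $ 1) / 2"
    by (simp add: sum_lessThan_2 proj_J_def algebra_simps)
  also have "\<dots> = complex_of_real ((cmod (v $ 0 - v $ 1))\<^sup>2 / 2)"
    by (simp only: of_real_divide complex_norm_square of_real_numeral)
  finally show ?thesis unfolding qform_def by (simp only: Re_complex_of_real)
qed

lemma idem_spectrum:
  assumes "J \<in> herm_mats n" "J * J = J" "x \<in> real_spectrum J"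
  shows "x = 0 \<or> x = 1"
proof -
  obtain v where v: "v \<in> carrier_vec n" "v \<noteq> 0\<^sub>v n" "J *\<^sub>v v = complex_of_real x \<cdot>\<^sub>v v"
    by (rule real_spectrumE[OF assms(3) herm_dim(1)[OF assms(1)]])
  have "Re ((J *\<^sub>v v) \<bullet>c (J *\<^sub>v v)) = qform J v" using herm_norm_qform[OF assms(1) v(1)] assms(2) by simp
  moreover have "Re ((J *\<^sub>v v) \<bullet>c (J *\<^sub>v v)) = x * x * Re (v \<bullet>c v)"
    unfolding v(3) using v(1) by (simp add: conjugate_smult_vec)
  moreover have "qform J v = x * Re (v \<bullet>c v)" using eigen_qform[OF v(3,1)] .
  ultimately show ?thesis using cscalar_prod_self_pos[OF v(1,2)] by auto
qed

text \<open>The spectrum of \<open>proj_J\<close> lies in {0, 1}, where exp(-u x) agrees with an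
  affine function of x.\<close>

lemma test_Y_eq:
  "test_Y u = 1\<^sub>m 2 + complex_of_real (exp (- u) - 1) \<cdot>\<^sub>m proj_J"
proof -
  have "test_Y u = mat_fun (\<lambda>x. exp (- u * x)) proj_J"
    unfolding test_Y_def mat_exp_def smult_eq_mat_fun[OF proj_J_herm] mat_fun_comp[OF proj_J_herm] ..
  also have "\<dots> = mat_fun (\<lambda>x. 1 + (exp (- u) - 1) * x) proj_J"
  proof (rule mat_fun_cong[OF proj_J_herm])
    fix x assume "x \<in> real_spectrum proj_J"
    then show "exp (- u * x) = 1 + (exp (- u) - 1) * x"
      using idem_spectrum[OF proj_J_herm proj_J_idem, of x] by auto
  qed
  finally show ?thesis
    unfolding mat_fun_add[OF proj_J_herm, symmetric] mat_fun_const_1[OF proj_J_herm]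
      mat_fun_smult[OF proj_J_herm, symmetric] mat_fun_id[OF proj_J_herm] .
qed

lemma test_Y_pd [simp]: "test_Y u \<in> pd_mats 2"
  unfolding test_Y_def by (intro mat_exp_pd herm_smult proj_J_herm)

lemma mat_fun_rdiag: "mat_fun f (rdiag n d) = rdiag n (\<lambda>i. f (d i))"
  using mat_fun_eqI[OF unitary_one, of "rdiag n d" n d f] by simp

lemma test_X_pd [simp]: "test_X s \<in> pd_mats 2"
proof -
  have "test_X s = mat_exp (rdiag 2 (\<lambda>i. if i = 0 then 0 else - s))"
    unfolding test_X_def mat_exp_def mat_fun_rdiag by (intro eq_matI) (auto simp: mat_diag_def)
  then show ?thesis by simp
qed

lemma test_X_powr: "mat_powr (test_X s) r = rdiag 2 (\<lambda>i. if i = 0 then 1 else exp (- s * r))"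
  unfolding mat_powr_psd_eq[OF pd_imp_psd[OF test_X_pd]] unfolding test_X_def mat_fun_rdiag
  by (intro eq_matI) (auto simp: mat_diag_def powr_def mult.commute)

lemma test_X_powr_unit_vec:
  assumes "i < 2"
  shows "mat_powr (test_X s) r *\<^sub>v unit_vec 2 i =
    complex_of_real (if i = 0 then 1 else exp (- s * r)) \<cdot>\<^sub>v unit_vec 2 i"
  unfolding test_X_powr
  by (intro eq_vecI) (use assms in \<open>auto simp: mat_diag_mult_vec[of _ 2] less_2_cases_iff simp del: index_mult_mat_vec\<close>)

lemma qform_smult_vec:
  "M \<in> carrier_mat n n \<Longrightarrow> v \<in> carrier_vec n \<Longrightarrow>
     qform M (complex_of_real c \<cdot>\<^sub>v v) = c * c * qform M v"
  unfolding qform_def by (simp add: mult_mat_vec[of _ n n] conjugate_smult_vec)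

lemma sandwich_diag:
  assumes M: "M \<in> carrier_mat 2 2" and i: "i < 2"
  shows "Re ((mat_powr (test_X s) r * M * mat_powr (test_X s) r) $$ (i, i)) =
    (if i = 0 then 1 else exp (- s * r) * exp (- s * r)) * Re (M $$ (i, i))"
proof -
  have Xr: "mat_powr (test_X s) r \<in> herm_mats 2" by simp
  have "Re ((mat_powr (test_X s) r * M * mat_powr (test_X s) r) $$ (i, i)) = qform M (mat_powr (test_X s) r *\<^sub>v unit_vec 2 i)"
    using qform_unit_vec[of "mat_powr (test_X s) r * M * mat_powr (test_X s) r" 2 i]
      qform_congruence[OF M herm_carrier[OF Xr], of "unit_vec 2 i"] M i herm_adjoint[OF Xr] by simp
  then show ?thesis
    using M i by (simp add: test_X_powr_unit_vec qform_smult_vec[of _ 2] qform_unit_vec[of _ 2])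
qed

lemma test_Y_diag:
  assumes "i < 2"
  shows "Re (test_Y u $$ (i, i)) = (1 + exp (- u)) / 2"
  using assms unfolding test_Y_eq by (simp add: proj_J_def field_simps)

lemma test_Y_le_one: "0 \<le> u \<Longrightarrow> qle 2 (test_Y u) (1\<^sub>m 2)"
proof (rule qleI)
  fix v :: "complex vec" assume u: "0 \<le> u" and v: "v \<in> carrier_vec 2"
  have "(exp (- u) - 1) * qform proj_J v \<le> 0"
    using u by (intro mult_nonpos_nonneg) (auto simp: qform_proj_J[OF v])
  then show "qform (test_Y u) v \<le> qform (1\<^sub>m 2) v"
    unfolding test_Y_eq using v herm_carrier[OF proj_J_herm] qform_smult[of proj_J 2 v "exp (- u) - 1"]
      qform_add[of "1\<^sub>m 2" 2 "complex_of_real (exp (- u) - 1) \<cdot>\<^sub>m proj_J" v] by simp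
qed

lemma test_X_le_one: "0 \<le> s \<Longrightarrow> qle 2 (test_X s) (1\<^sub>m 2)"
  using qform_rdiag[of _ 2 "\<lambda>_. 1"]
  by (intro qleI) (auto simp: test_X_def qform_rdiag qform_one cscalar_prod_self_Re sum_lessThan_2 mult_left_le_one_le)

text \<open>The inner matrix of the geometric mean of X^-1 and Y; its powers enter both families of
  means.\<close>

definition test_D :: "real \<Rightarrow> real \<Rightarrow> complex mat" where
  "test_D s u = mat_powr (test_X s) (1/2) * test_Y u * mat_powr (test_X s) (1/2)"

lemma test_D_pd [simp]: "test_D s u \<in> pd_mats 2"
  unfolding test_D_def by (intro pd_congruence') auto

lemma test_D_diag:
  "Re (test_D s u $$ (0, 0)) = (1 + exp (- u)) / 2"
  "Re (test_D s u $$ (1, 1)) = exp (- s) * (1 + exp (- u)) / 2"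
  unfolding test_D_def using sandwich_diag[OF pd_carrier[OF test_Y_pd], of 0 s "1/2" u]
    sandwich_diag[OF pd_carrier[OF test_Y_pd], of 1 s "1/2" u]
  by (simp_all add: test_Y_diag exp_add[symmetric])

lemma test_D_le_one:
  assumes "0 \<le> s" "0 \<le> u"
  shows "qle 2 (test_D s u) (1\<^sub>m 2)"
proof -
  have "qle 2 (test_D s u) (mat_powr (test_X s) (1/2) * 1\<^sub>m 2 * mat_powr (test_X s) (1/2))"
    unfolding test_D_def using test_Y_le_one[OF assms(2)] by (intro qle_congruence_herm) auto
  also have "mat_powr (test_X s) (1/2) * 1\<^sub>m 2 * mat_powr (test_X s) (1/2) = test_X s"
    using pd_sandwich_powr[OF test_X_pd[of s], of "1/2" 0] mat_powr_0[OF test_X_pd]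
      mat_powr_pd_simps(6)[OF test_X_pd] by simp
  also have "qle 2 (test_X s) (1\<^sub>m 2)" by (rule test_X_le_one[OF assms(1)])
  finally show ?thesis .
qed

lemma qle_mat_powr_contraction:
  assumes "M \<in> psd_mats n" "qle n M (1\<^sub>m n)" "0 \<le> r" "r \<le> 1"
  shows "qle n M (mat_powr M r)"
proof -
  have Mh: "M \<in> herm_mats n" using assms by simp
  have "qle n (mat_fun (\<lambda>x. x) M) (mat_fun (\<lambda>x. x powr r) M)"
  proof (rule mat_fun_mono[OF Mh])
    fix x assume x: "x \<in> real_spectrum M"
    have "0 \<le> x" "x \<le> 1" using psd_spectrum[OF assms(1) x] qle_spectrum_le[OF Mh _ x, of 1] assms(2) by auto
    then show "x \<le> x powr r" using powr_mono'[of r 1 x] assms by simp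
  qed
  then show ?thesis unfolding mat_powr_psd_eq[OF assms(1)] using Mh by simp
qed

lemma qle_diag:
  "qle n M N \<Longrightarrow> M \<in> carrier_mat n n \<Longrightarrow> N \<in> carrier_mat n n \<Longrightarrow> i < n \<Longrightarrow> Re (M $$ (i, i)) \<le> Re (N $$ (i, i))"
  using qleD[of n M N "unit_vec n i"] by (simp add: qform_unit_vec)

text \<open>The exponent of the Log-Euclidean mean of the test pair, explicit because log X is
  diagonal and log Y is -u J.\<close>

definition test_L :: "real \<Rightarrow> real \<Rightarrow> real \<Rightarrow> complex mat" where
  "test_L \<alpha> s u = complex_of_real (1 - \<alpha>) \<cdot>\<^sub>m rdiag 2 (\<lambda>i. if i = 0 then 0 else - s)
     + complex_of_real \<alpha> \<cdot>\<^sub>m (complex_of_real (- u) \<cdot>\<^sub>m proj_J)"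

lemma test_L_herm: "test_L \<alpha> s u \<in> herm_mats 2"
  unfolding test_L_def by (intro herm_add herm_smult proj_J_herm herm_rdiag)

lemma test_LE: "weighted_LE (1 - \<alpha>) \<alpha> (test_X s) (test_Y u) = mat_exp (test_L \<alpha> s u)"
proof -
  have uJ: "complex_of_real (- u) \<cdot>\<^sub>m proj_J \<in> herm_mats 2" by (intro herm_smult proj_J_herm)
  have lX: "mat_log (test_X s) = rdiag 2 (\<lambda>i. if i = 0 then 0 else - s)"
    unfolding mat_log_def test_X_def mat_fun_rdiag by (intro eq_matI) (auto simp: mat_diag_def)
  have lY: "mat_log (test_Y u) = complex_of_real (- u) \<cdot>\<^sub>m proj_J"
    unfolding mat_log_def test_Y_def mat_exp_def mat_fun_comp[OF uJ]
    using mat_fun_cong[OF uJ, of "\<lambda>x. if exp x = 0 then 0 else ln (exp x)" "\<lambda>x. x"] mat_fun_id[OF uJ] by simp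
  have c: "mat_exp (test_L \<alpha> s u) \<in> carrier_mat 2 2" using test_L_herm by simp
  show ?thesis
    unfolding weighted_LE_def lX lY mat_powr_0[OF test_Y_pd]
    using c herm_carrier[OF uJ] left_mult_one_mat[of "rdiag 2 (\<lambda>i. if i = 0 then 0 else - s)" 2 2]
      right_mult_one_mat[of "rdiag 2 (\<lambda>i. if i = 0 then 0 else - s)" 2 2]
      left_mult_one_mat[OF herm_carrier[OF uJ]] right_mult_one_mat[OF herm_carrier[OF uJ]]
    by (simp add: test_L_def)
qed

section \<open>Largest eigenvalue of the Log-Euclidean mean of the test pair\<close>

lemma test_L_qform:
  assumes v: "v \<in> carrier_vec 2"
  shows "qform (test_L \<alpha> s u) v = - (1 - \<alpha>) * s * (cmod (v $ 1))\<^sup>2 - \<alpha> * u / 2 * (cmod (v $ 0 - v $ 1))\<^sup>2"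
proof -
  have c: "proj_J \<in> carrier_mat 2 2" using proj_J_herm by (rule herm_carrier)
  have "qform (test_L \<alpha> s u) v = (1 - \<alpha>) * qform (rdiag 2 (\<lambda>i. if i = 0 then 0 else - s)) v + \<alpha> * (- u * qform proj_J v)"
    unfolding test_L_def using v c qform_smult[OF c v, of "- u"]
      qform_smult[of "complex_of_real (- u) \<cdot>\<^sub>m proj_J" 2 v \<alpha>]
      qform_smult[of "rdiag 2 (\<lambda>i. if i = 0 then 0 else - s)" 2 v "1 - \<alpha>"]
      qform_add[of "complex_of_real (1 - \<alpha>) \<cdot>\<^sub>m rdiag 2 (\<lambda>i. if i = 0 then 0 else - s)" 2
        "complex_of_real \<alpha> \<cdot>\<^sub>m (complex_of_real (- u) \<cdot>\<^sub>m proj_J)" v] by simp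
  then show ?thesis using v by (simp add: qform_rdiag qform_proj_J sum_lessThan_2 algebra_simps)
qed

lemma max_eigval_exp:
  assumes "L \<in> herm_mats n" "0 < n"
  shows "eigvals_desc (mat_exp L) ! 0 = exp (eigvals_desc L ! 0)"
  unfolding mat_exp_def using assms eigvals_desc_mat_fun[OF assms(1), of exp] eigvals_desc_length[OF assms(1)] by simp

text \<open>The value of \<open>u\<close> makes the coefficient of |v0 - v1|^2 equal to h^2/2 with h
  = (1 - \<alpha>) s/2. This suffices to absorb h (|v0|^2 - |v1|^2) by completing a square, at the
  cost of 1 in the exponent whatever \<open>s\<close> is. The sign of h does not matter, so both
  sides of \<alpha> = 1 are covered.\<close>

lemma test_LE_upper:
  assumes "0 < \<alpha>" and u: "u = ((1 - \<alpha>) * s)\<^sup>2 / (4 * \<alpha>)"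
  shows "eigvals_desc (weighted_LE (1 - \<alpha>) \<alpha> (test_X s) (test_Y u)) ! 0 \<le> exp (1 - (1 - \<alpha>) * s / 2)"
proof -
  define h where "h = (1 - \<alpha>) * s / 2"
  have w: "\<alpha> * u / 2 = h\<^sup>2 / 2" using assms(1) unfolding u h_def by (simp add: power2_eq_square field_simps)
  have real: "h * (a * a - b * b) \<le> a * a + b * b + h\<^sup>2 / 2 * ((a - b) * (a - b))" for a b :: real
  proof -
    have "0 \<le> (h * (a - b) - (a + b))\<^sup>2 / 2 + (a - b)\<^sup>2 / 2" by simp
    also have "\<dots> = a * a + b * b + h\<^sup>2 / 2 * ((a - b) * (a - b)) - h * (a * a - b * b)"
      by (simp add: power2_eq_square field_simps)
    finally show ?thesis by simp
  qed
  have "qle 2 (test_L \<alpha> s u) (complex_of_real (1 - h) \<cdot>\<^sub>m 1\<^sub>m 2)"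
  proof (rule qleI)
    fix v :: "complex vec" assume v: "v \<in> carrier_vec 2"
    have ineq: "- 2 * h * (cmod (v $ 1))\<^sup>2 - h\<^sup>2 / 2 * (cmod (v $ 0 - v $ 1))\<^sup>2 \<le> (1 - h) * ((cmod (v $ 0))\<^sup>2 + (cmod (v $ 1))\<^sup>2)"
      using real[of "Re (v $ 0)" "Re (v $ 1)"] real[of "Im (v $ 0)" "Im (v $ 1)"]
      unfolding cmod_power2 by (simp add: power2_eq_square algebra_simps)
    have e: "- (1 - \<alpha>) * s = - 2 * h" by (simp add: h_def algebra_simps)
    show "qform (test_L \<alpha> s u) v \<le> qform (complex_of_real (1 - h) \<cdot>\<^sub>m 1\<^sub>m 2) v"
      unfolding test_L_qform[OF v] w e qform_smult[OF one_carrier_mat v] qform_one[OF v]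
        cscalar_prod_self_Re[OF v] sum_lessThan_2 by (rule ineq)
  qed
  then have "eigvals_desc (test_L \<alpha> s u) ! 0 \<le> 1 - h" by (rule max_eigval_le[OF test_L_herm]) simp
  then show ?thesis unfolding test_LE using max_eigval_exp[OF test_L_herm, of \<alpha> s u] by (simp add: h_def)
qed

text \<open>The test vector (1, 1) lies in the kernel of \<open>proj_J\<close>, so only log X
  contributes and the bound is independent of \<open>u\<close>.\<close>

lemma test_LE_lower:
  "exp (- (1 - \<alpha>) * s / 2) \<le> eigvals_desc (weighted_LE (1 - \<alpha>) \<alpha> (test_X s) (test_Y u)) ! 0"
proof -
  define v :: "complex vec" where "v = vec 2 (\<lambda>_. 1)"
  have v: "v \<in> carrier_vec 2" by (simp add: v_def)
  have "- (1 - \<alpha>) * s \<le> eigvals_desc (test_L \<alpha> s u) ! 0 * 2"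
    using max_eigval_ge_qform[OF test_L_herm v, of \<alpha> s u]
    unfolding test_L_qform[OF v] cscalar_prod_self_Re[OF v] by (simp add: v_def sum_lessThan_2)
  then show ?thesis unfolding test_LE using max_eigval_exp[OF test_L_herm, of \<alpha> s u] by simp
qed

section \<open>Largest eigenvalues of the other means of the test pair\<close>

lemma test_LE_pd: "weighted_LE (1 - \<alpha>) \<alpha> (test_X s) (test_Y u) \<in> psd_mats 2"
  by (intro weighted_LE_psd pd_imp_psd) simp_all

lemma log_maj_max_eigval: "log_maj n X Y \<Longrightarrow> 0 < n \<Longrightarrow> eigvals_desc X ! 0 \<le> eigvals_desc Y ! 0"
  unfolding log_maj_def by (auto dest!: bspec[of _ _ 1])

text \<open>From D \<le> 1 follows D \<le> D^(1/2), and undoing the sandwich gives Y \<le> E. For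
  \<alpha> > 0, Y \<le> Y^\<alpha> \<le> E^\<alpha> = C bounds the entry (0, 0) of C below by 1/2.
  Since X has weight 1 on coordinate 0, the entry (0, 0) of C X C is at least the square of
  this.\<close>

lemma SG_core_test_lower:
  assumes "0 \<le> \<alpha>" "\<alpha> \<le> 1" "0 \<le> s" "0 \<le> u"
  shows "1/4 \<le> eigvals_desc (SG_core \<alpha> (test_X s) (test_Y u)) ! 0"
proof -
  let ?X = "test_X s" and ?Y = "test_Y u" and ?D = "test_D s u"
  have Xp: "?X \<in> psd_mats 2" and Yp: "?Y \<in> psd_mats 2" and Dp: "?D \<in> psd_mats 2" by (simp_all add: pd_imp_psd)
  define E where "E = geo_mean (1/2) (mat_powr ?X (- 1)) ?Y"
  have E: "E \<in> psd_mats 2" unfolding E_def using Xp Yp by (intro geo_mean_psd) auto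
  have Eeq: "E = mat_powr ?X (- (1/2)) * mat_powr ?D (1/2) * mat_powr ?X (- (1/2))"
    unfolding E_def geo_mean_inverse[OF Xp] test_D_def ..
  have "qle 2 ?D (mat_powr ?D (1/2))" by (intro qle_mat_powr_contraction[OF Dp test_D_le_one]) (use assms in auto)
  then have "qle 2 (mat_powr ?X (- (1/2)) * ?D * mat_powr ?X (- (1/2))) E"
    unfolding Eeq using Xp Dp by (intro qle_congruence_herm) auto
  also have "mat_powr ?X (- (1/2)) * ?D * mat_powr ?X (- (1/2)) = ?Y"
    unfolding test_D_def by (rule pd_sandwich_cancel(2)[OF test_X_pd pd_carrier[OF test_Y_pd]])
  finally have YE: "qle 2 ?Y E" .
  define C where "C = mat_powr E \<alpha>"
  have C: "C \<in> psd_mats 2" unfolding C_def using E by simp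
  have "1/2 \<le> Re (C $$ (0, 0))"
  \<comment> \<open>Exponent 0 lies outside \<open>loewner_heinz\<close>; there C is the identity
    because E is invertible.\<close>
  proof (cases "\<alpha> = 0")
    case False
    have "qle 2 ?Y (mat_powr ?Y \<alpha>)" using assms by (intro qle_mat_powr_contraction[OF Yp test_Y_le_one]) auto
    also have "qle 2 (mat_powr ?Y \<alpha>) C" unfolding C_def using assms False by (intro loewner_heinz[OF Yp E YE]) auto
    finally show ?thesis
      using qle_diag[of 2 ?Y C 0] C Yp test_Y_diag[of 0 u] by (auto intro: order_trans[rotated])
  next
    case True
    have "E \<in> pd_mats 2" unfolding Eeq by (intro pd_congruence') auto
    then show ?thesis unfolding C_def True by simp
  qed
  moreover have "(Re (C $$ (0, 0)))\<^sup>2 \<le> Re ((C * ?X * C) $$ (0, 0))"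
  proof -
    have cv: "C *\<^sub>v unit_vec 2 0 \<in> carrier_vec 2" using C by simp
    have "(Re (C $$ (0, 0)))\<^sup>2 \<le> (cmod (C $$ (0, 0)))\<^sup>2" by (simp add: cmod_power2)
    also have "\<dots> \<le> qform ?X (C *\<^sub>v unit_vec 2 0)"
    proof -
      have "C $$ (0, 0) = (C *\<^sub>v unit_vec 2 0) $ 0" using C by (simp add: scalar_prod_right_unit[of _ 2])
      then show ?thesis unfolding test_X_def qform_rdiag[OF cv] sum_lessThan_2 by simp
    qed
    also have "\<dots> = Re ((C * ?X * C) $$ (0, 0))"
      using qform_unit_vec[of "C * ?X * C" 2 0] C Xp
        qform_congruence[OF psd_carrier[OF Xp] psd_carrier[OF C], of "unit_vec 2 0"] herm_adjoint[OF psd_herm[OF C]] by simp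
    finally show ?thesis .
  qed
  moreover have "Re ((C * ?X * C) $$ (0, 0)) \<le> eigvals_desc (SG_core \<alpha> ?X ?Y) ! 0"
    unfolding SG_core_def Let_def E_def[symmetric] C_def[symmetric]
    using C Xp by (intro max_eigval_ge_diag[where n = 2] herm_congruence') auto
  moreover have "(1/2)\<^sup>2 \<le> (Re (C $$ (0, 0)))\<^sup>2" if "1/2 \<le> Re (C $$ (0, 0))"
    using that by (intro power_mono) auto
  ultimately show ?thesis by (simp add: power2_eq_square)
qed

text \<open>The outer factors have the entry 1 at position 0, so they keep the entry (0, 0) of
  D^\<alpha>, which is at least that of D because D \<le> 1.\<close>

lemma SGt_core_test_lower_small:
  assumes "0 \<le> \<alpha>" "\<alpha> \<le> 1" "0 \<le> s" "0 \<le> u"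
  shows "1/2 \<le> eigvals_desc (SGt_core \<alpha> (test_X s) (test_Y u)) ! 0"
proof -
  have Dp: "test_D s u \<in> psd_mats 2" by (simp add: pd_imp_psd)
  have "1/2 \<le> Re (test_D s u $$ (0, 0))" by (simp add: test_D_diag)
  also have "\<dots> \<le> Re (mat_powr (test_D s u) \<alpha> $$ (0, 0))"
    using assms Dp by (intro qle_diag[OF qle_mat_powr_contraction[OF Dp test_D_le_one]]) auto
  also have "\<dots> = Re ((mat_powr (test_X s) (1/2 - \<alpha>) * mat_powr (test_D s u) \<alpha> * mat_powr (test_X s) (1/2 - \<alpha>)) $$ (0, 0))"
    using Dp by (simp add: sandwich_diag)
  also have "\<dots> \<le> eigvals_desc (mat_powr (test_X s) (1/2 - \<alpha>) * mat_powr (test_D s u) \<alpha> * mat_powr (test_X s) (1/2 - \<alpha>)) ! 0"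
    by (intro max_eigval_ge_diag[where n = 2] herm_congruence') auto
  finally show ?thesis
    unfolding eigvals_SGt_core[OF test_X_pd pd_imp_psd[OF test_Y_pd]] test_D_def .
qed

text \<open>At position 1 the outer factors contribute e^((2\<alpha> - 1) s), and D has an entry of
  at least e^-s/2. The power is bounded below by the linear function in x^\<alpha> \<ge> m^(\<alpha>
  - 1) (x - m), with m half of that entry's bound, so the entry of D^\<alpha> is at least
  m^\<alpha>.\<close>

lemma SGt_core_test_lower_large:
  assumes \<alpha>: "1 \<le> \<alpha>"
  shows "exp ((\<alpha> - 1) * s) * (1/4) powr \<alpha> \<le> eigvals_desc (SGt_core \<alpha> (test_X s) (test_Y u)) ! 0"
proof -
  let ?D = "test_D s u"
  have Dp: "?D \<in> psd_mats 2" and Dh: "?D \<in> herm_mats 2" by (simp_all add: pd_imp_psd)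
  define m where "m = exp (- s) / 4"
  have m: "0 < m" by (simp add: m_def)
  have "qle 2 (mat_fun (\<lambda>x. m powr (\<alpha> - 1) * (x + (- m) * 1)) ?D) (mat_fun (\<lambda>x. x powr \<alpha>) ?D)"
  proof (rule mat_fun_mono[OF Dh])
    fix x assume "x \<in> real_spectrum ?D"
    then have x: "0 < x" using pd_spectrum[OF test_D_pd] by blast
    show "m powr (\<alpha> - 1) * (x + (- m) * 1) \<le> x powr \<alpha>"
    proof (cases "x \<le> m")
      case True
      then have "m powr (\<alpha> - 1) * (x + (- m) * 1) \<le> 0" by (intro mult_nonneg_nonpos) auto
      then show ?thesis by (meson order_trans powr_ge_zero)
    next
      case False
      have "m powr (\<alpha> - 1) * (x + (- m) * 1) \<le> x powr (\<alpha> - 1) * x"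
        using False m x \<alpha> by (intro mult_mono powr_mono2) auto
      also have "\<dots> = x powr \<alpha>" using x powr_add[of x "\<alpha> - 1" 1] by simp
      finally show ?thesis .
    qed
  qed
  then have le: "qle 2 (complex_of_real (m powr (\<alpha> - 1)) \<cdot>\<^sub>m (?D + complex_of_real (- m) \<cdot>\<^sub>m 1\<^sub>m 2)) (mat_powr ?D \<alpha>)"
    unfolding mat_powr_psd_eq[OF Dp] mat_fun_smult[OF Dh, symmetric] mat_fun_add[OF Dh, symmetric]
      mat_fun_id[OF Dh] mat_fun_const_1[OF Dh] .
  have "m powr \<alpha> = m powr (\<alpha> - 1) * m" using m powr_add[of m "\<alpha> - 1" 1] by simp
  also have "\<dots> \<le> m powr (\<alpha> - 1) * (Re (?D $$ (1, 1)) - m)"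
    unfolding test_D_diag by (intro mult_left_mono) (auto simp: m_def)
  also have "\<dots> = Re ((complex_of_real (m powr (\<alpha> - 1)) \<cdot>\<^sub>m (?D + complex_of_real (- m) \<cdot>\<^sub>m 1\<^sub>m 2)) $$ (1, 1))"
    using pd_carrier[OF test_D_pd, of s u] by simp
  also have "\<dots> \<le> Re (mat_powr ?D \<alpha> $$ (1, 1))"
    using Dp by (intro qle_diag[OF le]) auto
  finally have lower: "m powr \<alpha> \<le> Re (mat_powr ?D \<alpha> $$ (1, 1))" .
  have "exp ((\<alpha> - 1) * s) * (1/4) powr \<alpha> = exp (- s * (1/2 - \<alpha>)) * exp (- s * (1/2 - \<alpha>)) * m powr \<alpha>"
    unfolding m_def by (simp add: powr_divide powr_def exp_add[symmetric] ln_div algebra_simps)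
  also have "\<dots> \<le> exp (- s * (1/2 - \<alpha>)) * exp (- s * (1/2 - \<alpha>)) * Re (mat_powr ?D \<alpha> $$ (1, 1))"
    using lower by (intro mult_left_mono) auto
  also have "\<dots> = Re ((mat_powr (test_X s) (1/2 - \<alpha>) * mat_powr ?D \<alpha> * mat_powr (test_X s) (1/2 - \<alpha>)) $$ (1, 1))"
    using sandwich_diag[OF psd_carrier[OF mat_powr_psd[OF Dp]], of 1 s "1/2 - \<alpha>" \<alpha>] by simp
  also have "\<dots> \<le> eigvals_desc (mat_powr (test_X s) (1/2 - \<alpha>) * mat_powr ?D \<alpha> * mat_powr (test_X s) (1/2 - \<alpha>)) ! 0"
    by (intro max_eigval_ge_diag[where n = 2] herm_congruence') auto
  finally show ?thesis
    unfolding eigvals_SGt_core[OF test_X_pd pd_imp_psd[OF test_Y_pd]] test_D_def .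
qed

lemma sandwich_affine:
  fixes K D :: "complex mat"
  assumes "K \<in> carrier_mat n n" "D \<in> carrier_mat n n"
  shows "K * (a \<cdot>\<^sub>m (D + q \<cdot>\<^sub>m 1\<^sub>m n)) * K = a \<cdot>\<^sub>m (K * D * K + q \<cdot>\<^sub>m (K * K))"
  using assms
  by (simp add: mat_mult_smult mat_smult_mult mat_mult_add mat_add_mult right_mult_one_mat[of _ n n])

text \<open>The choice u = s gives X and Y the same determinant q = e^-s, so the eigenvalues of D
  satisfy d0 d1 = q^2, and their sum, the trace, is at least 1/2. Hence x + q = sqrt x (sqrt d0 +
  sqrt d1) for either eigenvalue x, and D^(1/2) \<le> sqrt 2 (D + q). Undoing the sandwich gives E
  \<le> sqrt 2 (Y + q X^-1) \<le> 2 sqrt 2, and the square of E^\<alpha> is at most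
  8^\<alpha>.\<close>

lemma SG_core_test_upper:
  assumes \<alpha>: "0 < \<alpha>" and s: "0 \<le> s"
  shows "eigvals_desc (SG_core \<alpha> (test_X s) (test_Y s)) ! 0 \<le> 8 powr \<alpha>"
proof -
  let ?X = "test_X s" and ?Y = "test_Y s" and ?D = "test_D s s"
  have Xp: "?X \<in> psd_mats 2" and Yp: "?Y \<in> psd_mats 2" and Dp: "?D \<in> psd_mats 2" and Dh: "?D \<in> herm_mats 2"
    by (simp_all add: pd_imp_psd)
  define q where "q = exp (- s)"
  have q: "0 < q" "q \<le> 1" using s by (auto simp: q_def)
  obtain U d where U: "U \<in> unitary_mats 2" and De: "?D = U * rdiag 2 d * mat_adjoint U" and sp: "real_spectrum ?D = d ` {..<2}"
    using herm_cases[OF Dh] by metis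
  have d: "0 < d 0" "0 < d 1" using pd_spectrum[OF test_D_pd[of s s], of "d 0"] pd_spectrum[OF test_D_pd[of s s], of "d 1"] sp by auto
  have detX: "real_det ?X = q"
    unfolding test_X_def real_det_def using det_spectral[OF unitary_one, of 2 "\<lambda>i. if i = 0 then 1 else exp (- s)"]
    by (simp add: numeral_2_eq_2 q_def)
  have detY: "real_det ?Y = q"
    unfolding test_Y_def real_det_mat_exp[OF herm_smult[OF proj_J_herm]] real_trace_smult[OF herm_carrier[OF proj_J_herm]]
    by (simp add: real_trace_def proj_J_def numeral_2_eq_2 q_def)
  have "d 0 * d 1 = real_det ?D"
    using det_spectral[OF U, of d] De by (simp add: real_det_def numeral_2_eq_2)
  also have "\<dots> = q * q"
    unfolding test_D_def real_det_mult3[OF mat_powr_herm[OF Xp] psd_herm[OF Yp] mat_powr_herm[OF Xp]]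
      real_det_mat_powr[OF Xp] detX detY using q by (simp add: powr_half_sqrt)
  finally have dd: "d 0 * d 1 = q * q" .
  have "d 0 + d 1 = real_trace ?D" using real_trace_spectral[OF U, of d] De by (simp add: sum_lessThan_2)
  also have "\<dots> \<ge> 1/2"
    using test_D_diag[of s s] by (simp add: real_trace_def pd_dim(1)[OF test_D_pd] sum_lessThan_2 add_increasing2)
  finally have dt: "1/2 \<le> d 0 + d 1" .
  have sq: "sqrt (d 0) * sqrt (d 1) = q" using dd q by (simp add: real_sqrt_mult[symmetric])
  have st: "1/2 \<le> (sqrt (d 0) + sqrt (d 1))\<^sup>2"
    using dt d sq q by (simp add: power2_sum)
  have root: "1 \<le> sqrt 2 * (sqrt (d 0) + sqrt (d 1))"
  proof -
    have "sqrt (1/2) \<le> sqrt ((sqrt (d 0) + sqrt (d 1))\<^sup>2)" using st by (rule real_sqrt_le_mono)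
    then have "sqrt (1/2) \<le> sqrt (d 0) + sqrt (d 1)" using d by simp
    then have "sqrt 2 * sqrt (1/2) \<le> sqrt 2 * (sqrt (d 0) + sqrt (d 1))" by (intro mult_left_mono) auto
    then show ?thesis by (simp add: real_sqrt_mult[symmetric])
  qed
  have chord: "x powr (1/2) \<le> sqrt 2 * (x + q * 1)" if "x \<in> real_spectrum ?D" for x
  proof -
    have x: "x = d 0 \<or> x = d 1" using that unfolding sp by (auto simp: less_2_cases_iff)
    have "x + q = sqrt x * (sqrt (d 0) + sqrt (d 1))"
      using x d sq by (auto simp: distrib_left mult.commute)
    then have "sqrt 2 * (x + q) = sqrt x * (sqrt 2 * (sqrt (d 0) + sqrt (d 1)))" by simp
    also have "\<dots> \<ge> sqrt x * 1" using root x d by (intro mult_left_mono) auto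
    finally show ?thesis using x d by (auto simp: powr_half_sqrt)
  qed
  define E where "E = geo_mean (1/2) (mat_powr ?X (- 1)) ?Y"
  have E: "E \<in> psd_mats 2" unfolding E_def using Xp Yp by (intro geo_mean_psd) auto
  have Eeq: "E = mat_powr ?X (- (1/2)) * mat_powr ?D (1/2) * mat_powr ?X (- (1/2))"
    unfolding E_def geo_mean_inverse[OF Xp] test_D_def ..
  let ?Z = "complex_of_real (sqrt 2) \<cdot>\<^sub>m (?D + complex_of_real q \<cdot>\<^sub>m 1\<^sub>m 2)"
  have "qle 2 (mat_powr ?D (1/2)) ?Z"
    using mat_fun_mono[OF Dh, of "\<lambda>x. x powr (1/2)" "\<lambda>x. sqrt 2 * (x + q * 1)", OF chord]
    unfolding mat_powr_psd_eq[OF Dp] mat_fun_smult[OF Dh, symmetric] mat_fun_add[OF Dh, symmetric]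
      mat_fun_id[OF Dh] mat_fun_const_1[OF Dh] .
  then have "qle 2 E (mat_powr ?X (- (1/2)) * ?Z * mat_powr ?X (- (1/2)))"
    unfolding Eeq using Xp Dp by (intro qle_congruence_herm) auto
  also have "mat_powr ?X (- (1/2)) * ?Z * mat_powr ?X (- (1/2)) = complex_of_real (sqrt 2) \<cdot>\<^sub>m (?Y + complex_of_real q \<cdot>\<^sub>m mat_powr ?X (- 1))"
  proof -
    have "mat_powr ?X (- (1/2)) * ?D * mat_powr ?X (- (1/2)) = ?Y"
      unfolding test_D_def by (rule pd_sandwich_cancel(2)[OF test_X_pd pd_carrier[OF test_Y_pd]])
    moreover have "mat_powr ?X (- (1/2)) * mat_powr ?X (- (1/2)) = mat_powr ?X (- 1)"
      using mat_powr_mult[OF Xp, of "- (1/2)" "- (1/2)"] by simp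
    ultimately show ?thesis
      using sandwich_affine[OF mat_powr_carrier[OF Xp] psd_carrier[OF Dp]] by simp
  qed
  finally have EZ: "qle 2 E (complex_of_real (sqrt 2) \<cdot>\<^sub>m (?Y + complex_of_real q \<cdot>\<^sub>m mat_powr ?X (- 1)))" .
  have "qle 2 E (complex_of_real (2 * sqrt 2) \<cdot>\<^sub>m 1\<^sub>m 2)"
  proof (rule qleI)
    fix v :: "complex vec" assume v: "v \<in> carrier_vec 2"
    have "q * qform (mat_powr ?X (- 1)) v \<le> Re (v \<bullet>c v)"
    proof -
      have "q * qform (mat_powr ?X (- 1)) v = q * (cmod (v $ 0))\<^sup>2 + (q * exp (- s * - 1)) * (cmod (v $ 1))\<^sup>2"
        unfolding test_X_powr qform_rdiag[OF v] sum_lessThan_2 by (simp add: distrib_left mult.assoc)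
      also have "q * exp (- s * - 1) = 1" by (simp add: q_def exp_minus)
      also have "q * (cmod (v $ 0))\<^sup>2 \<le> 1 * (cmod (v $ 0))\<^sup>2" using q by (intro mult_right_mono) auto
      finally show ?thesis unfolding cscalar_prod_self_Re[OF v] sum_lessThan_2 by simp
    qed
    moreover have "qform ?Y v \<le> Re (v \<bullet>c v)" using qleD[OF test_Y_le_one[OF s] v] v by (simp add: qform_one)
    moreover have "qform E v \<le> sqrt 2 * (qform ?Y v + q * qform (mat_powr ?X (- 1)) v)"
      using qleD[OF EZ v] v Xp Yp qform_smult[of "?Y + complex_of_real q \<cdot>\<^sub>m mat_powr ?X (- 1)" 2 v "sqrt 2"]
      by (simp add: qform_add[of _ 2] qform_smult[of _ 2])
    moreover have "sqrt 2 * (qform ?Y v + q * qform (mat_powr ?X (- 1)) v) \<le> sqrt 2 * (Re (v \<bullet>c v) + Re (v \<bullet>c v))"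
      using calculation by (intro mult_left_mono) auto
    ultimately have "qform E v \<le> sqrt 2 * (Re (v \<bullet>c v) + Re (v \<bullet>c v))" by linarith
    then show "qform E v \<le> qform (complex_of_real (2 * sqrt 2) \<cdot>\<^sub>m 1\<^sub>m 2) v"
      using v qform_smult[of "1\<^sub>m 2" 2 v "2 * sqrt 2"] by (simp add: qform_one)
  qed
  then have spE: "x \<le> 2 * sqrt 2" if "x \<in> real_spectrum E" for x
    using qle_spectrum_le[OF psd_herm[OF E] _ that] by blast
  define C where "C = mat_powr E \<alpha>"
  have C: "C \<in> psd_mats 2" unfolding C_def using E by simp
  have "qle 2 (C * C) (complex_of_real (8 powr \<alpha>) \<cdot>\<^sub>m 1\<^sub>m 2)"
  proof -
    have "C * C = mat_powr E (\<alpha> + \<alpha>)" unfolding C_def using E by (simp add: mat_powr_mult)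
    moreover have "qle 2 (mat_powr E (\<alpha> + \<alpha>)) (complex_of_real (8 powr \<alpha>) \<cdot>\<^sub>m 1\<^sub>m 2)"
    proof (rule qle_one_spectrum)
      fix y assume "y \<in> real_spectrum (mat_powr E (\<alpha> + \<alpha>))"
      then obtain x where x: "x \<in> real_spectrum E" "y = x powr (\<alpha> + \<alpha>)"
        unfolding real_spectrum_mat_powr[OF E] by auto
      have "y \<le> (2 * sqrt 2) powr (\<alpha> + \<alpha>)"
        unfolding x(2) using psd_spectrum[OF E x(1)] spE[OF x(1)] \<alpha> by (intro powr_mono2) auto
      also have "\<dots> = ((2 * sqrt 2) * (2 * sqrt 2)) powr \<alpha>" by (simp only: powr_add powr_mult)
      also have "(2 * sqrt 2) * (2 * sqrt 2) = (8 :: real)" by simp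
      finally show "y \<le> 8 powr \<alpha>" .
    qed (use E in simp)
    ultimately show ?thesis by simp
  qed
  moreover have "qle 2 (C * ?X * C) (C * C)"
  proof -
    have "qle 2 (C * ?X * C) (C * 1\<^sub>m 2 * C)" using C Xp test_X_le_one[OF s] by (intro qle_congruence_herm) auto
    then show ?thesis using C by (simp add: right_mult_one_mat[of _ 2 2])
  qed
  ultimately have "qle 2 (C * ?X * C) (complex_of_real (8 powr \<alpha>) \<cdot>\<^sub>m 1\<^sub>m 2)" by (meson qle_trans)
  then show ?thesis
    unfolding SG_core_def Let_def E_def[symmetric] C_def[symmetric]
    using C Xp by (intro max_eigval_le herm_congruence') auto
qed

section \<open>Choice of the parameters for the counterexamples\<close>

theorem SG_mean_not_log_maj_LE_mean:
  assumes \<alpha>: "0 < \<alpha>" "\<alpha> < 1" and p: "0 < p"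
  shows "\<exists>A \<in> pd_mats 2. \<exists>B \<in> pd_mats 2. \<not> log_maj 2 (SG_mean \<alpha> p A B) (LE_mean \<alpha> A B)"
proof -
  \<comment> \<open>Brings the upper bound for the Log-Euclidean mean down to 1/8, below the lower
    bound 1/4 for the other mean.\<close>
  define s where "s = 2 * (1 + ln 8) / (1 - \<alpha>)"
  define u where "u = ((1 - \<alpha>) * s)\<^sup>2 / (4 * \<alpha>)"
  have su: "0 \<le> s" "0 \<le> u" using \<alpha> by (auto simp: s_def u_def)
  let ?X = "test_X s" and ?Y = "test_Y u"
  have "\<not> log_maj 2 (SG_core \<alpha> ?X ?Y) (weighted_LE (1 - \<alpha>) \<alpha> ?X ?Y)"
  proof
    assume "log_maj 2 (SG_core \<alpha> ?X ?Y) (weighted_LE (1 - \<alpha>) \<alpha> ?X ?Y)"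
    then have "1/4 \<le> exp (1 - (1 - \<alpha>) * s / 2)"
      using log_maj_max_eigval[of 2] SG_core_test_lower[OF _ _ su, of \<alpha>] test_LE_upper[OF \<alpha>(1) u_def] \<alpha> by fastforce
    also have "1 - (1 - \<alpha>) * s / 2 = - ln 8"
    proof -
      have "(1 - \<alpha>) * s = 2 * (1 + ln 8)" using \<alpha> by (simp add: s_def)
      then show ?thesis by (simp add: add_divide_distrib)
    qed
    also have "exp (- ln 8) = (1/8 :: real)" by (simp add: exp_minus)
    finally show False by simp
  qed
  then have "\<not> log_maj 2 (mat_powr (SG_core \<alpha> ?X ?Y) (1/p)) (mat_powr (weighted_LE (1 - \<alpha>) \<alpha> ?X ?Y) (1/p))"
    using log_maj_mat_powr_iff[OF SG_core_psd[OF pd_imp_psd[OF test_X_pd] pd_imp_psd[OF test_Y_pd]] test_LE_pd, of "1/p" \<alpha> s u \<alpha>] p by simp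
  moreover obtain A B where AB: "A \<in> pd_mats 2" "B \<in> pd_mats 2"
    and e: "\<forall>\<alpha>. LE_mean \<alpha> A B = mat_powr (weighted_LE (1 - \<alpha>) \<alpha> ?X ?Y) (1/p) \<and>
      SG_mean \<alpha> p A B = mat_powr (SG_core \<alpha> ?X ?Y) (1/p) \<and>
      SGt_mean \<alpha> p A B = mat_powr (SGt_core \<alpha> ?X ?Y) (1/p)"
    using counterexample_exponent[OF test_X_pd[of s] test_Y_pd[of u] p] by blast
  ultimately show ?thesis using AB by (intro bexI[of _ A] bexI[of _ B]) (simp_all add: e)
qed

theorem LE_mean_not_log_maj_SG_mean:
  assumes \<alpha>: "1 < \<alpha>" and p: "0 < p"
  shows "\<exists>A \<in> pd_mats 2. \<exists>B \<in> pd_mats 2. \<not> log_maj 2 (LE_mean \<alpha> A B) (SG_mean \<alpha> p A B)"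
proof -
  \<comment> \<open>Makes the lower bound for the Log-Euclidean mean e times the upper bound
    8^\<alpha> for the other mean.\<close>
  define s where "s = 2 * (1 + \<alpha> * ln 8) / (\<alpha> - 1)"
  have s: "0 \<le> s" using \<alpha> by (auto simp: s_def)
  let ?X = "test_X s" and ?Y = "test_Y s"
  have "\<not> log_maj 2 (weighted_LE (1 - \<alpha>) \<alpha> ?X ?Y) (SG_core \<alpha> ?X ?Y)"
  proof
    assume "log_maj 2 (weighted_LE (1 - \<alpha>) \<alpha> ?X ?Y) (SG_core \<alpha> ?X ?Y)"
    then have "exp (- (1 - \<alpha>) * s / 2) \<le> 8 powr \<alpha>"
      using log_maj_max_eigval[of 2] SG_core_test_upper[OF _ s, of \<alpha>] test_LE_lower[of \<alpha> s s] \<alpha> by fastforce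
    moreover have "- (1 - \<alpha>) * s / 2 = 1 + \<alpha> * ln 8"
    proof -
      have "- (1 - \<alpha>) * s = 2 * (1 + \<alpha> * ln 8)" unfolding s_def using \<alpha> by simp
      then show ?thesis by simp
    qed
    ultimately have "exp (1 + \<alpha> * ln 8) \<le> exp (\<alpha> * ln 8)" by (simp add: powr_def)
    then show False by simp
  qed
  then have "\<not> log_maj 2 (mat_powr (weighted_LE (1 - \<alpha>) \<alpha> ?X ?Y) (1/p)) (mat_powr (SG_core \<alpha> ?X ?Y) (1/p))"
    using log_maj_mat_powr_iff[OF test_LE_pd SG_core_psd[OF pd_imp_psd[OF test_X_pd] pd_imp_psd[OF test_Y_pd]], of "1/p" \<alpha> s s \<alpha>] p by simp
  moreover obtain A B where AB: "A \<in> pd_mats 2" "B \<in> pd_mats 2"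
    and e: "\<forall>\<alpha>. LE_mean \<alpha> A B = mat_powr (weighted_LE (1 - \<alpha>) \<alpha> ?X ?Y) (1/p) \<and>
      SG_mean \<alpha> p A B = mat_powr (SG_core \<alpha> ?X ?Y) (1/p) \<and>
      SGt_mean \<alpha> p A B = mat_powr (SGt_core \<alpha> ?X ?Y) (1/p)"
    using counterexample_exponent[OF test_X_pd[of s] test_Y_pd[of s] p] by blast
  ultimately show ?thesis using AB by (intro bexI[of _ A] bexI[of _ B]) (simp_all add: e)
qed

theorem SGt_mean_not_log_maj_LE_mean:
  assumes \<alpha>: "0 < \<alpha>" "\<alpha> \<noteq> 1" and p: "0 < p"
  shows "\<exists>A \<in> pd_mats 2. \<exists>B \<in> pd_mats 2. \<not> log_maj 2 (SGt_mean \<alpha> p A B) (LE_mean \<alpha> A B)"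
proof -
  \<comment> \<open>One value for both cases. For \<alpha> < 1 the Log-Euclidean bound falls below
    1/4 while the other mean keeps an eigenvalue of at least 1/2. For \<alpha> > 1 the exponents of
    the two bounds are (\<alpha> - 1) s/2 and (\<alpha> - 1) s up to constants, and \<open>s\<close>
    is large enough to outweigh these constants.\<close>
  define s where "s = 2 * (2 + (1 + \<alpha>) * ln 4) / \<bar>1 - \<alpha>\<bar>"
  define u where "u = ((1 - \<alpha>) * s)\<^sup>2 / (4 * \<alpha>)"
  have su: "0 \<le> s" "0 \<le> u" using \<alpha> by (auto simp: s_def u_def)
  let ?X = "test_X s" and ?Y = "test_Y u"
  have "\<not> log_maj 2 (SGt_core \<alpha> ?X ?Y) (weighted_LE (1 - \<alpha>) \<alpha> ?X ?Y)"
  proof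
    assume "log_maj 2 (SGt_core \<alpha> ?X ?Y) (weighted_LE (1 - \<alpha>) \<alpha> ?X ?Y)"
    then have le: "eigvals_desc (SGt_core \<alpha> ?X ?Y) ! 0 \<le> exp (1 - (1 - \<alpha>) * s / 2)"
      using log_maj_max_eigval[of 2] test_LE_upper[OF \<alpha>(1) u_def] by fastforce
    show False
    proof (cases "\<alpha> < 1")
      case True
      have "1/2 \<le> exp (1 - (1 - \<alpha>) * s / 2)"
        using le SGt_core_test_lower_small[OF _ _ su, of \<alpha>] \<alpha> True by simp
      also have "1 - (1 - \<alpha>) * s / 2 = - 1 - (1 + \<alpha>) * ln 4"
      proof -
        have "(1 - \<alpha>) * s = 2 * (2 + (1 + \<alpha>) * ln 4)" using True by (simp add: s_def)
        then show ?thesis by (simp add: add_divide_distrib)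
      qed
      also have "exp \<dots> \<le> exp (- 1 - ln 4)"
        using \<alpha> by (simp add: mult_le_cancel_right1)
      also have "\<dots> \<le> exp (- ln 4)" by simp
      also have "\<dots> = (1/4 :: real)" by (simp add: exp_minus)
      finally show False by simp
    next
      case False
      have "exp ((\<alpha> - 1) * s) * (1/4) powr \<alpha> \<le> exp (1 - (1 - \<alpha>) * s / 2)"
        by (rule order_trans[OF SGt_core_test_lower_large le]) (use False in simp)
      moreover have "exp ((\<alpha> - 1) * s) * (1/4) powr \<alpha> = exp ((\<alpha> - 1) * s - \<alpha> * ln 4)"
        by (simp add: powr_def ln_div flip: exp_add)
      moreover have "1 - (1 - \<alpha>) * s / 2 = 1 + (\<alpha> - 1) * s / 2" by (simp add: field_simps)
      ultimately have "exp ((\<alpha> - 1) * s - \<alpha> * ln 4) \<le> exp (1 + (\<alpha> - 1) * s / 2)" by simp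
      then have "(\<alpha> - 1) * s - \<alpha> * ln 4 \<le> 1 + (\<alpha> - 1) * s / 2" by (simp only: exp_le_cancel_iff)
      then have "(\<alpha> - 1) * s / 2 \<le> 1 + \<alpha> * ln 4" by linarith
      moreover have "(\<alpha> - 1) * s / 2 = 2 + (1 + \<alpha>) * ln 4" using False \<alpha> by (simp add: s_def)
      ultimately have "1 + ln 4 \<le> (0::real)" by (simp add: distrib_right)
      moreover have "0 < ln (4::real)" by (rule ln_gt_zero) simp
      ultimately show False by linarith
    qed
  qed
  then have "\<not> log_maj 2 (mat_powr (SGt_core \<alpha> ?X ?Y) (1/p)) (mat_powr (weighted_LE (1 - \<alpha>) \<alpha> ?X ?Y) (1/p))"
    using log_maj_mat_powr_iff[OF SGt_core_psd[OF pd_imp_psd[OF test_X_pd] pd_imp_psd[OF test_Y_pd]] test_LE_pd, of "1/p" \<alpha> s u \<alpha>] p by simp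
  moreover obtain A B where AB: "A \<in> pd_mats 2" "B \<in> pd_mats 2"
    and e: "\<forall>\<alpha>. LE_mean \<alpha> A B = mat_powr (weighted_LE (1 - \<alpha>) \<alpha> ?X ?Y) (1/p) \<and>
      SG_mean \<alpha> p A B = mat_powr (SG_core \<alpha> ?X ?Y) (1/p) \<and>
      SGt_mean \<alpha> p A B = mat_powr (SGt_core \<alpha> ?X ?Y) (1/p)"
    using counterexample_exponent[OF test_X_pd[of s] test_Y_pd[of u] p] by blast
  ultimately show ?thesis using AB by (intro bexI[of _ A] bexI[of _ B]) (simp_all add: e)
qed

theorem corollary3p18:
  shows
    "(\<forall>\<alpha> p :: real. \<forall>n. \<forall>A \<in> psd_mats n. \<forall>B \<in> psd_mats n.
        1 < \<alpha> \<and> 0 < p \<and> loewner_le (supp_proj B) (supp_proj A) \<longrightarrow>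
        log_maj n (LE_mean \<alpha> A B) (G_mean \<alpha> p A B)) \<and>
     (\<forall>\<alpha> p :: real. 0 < \<alpha> \<and> \<alpha> < 1 \<and> 0 < p \<longrightarrow>
        (\<exists>A \<in> pd_mats 2. \<exists>B \<in> pd_mats 2. \<not> log_maj 2 (SG_mean \<alpha> p A B) (LE_mean \<alpha> A B))) \<and>
     (\<forall>\<alpha> p :: real. 1 < \<alpha> \<and> 0 < p \<longrightarrow>
        (\<exists>A \<in> pd_mats 2. \<exists>B \<in> pd_mats 2. \<not> log_maj 2 (LE_mean \<alpha> A B) (SG_mean \<alpha> p A B))) \<and>
     (\<forall>\<alpha> p :: real. 0 < \<alpha> \<and> \<alpha> \<noteq> 1 \<and> 0 < p \<longrightarrow>
        (\<exists>A \<in> pd_mats 2. \<exists>B \<in> pd_mats 2. \<not> log_maj 2 (SGt_mean \<alpha> p A B) (LE_mean \<alpha> A B))) \<and>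
     (\<forall>\<alpha> p :: real. \<forall>n. \<forall>A \<in> psd_mats n. \<forall>B \<in> psd_mats n.
        0 < \<alpha> \<and> \<alpha> \<le> 1/2 \<and> 0 < p \<and> loewner_le (supp_proj B) (supp_proj A) \<longrightarrow>
        log_maj n (LE_mean \<alpha> A B) (SGt_mean \<alpha> p A B)) \<and>
     (\<forall>\<alpha> p :: real. \<forall>n. \<forall>A \<in> psd_mats n. \<forall>B \<in> psd_mats n.
        1 < \<alpha> \<and> 0 < p \<and> loewner_le (supp_proj B) (supp_proj A) \<longrightarrow>
        log_maj n (LE_mean \<alpha> A B) (SGt_mean \<alpha> p A B))"
  using LE_mean_log_maj_G_mean SG_mean_not_log_maj_LE_mean LE_mean_not_log_maj_SG_mean
    SGt_mean_not_log_maj_LE_mean LE_mean_log_maj_SGt_mean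
  by (intro conjI allI ballI impI) simp_all

end
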